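(* For every graph class $\mathcal{C}$ of bounded expansion and every $d\in\mathbb{N}$, there exist a constant $s\in\mathbb{N}$ and an algorithm running in time $\mathcal{O}(nm)$ that, given a graph $H\in\overline{\mathcal{C}^d}$ with $n$ vertices and $m$ edges, finds a clique in $H$ of size at least $\frac{1}{s}\cdot\omega(H)$.
   Context: All graphs are finite, simple and undirected. $G^d$ is the graph on $V(G)$ where distinct $u,v$ are adjacent iff their distance in $G$ is at most $d$; $\mathcal{C}^d=\{G^d:G\in\mathcal{C}\}$; $\overline{\mathcal{D}}$ denotes the class of all induced subgraphs of graphs in $\mathcal{D}$. $\omega$ is the clique number. A graph is a depth-$r$ minor of $G$ if it is obtained from a subgraph of $G$ by contracting pairwise disjoint connected subgraphs of radius at most $r$; a class $\mathcal{C}$ has bounded expansion if for every $r\in\mathbb{N}$ the ratio of edges to vertices of depth-$r$ minors of graphs in $\mathcal{C}$ is bounded. *)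

theory Defs
  imports Complex_Main "HOL-Library.Extended_Nat" "HOL-Library.Disjoint_Sets"
begin

section \<open>Finite simple graphs\<close>

record 'a ugraph =
  verts :: "'a set"
  edges :: "'a set set"

definition simple_graph :: "'a ugraph \<Rightarrow> bool" where
  "simple_graph G \<longleftrightarrow> finite (verts G) \<and> edges G \<subseteq> {e. e \<subseteq> verts G \<and> card e = 2}"

definition subgraph :: "'a ugraph \<Rightarrow> 'a ugraph \<Rightarrow> bool" where
  "subgraph H G \<longleftrightarrow> simple_graph H \<and> verts H \<subseteq> verts G \<and> edges H \<subseteq> edges G"

definition induced_subgraph :: "'a ugraph \<Rightarrow> 'a ugraph \<Rightarrow> bool" where
  "induced_subgraph H G \<longleftrightarrow> verts H \<subseteq> verts G \<and> edges H = {e \<in> edges G. e \<subseteq> verts H}"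

definition induced_closure :: "'a ugraph set \<Rightarrow> 'a ugraph set" where
  "induced_closure D = {H. \<exists>G\<in>D. induced_subgraph H G}"

definition walk :: "'a ugraph \<Rightarrow> 'a \<Rightarrow> 'a list \<Rightarrow> 'a \<Rightarrow> bool" where
  "walk G u p v \<longleftrightarrow> p \<noteq> [] \<and> hd p = u \<and> last p = v \<and> set p \<subseteq> verts G \<and>
     (\<forall>i. Suc i < length p \<longrightarrow> {p ! i, p ! Suc i} \<in> edges G)"

text \<open>The distance is \<open>\<infinity>\<close> if there is no walk.\<close>
definition gdist :: "'a ugraph \<Rightarrow> 'a \<Rightarrow> 'a \<Rightarrow> enat" where
  "gdist G u v = (INF p \<in> {p. walk G u p v}. enat (length p - 1))"

definition graph_power :: "'a ugraph \<Rightarrow> nat \<Rightarrow> 'a ugraph" where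
  "graph_power G d =
     \<lparr> verts = verts G,
       edges = {{u, v} | u v. u \<in> verts G \<and> v \<in> verts G \<and> u \<noteq> v \<and> gdist G u v \<le> enat d} \<rparr>"

definition class_power :: "'a ugraph set \<Rightarrow> nat \<Rightarrow> 'a ugraph set" where
  "class_power C d = (\<lambda>G. graph_power G d) ` C"

definition clique :: "'a ugraph \<Rightarrow> 'a set \<Rightarrow> bool" where
  "clique G K \<longleftrightarrow> K \<subseteq> verts G \<and> (\<forall>u\<in>K. \<forall>v\<in>K. u \<noteq> v \<longrightarrow> {u, v} \<in> edges G)"

definition clique_number :: "'a ugraph \<Rightarrow> nat" where
  "clique_number G = Max (card ` {K. clique G K})"


section \<open>Bounded expansion\<close>

definition connected_graph :: "'a ugraph \<Rightarrow> bool" where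
  "connected_graph G \<longleftrightarrow> verts G \<noteq> {} \<and> (\<forall>u\<in>verts G. \<forall>v\<in>verts G. \<exists>p. walk G u p v)"

definition radius :: "'a ugraph \<Rightarrow> enat" where
  "radius G = (INF u \<in> verts G. SUP v \<in> verts G. gdist G u v)"

text \<open>
  A contraction of pairwise disjoint connected subgraphs of \<open>S\<close> is given by the partition
  \<open>P\<close> of \<open>verts S\<close> into the vertex sets of these subgraphs, where vertices that are not
  touched by the contraction form singleton parts (connected subgraphs of radius \<open>0\<close>).
  The vertices of the contracted graph are the parts.
\<close>
definition contraction :: "'a ugraph \<Rightarrow> 'a set set \<Rightarrow> 'a set ugraph" where
  "contraction S P =
     \<lparr> verts = P,
       edges = {{A, B} | A B. A \<in> P \<and> B \<in> P \<and> A \<noteq> B \<and> (\<exists>a\<in>A. \<exists>b\<in>B. {a, b} \<in> edges S)} \<rparr>"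

definition depth_minor :: "nat \<Rightarrow> 'a set ugraph \<Rightarrow> 'a ugraph \<Rightarrow> bool" where
  "depth_minor r M G \<longleftrightarrow>
     (\<exists>S P. subgraph S G \<and> partition_on (verts S) P \<and>
        (\<forall>A\<in>P. \<exists>B. subgraph B S \<and> verts B = A \<and> connected_graph B \<and> radius B \<le> enat r) \<and>
        M = contraction S P)"

definition bounded_expansion :: "'a ugraph set \<Rightarrow> bool" where
  "bounded_expansion C \<longleftrightarrow>
     (\<forall>r. \<exists>k::real. \<forall>G\<in>C. \<forall>M. depth_minor r M G \<longrightarrow>
        real (card (edges M)) / real (card (verts M)) \<le> k)"


section \<open>Model of computation: a word RAM\<close>

text \<open>
  Programs are structured programs over finitely many scalar variables (registers) and an
  indirectly addressed memory of natural numbers, in the unit-cost measure.  The parameter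
  \<open>W\<close> bounds all values, including constants, addresses and intermediate results: a
  computation that leaves the range \<open>{0..W}\<close> is stuck, so that it has no result at all.
  Taking \<open>W\<close> polynomial in the input size gives machine words of logarithmic length.
  \<open>Minus\<close> is truncated subtraction; conditions are true iff they are nonzero.
\<close>

datatype expr =
    Const nat
  | Var nat
  | Mem expr
  | Plus expr expr
  | Minus expr expr
  | Times expr expr

datatype com =
    Skip
  | Assign nat expr
  | Store expr expr
  | Seq com com
  | If expr com com
  | While expr com

record state =
  var :: "nat \<Rightarrow> nat"
  mem :: "nat \<Rightarrow> nat"

primrec eval :: "expr \<Rightarrow> state \<Rightarrow> nat" where
  "eval (Const k) s = k"
| "eval (Var i) s = var s i"
| "eval (Mem e) s = mem s (eval e s)"
| "eval (Plus e1 e2) s = eval e1 s + eval e2 s"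
| "eval (Minus e1 e2) s = eval e1 s - eval e2 s"
| "eval (Times e1 e2) s = eval e1 s * eval e2 s"

primrec fits :: "nat \<Rightarrow> expr \<Rightarrow> state \<Rightarrow> bool" where
  "fits W (Const k) s \<longleftrightarrow> k \<le> W"
| "fits W (Var i) s \<longleftrightarrow> var s i \<le> W"
| "fits W (Mem e) s \<longleftrightarrow> fits W e s \<and> mem s (eval e s) \<le> W"
| "fits W (Plus e1 e2) s \<longleftrightarrow> fits W e1 s \<and> fits W e2 s \<and> eval e1 s + eval e2 s \<le> W"
| "fits W (Minus e1 e2) s \<longleftrightarrow> fits W e1 s \<and> fits W e2 s"
| "fits W (Times e1 e2) s \<longleftrightarrow> fits W e1 s \<and> fits W e2 s \<and> eval e1 s * eval e2 s \<le> W"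

primrec cost :: "expr \<Rightarrow> nat" where
  "cost (Const k) = 1"
| "cost (Var i) = 1"
| "cost (Mem e) = cost e + 1"
| "cost (Plus e1 e2) = cost e1 + cost e2 + 1"
| "cost (Minus e1 e2) = cost e1 + cost e2 + 1"
| "cost (Times e1 e2) = cost e1 + cost e2 + 1"

text \<open>\<open>exec W c s t s'\<close>: started in \<open>s\<close>, program \<open>c\<close> halts in \<open>s'\<close> after time \<open>t\<close>.\<close>
inductive exec :: "nat \<Rightarrow> com \<Rightarrow> state \<Rightarrow> nat \<Rightarrow> state \<Rightarrow> bool" for W :: nat where
  Skip: "exec W Skip s 1 s"
| Assign: "fits W e s \<Longrightarrow>
    exec W (Assign i e) s (cost e + 1) (s\<lparr>var := (var s)(i := eval e s)\<rparr>)"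
| Store: "fits W a s \<Longrightarrow> fits W e s \<Longrightarrow>
    exec W (Store a e) s (cost a + cost e + 1) (s\<lparr>mem := (mem s)(eval a s := eval e s)\<rparr>)"
| Seq: "exec W c1 s t1 s' \<Longrightarrow> exec W c2 s' t2 s'' \<Longrightarrow> exec W (Seq c1 c2) s (t1 + t2) s''"
| IfTrue: "fits W e s \<Longrightarrow> eval e s \<noteq> 0 \<Longrightarrow> exec W c1 s t s' \<Longrightarrow>
    exec W (If e c1 c2) s (cost e + 1 + t) s'"
| IfFalse: "fits W e s \<Longrightarrow> eval e s = 0 \<Longrightarrow> exec W c2 s t s' \<Longrightarrow>
    exec W (If e c1 c2) s (cost e + 1 + t) s'"
| WhileFalse: "fits W e s \<Longrightarrow> eval e s = 0 \<Longrightarrow> exec W (While e c) s (cost e + 1) s"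
| WhileTrue: "fits W e s \<Longrightarrow> eval e s \<noteq> 0 \<Longrightarrow> exec W c s t1 s' \<Longrightarrow>
    exec W (While e c) s' t2 s'' \<Longrightarrow> exec W (While e c) s (cost e + 1 + t1 + t2) s''"

inductive_cases SkipE: "exec W Skip s t s'"
inductive_cases AssignE: "exec W (Assign i e) s t s'"
inductive_cases StoreE: "exec W (Store a e) s t s'"
inductive_cases SeqE: "exec W (Seq c1 c2) s t s'"
inductive_cases IfE: "exec W (If e c1 c2) s t s'"
inductive_cases WhileE: "exec W (While e c) s t s'"

lemma exec_deterministic:
  "exec W c s t s' \<Longrightarrow> exec W c s u s'' \<Longrightarrow> u = t \<and> s'' = s'"
proof (induction arbitrary: u s'' rule: exec.induct)
  case (Skip s)
  then show ?case by (elim SkipE) simp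
next
  case (Assign e s i)
  from Assign.prems show ?case by (elim AssignE) simp
next
  case (Store a s e)
  from Store.prems show ?case by (elim StoreE) simp
next
  case (Seq c1 s t1 s1 c2 t2 s2)
  from Seq.prems obtain u1 r u2 where
    run: "exec W c1 s u1 r" "exec W c2 r u2 s''" and u: "u = u1 + u2"
    by (rule SeqE)
  from Seq.IH(1)[OF run(1)] have r: "u1 = t1" "r = s1" by auto
  from Seq.IH(2)[OF run(2)[unfolded r]] u r show ?case by simp
next
  case (IfTrue e s c1 t s' c2)
  from IfTrue.prems obtain v where
    run: "exec W c1 s v s''" and u: "u = cost e + 1 + v"
    by (rule IfE) (use that IfTrue.hyps in auto)
  from IfTrue.IH[OF run] u show ?case by simp
next
  case (IfFalse e s c2 t s' c1)
  from IfFalse.prems obtain v where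
    run: "exec W c2 s v s''" and u: "u = cost e + 1 + v"
    by (rule IfE) (use that IfFalse.hyps in auto)
  from IfFalse.IH[OF run] u show ?case by simp
next
  case (WhileFalse e s c)
  from WhileFalse.prems show ?case by (rule WhileE) (use WhileFalse.hyps in simp_all)
next
  case (WhileTrue e s c t1 s1 t2 s2)
  from WhileTrue.prems obtain u1 r u2 where
    run: "exec W c s u1 r" "exec W (While e c) r u2 s''" and u: "u = cost e + 1 + u1 + u2"
    by (rule WhileE) (use that WhileTrue.hyps in auto)
  from WhileTrue.IH(1)[OF run(1)] have r: "u1 = t1" "r = s1" by auto
  from WhileTrue.IH(2)[OF run(2)[unfolded r]] u r show ?case by simp
qed


section \<open>Graphs as inputs, vertex sets as outputs\<close>

text \<open>
  \<open>adj\<close> is an adjacency-list representation of \<open>H\<close> with vertices numbered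
  \<open>0, \<dots>, n - 1\<close>; the number \<open>i\<close> stands for the vertex \<open>f i\<close>.  The numbering and the order
  of each list are arbitrary.
\<close>
definition adj_lists :: "'a ugraph \<Rightarrow> (nat \<Rightarrow> 'a) \<Rightarrow> nat list list \<Rightarrow> bool" where
  "adj_lists H f adj \<longleftrightarrow>
     bij_betw f {..<length adj} (verts H) \<and>
     (\<forall>i<length adj. distinct (adj ! i) \<and>
        set (adj ! i) = {j. j < length adj \<and> {f i, f j} \<in> edges H})"

text \<open>
  Memory layout: \<open>n\<close>, \<open>m\<close>, then \<open>n + 1\<close> pointers, then the concatenated adjacency lists.
  The list of vertex \<open>i\<close> occupies the addresses from the content of cell \<open>2 + i\<close> up to, but
  excluding, the content of cell \<open>3 + i\<close>.  All other cells and all variables are initially \<open>0\<close>.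
\<close>
definition graph_input :: "nat list list \<Rightarrow> nat list" where
  "graph_input adj =
     length adj # length (concat adj) div 2 #
     map (\<lambda>i. length adj + 3 + length (concat (take i adj))) [0..<length adj + 1] @
     concat adj"

definition initial_state :: "nat list \<Rightarrow> state" where
  "initial_state xs = \<lparr> var = (\<lambda>_. 0), mem = (\<lambda>i. if i < length xs then xs ! i else 0) \<rparr>"

text \<open>The output is a list in memory, with its length in variable 0 and its address in variable 1.\<close>
definition output_set :: "state \<Rightarrow> nat set" where
  "output_set s = mem s ` {var s 1..<var s 1 + var s 0}"

end

(*
  Fraternal augmentation of a graph G of bounded expansion gives every vertex boundedly many labelled
  hubs (w, i) such that two vertices are within distance d iff they share a hub w with labels summing
  to at most d.  Orient every edge of G^d towards a vertex with the smaller label at a common hub: the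
  vertices whose label at w is at most d/2 form a clique, so H is 2c omega-degenerate, and peeling
  vertices of minimum degree puts a maximum clique K into a closed neighborhood X of size O(|K|).
  In X, few hubs are heavy (seen by a constant fraction of X), and vertices with the same heavy hubs and
  labels have almost the same neighborhood in X.  Hence a bounded number of greedily chosen centers is a
  net for the symmetric difference of neighborhoods.  Around the center closest to a typical vertex of K,
  at one of boundedly many scales, the vertices of X with nearly the same neighborhood that are adjacent
  to all the others form a clique of size at least a constant fraction of K.  Trying all centers and
  scales costs O(|X|^2) = O(n deg b) for the peeled vertex b, and the degrees sum up to O(m).
*)
theory Submission imports Defs begin

section \<open>Hub labellings from bounded expansion\<close>

text \<open>The labels are never computed: hubs occur in the analysis only, while the program
  compares neighborhoods inside X. A single threshold between heavy and light hubs would not do. The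
  number of types at threshold N is exponential in N, and light hubs must be rarer than the share of
  X that one type of K can have, which itself depends on N. So there is a tower of thresholds, each
  chosen after the number of types at the one before, and averaging over the hubs of X yields two
  consecutive thresholds such that at least half of K has no hub between them. Which pair it is
  depends on the unknown hubs, hence the search over all scales; the net is taken at the finest one.
  The time bound is constant for m = 0 and only linear in n for m = 1. So an edgeless graph is
  recognized from two pointers, and the n by n matrix is filled in time O(n + m), as untouched
  memory is zero. Peeling is charged to degrees: every round lowers their sum by twice the degree of
  the peeled vertex.\<close>

lemma walk_single: "v \<in> verts G \<Longrightarrow> walk G v [v] v"
  by (simp add: walk_def)

lemma walk_rev:
  assumes "walk G u p v"
  shows "walk G v (rev p) u"
proof -
  have "{rev p ! i, rev p ! Suc i} \<in> edges G" if "Suc i < length p" for i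
  proof -
    have "Suc (length p - Suc (Suc i)) < length p" using that by simp
    then have "{p ! (length p - Suc (Suc i)), p ! Suc (length p - Suc (Suc i))} \<in> edges G"
      using assms unfolding walk_def by blast
    moreover have "Suc (length p - Suc (Suc i)) = length p - Suc i" using that by simp
    ultimately show ?thesis using that by (simp add: rev_nth insert_commute)
  qed
  then show ?thesis using assms by (auto simp: walk_def hd_rev last_rev)
qed

lemma walk_append:
  assumes "walk G u p v" "walk G v q w"
  shows "walk G u (p @ tl q) w"
proof -
  obtain q' where q: "q = v # q'" using assms(2) by (cases q) (auto simp: walk_def)
  have lp: "last p = v" "p \<noteq> []" using assms(1) by (auto simp: walk_def)
  have "{(p @ q') ! i, (p @ q') ! Suc i} \<in> edges G" if i: "Suc i < length (p @ q')" for i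
  proof -
    consider "Suc i < length p" | "Suc i = length p" | "i \<ge> length p" by linarith
    then show ?thesis
    proof cases
      case 1 then show ?thesis using assms(1) by (simp add: walk_def nth_append)
    next
      case 2
      have "{q ! 0, q ! Suc 0} \<in> edges G" using assms(2) 2 i q by (auto simp: walk_def)
      moreover have "p ! i = v" using 2 lp by (metis diff_Suc_1 last_conv_nth)
      ultimately show ?thesis using 2 q by (simp add: nth_append)
    next
      case 3
      have "Suc (Suc (i - length p)) < length q" using i q 3 by simp
      then have "{q ! Suc (i - length p), q ! Suc (Suc (i - length p))} \<in> edges G"
        using assms(2) by (auto simp: walk_def)
      then show ?thesis using 3 q by (simp add: nth_append Suc_diff_le)
    qed
  qed
  then show ?thesis using assms q lp by (auto simp: walk_def)
qed

lemma walk_take: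
  assumes "walk G u p v" "i < length p"
  shows "walk G u (take (Suc i) p) (p ! i)"
  using assms by (auto simp: walk_def last_conv_nth dest: in_set_takeD)

lemma walk_restrict:
  assumes "walk G u p v" "set p \<subseteq> A"
  shows "walk \<lparr>verts = A, edges = {e \<in> edges G. e \<subseteq> A}\<rparr> u p v"
  using assms by (auto simp: walk_def)

text \<open>The infimum of a nonempty set of extended naturals is attained, and over no walks at all
  it is infinite; so a finite distance bound always yields an actual walk. A list of
  \<open>Suc d\<close> vertices has \<open>d\<close> edges.\<close>

lemma gdist_le_iff:
  "gdist G u v \<le> enat d \<longleftrightarrow> (\<exists>p. walk G u p v \<and> length p \<le> Suc d)"
proof
  assume *: "gdist G u v \<le> enat d"
  let ?A = "(\<lambda>p. enat (length p - 1)) ` {p. walk G u p v}"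
  have "?A \<noteq> {}" using * by (auto simp: gdist_def Inf_enat_def split: if_splits)
  then have "gdist G u v \<in> ?A" unfolding gdist_def
    by (metis (no_types, lifting) Inf_enat_def LeastI_ex ex_in_conv)
  then obtain p where "walk G u p v" "gdist G u v = enat (length p - 1)" by auto
  with * show "\<exists>p. walk G u p v \<and> length p \<le> Suc d" by (intro exI[of _ p]) simp
next
  assume "\<exists>p. walk G u p v \<and> length p \<le> Suc d"
  then obtain p where p: "walk G u p v" "length p \<le> Suc d" by blast
  have "gdist G u v \<le> enat (length p - 1)" unfolding gdist_def
    using p(1) by (intro INF_lower) simp
  also have "\<dots> \<le> enat d" using p by simp
  finally show "gdist G u v \<le> enat d" .
qed

text \<open>Short walks from one center give both properties required of a contracted part; the
  center is the witness for the infimum in \<open>radius\<close>.\<close>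

lemma radius_connectedI:
  assumes "c \<in> verts B" and "\<And>x. x \<in> verts B \<Longrightarrow> \<exists>p. walk B c p x \<and> length p \<le> Suc r"
  shows "connected_graph B" "radius B \<le> enat r"
proof -
  show "connected_graph B" unfolding connected_graph_def
  proof (intro conjI ballI)
    fix u v assume "u \<in> verts B" "v \<in> verts B"
    then obtain p q where "walk B c p u" "walk B c q v" using assms(2) by blast
    then show "\<exists>p. walk B u p v" by (meson walk_append walk_rev)
  qed (use assms(1) in blast)
  have "(SUP v \<in> verts B. gdist B c v) \<le> enat r"
    using assms(2) by (intro SUP_least) (simp add: gdist_le_iff)
  then show "radius B \<le> enat r" unfolding radius_def by (rule INF_lower2[OF assms(1)])
qed

section \<open>Sparsity of vertex pairs that are joined by short walks\<close>

definition internals :: "'a list \<Rightarrow> 'a set" where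
  "internals p = set (butlast (tl p))"

lemma internals_rev: "internals (rev p) = internals p"
  by (cases p; cases "tl p" rule: rev_cases) (auto simp: internals_def butlast_append)

lemma card_internals: "card (internals p) \<le> length p"
  unfolding internals_def 
  by (rule order_trans[OF card_length]) simp

text \<open>As \<open>u\<close> and \<open>v\<close> differ from \<open>z\<close>, both walks have
  at least two vertices, and \<open>z\<close> is the only vertex that turns from an end into an
  inner vertex.\<close>

lemma internals_append:
  assumes "walk G z p u" "walk G z q v" "u \<noteq> z" "v \<noteq> z"
  shows "internals (rev p @ tl q) \<subseteq> internals p \<union> {z} \<union> internals q"
proof -
  obtain p' where p: "p = z # p' @ [u]" using assms(1,3)
    by (cases p; cases "tl p" rule: rev_cases) (auto simp: walk_def)
  obtain q' where q: "q = z # q' @ [v]" using assms(2,4)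
    by (cases q; cases "tl q" rule: rev_cases) (auto simp: walk_def)
  show ?thesis by (auto simp: p q internals_def butlast_append)
qed

text \<open>The density bound in multiplicative form over the naturals, which is also meaningful for
  a minor without vertices.\<close>

definition minor_density :: "'a ugraph \<Rightarrow> nat \<Rightarrow> nat \<Rightarrow> bool" where
  "minor_density G r k \<longleftrightarrow> (\<forall>M. depth_minor r M G \<longrightarrow> card (edges M) \<le> k * card (verts M))"

lemma card_le_by_inj_disjoint:
  assumes "finite S" "\<And>e. e \<in> E \<Longrightarrow> I e \<inter> S \<noteq> {}"
    "\<And>e f. e \<in> E \<Longrightarrow> f \<in> E \<Longrightarrow> e \<noteq> f \<Longrightarrow> I e \<inter> I f = {}"
  shows "card E \<le> card S"
proof -
  have "\<forall>e\<in>E. \<exists>z. z \<in> I e \<inter> S" using assms(2) by blast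
  then obtain h where h: "\<And>e. e \<in> E \<Longrightarrow> h e \<in> I e \<inter> S" by metis
  have "inj_on h E"
  proof (rule inj_onI, rule ccontr)
    fix e f assume *: "e \<in> E" "f \<in> E" "h e = h f" "e \<noteq> f"
    then have "h e \<in> I e \<inter> I f" using h[of e] h[of f] by auto
    then show False using assms(3)[OF *(1,2,4)] by simp
  qed
  moreover have "h ` E \<subseteq> S" using h by blast
  ultimately show ?thesis using assms(1) by (metis card_inj_on_le)
qed

text \<open>Contract every walk, without its last vertex, into its first vertex.\<close>
lemma disjoint_walks_sparse:
  assumes G: "simple_graph G" and md: "minor_density G r k" and S: "S \<subseteq> verts G"
    and E: "\<And>e. e \<in> E \<Longrightarrow> e \<subseteq> S \<and> card e = 2 \<and>
        (\<exists>u v. e = {u, v} \<and> walk G u (p e) v) \<and> length (p e) \<le> Suc r \<and> internals (p e) \<inter> S = {}"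
    and disj: "\<And>e f. e \<in> E \<Longrightarrow> f \<in> E \<Longrightarrow> e \<noteq> f \<Longrightarrow> internals (p e) \<inter> internals (p f) = {}"
  shows "card E \<le> k * card S"
proof -
  \<comment> \<open>The end \<open>hd (p e)\<close> absorbs the interior of the walk. Interiors
    avoid \<open>S\<close> and are disjoint for different pairs, so different sets
    \<open>B v\<close> are disjoint.\<close>
  define B where "B v = insert v (\<Union>e\<in>{e\<in>E. hd (p e) = v}. internals (p e))" for v
  define gr where "gr A = \<lparr>verts = A, edges = {e \<in> edges G. e \<subseteq> A}\<rparr>" for A :: "'a set"
  define SG where "SG = gr (\<Union>(B ` S))"
  have finV: "finite (verts G)" using G by (simp add: simple_graph_def)
  have finS: "finite S" using S finV finite_subset by blast
  have walkE: "\<exists>v. e = {hd (p e), v} \<and> v \<noteq> hd (p e) \<and> walk G (hd (p e)) (p e) v" if "e \<in> E" for e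
    using E[OF that] by (auto simp: walk_def card_2_iff doubleton_eq_iff)
  have int_sub: "internals (p e) \<subseteq> verts G" if e: "e \<in> E" for e
  proof -
    obtain v where "walk G (hd (p e)) (p e) v" using walkE[OF e] by blast
    then have "set (p e) \<subseteq> verts G" by (simp add: walk_def)
    then show ?thesis unfolding internals_def
      by (cases "p e") (auto dest: in_set_butlastD)
  qed
  have Bsub: "B v \<subseteq> verts G" if "v \<in> S" for v
    using that S int_sub unfolding B_def by fastforce
  have Bdisj: "B u \<inter> B v = {}" if uv: "u \<in> S" "v \<in> S" "u \<noteq> v" for u v
  proof (rule ccontr)
    assume "B u \<inter> B v \<noteq> {}"
    then obtain x where x: "x \<in> B u" "x \<in> B v" by blast
    show False
    proof (cases "x = u \<or> x = v")
      case True
      then obtain e where "e \<in> E" "x \<in> internals (p e)" "x \<in> S"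
        using x uv by (auto simp: B_def)
      then show False using E[of e] by blast
    next
      case False
      then obtain e f where "e \<in> E" "f \<in> E" "hd (p e) = u" "hd (p f) = v"
          "x \<in> internals (p e)" "x \<in> internals (p f)"
        using x by (auto simp: B_def)
      then show False using disj[of e f] that by (cases "e = f") auto
    qed
  qed
  have simple: "simple_graph (gr A)" if "A \<subseteq> verts G" for A
    using G that finV unfolding simple_graph_def gr_def by (auto intro: finite_subset)
  have sub1: "subgraph SG G" unfolding subgraph_def SG_def
    using simple[of "\<Union>(B ` S)"] Bsub by (auto simp: gr_def)
  have part: "partition_on (verts SG) (B ` S)"
  proof (rule partition_onI)
    show "\<Union>(B ` S) = verts SG" by (simp add: SG_def gr_def)
    show "{} \<notin> B ` S" by (auto simp: B_def)
    fix P Q assume "P \<in> B ` S" "Q \<in> B ` S" "P \<noteq> Q"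
    then show "disjnt P Q" using Bdisj by (auto simp: disjnt_def)
  qed
  have parts: "\<exists>H. subgraph H SG \<and> verts H = A \<and> connected_graph H \<and> radius H \<le> enat r"
    if AB: "A \<in> B ` S" for A
  proof -
    obtain v where v: "v \<in> S" "A = B v" using AB by blast
    have reach: "\<exists>q. walk (gr (B v)) v q x \<and> length q \<le> Suc r" if x: "x \<in> B v" for x
    proof (cases "x = v")
      case True
      have "walk (gr (B v)) v [v] v" using x True by (intro walk_single) (simp add: gr_def)
      then show ?thesis using True by (intro exI[of _ "[v]"]) simp
    next
      case False
      then obtain e where e: "e \<in> E" "hd (p e) = v" "x \<in> internals (p e)" using x by (auto simp: B_def)
      obtain w where w: "walk G v (p e) w" using walkE e by blast
      have xb: "x \<in> set (butlast (p e))" using e(3) unfolding internals_def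
        by (cases "p e") (auto split: if_splits)
      then obtain i where i: "i < length (butlast (p e))" "butlast (p e) ! i = x" by (meson in_set_conv_nth)
      have il: "i < length (p e)" "p e ! i = x" using i by (auto simp: nth_butlast)
      have W: "walk G v (take (Suc i) (p e)) x" using walk_take[OF w il(1)] il(2) by simp
      \<comment> \<open>The prefix that leads to an inner vertex misses the last vertex of the walk,
        hence stays inside \<open>B v\<close>; this bounds the radius of the part.\<close>
      have "set (take (Suc i) (p e)) \<subseteq> set (butlast (p e))"
      proof -
        have "take (Suc i) (p e) = take (Suc i) (butlast (p e))" using i(1)
          by (simp add: take_butlast)
        then show ?thesis by (metis set_take_subset)
      qed
      moreover have "set (butlast (p e)) \<subseteq> insert v (internals (p e))"
        using e(2) unfolding internals_def by (cases "p e") (auto split: if_splits)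
      ultimately have "set (take (Suc i) (p e)) \<subseteq> B v" using e by (auto simp: B_def)
      then have "walk (gr (B v)) v (take (Suc i) (p e)) x"
        unfolding gr_def by (rule walk_restrict[OF W])
      moreover have "length (take (Suc i) (p e)) \<le> Suc r" using E[OF e(1)] by (simp add: min.coboundedI1)
      ultimately show ?thesis by blast
    qed
    have "v \<in> verts (gr (B v))" by (simp add: gr_def B_def)
    then have "connected_graph (gr (B v))" "radius (gr (B v)) \<le> enat r"
      using radius_connectedI[of v "gr (B v)" r] reach by (auto simp: gr_def)
    moreover have "subgraph (gr (B v)) SG" unfolding subgraph_def
      using simple[OF Bsub[OF v(1)]] v by (auto simp: gr_def SG_def)
    ultimately show ?thesis using v by (intro exI[of _ "gr (B v)"]) (simp add: gr_def)
  qed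
  have "depth_minor r (contraction SG (B ` S)) G" unfolding depth_minor_def
    using sub1 part parts by blast
  then have le: "card (edges (contraction SG (B ` S))) \<le> k * card (B ` S)"
    using md by (auto simp: minor_density_def contraction_def)
  have injB: "inj_on B S"
  proof (rule inj_onI)
    fix u v assume *: "u \<in> S" "v \<in> S" "B u = B v"
    have "u \<in> B u" by (simp add: B_def)
    then show "u = v" using Bdisj[of u v] * by auto
  qed
  have img: "(\<lambda>e. B ` e) ` E \<subseteq> edges (contraction SG (B ` S))"
  proof safe
    fix e assume e: "e \<in> E"
    obtain v where v: "e = {hd (p e), v}" "v \<noteq> hd (p e)" "walk G (hd (p e)) (p e) v"
      using walkE e by blast
    define u where "u = hd (p e)"
    have uv: "u \<in> S" "v \<in> S" "u \<noteq> v" using E[OF e] v by (auto simp: u_def)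
    have len: "length (p e) \<ge> 2" using v(2,3) by (cases "p e"; cases "tl (p e)") (auto simp: walk_def)
    \<comment> \<open>The last but one vertex is in \<open>B u\<close> (it is \<open>u\<close>
      itself if the walk is one edge), so the last edge of the walk connects the two parts.\<close>
    define x where "x = p e ! (length (p e) - 2)"
    have "{p e ! (length (p e) - 2), p e ! Suc (length (p e) - 2)} \<in> edges G"
      using v(3) len unfolding walk_def by auto
    moreover have "p e ! Suc (length (p e) - 2) = v"
    proof -
      have "Suc (length (p e) - 2) = length (p e) - 1" using len by simp
      then show ?thesis using v(3) unfolding walk_def by (metis last_conv_nth)
    qed
    ultimately have xe: "{x, v} \<in> edges G" by (simp add: x_def)
    have "x \<in> set (butlast (p e))"
    proof -
      have "length (p e) - 2 < length (butlast (p e))" using len by simp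
      then show ?thesis unfolding x_def by (metis nth_butlast nth_mem)
    qed
    moreover have "set (butlast (p e)) \<subseteq> insert u (internals (p e))"
      unfolding u_def internals_def by (cases "p e") (auto split: if_splits)
    ultimately have xB: "x \<in> B u" using e by (auto simp: B_def u_def)
    have vB: "v \<in> B v" by (simp add: B_def)
    have "{x, v} \<in> edges SG" using xe xB vB uv by (auto simp: SG_def gr_def)
    moreover have "B u \<noteq> B v" using injB uv by (auto simp: inj_on_def)
    ultimately have "{B u, B v} \<in> edges (contraction SG (B ` S))"
      using xB vB uv by (auto simp: contraction_def)
    moreover have "B ` e = {B u, B v}" by (subst v(1)) (simp add: u_def)
    ultimately show "B ` e \<in> edges (contraction SG (B ` S))" by simp
  qed
  have inj: "inj_on (\<lambda>e. B ` e) E"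
  proof (rule inj_onI)
    fix e f assume ef: "e \<in> E" "f \<in> E" "B ` e = B ` f"
    have "e \<subseteq> S" "f \<subseteq> S" using E[OF ef(1)] E[OF ef(2)] by simp_all
    then show "e = f" using ef(3) inj_on_image_eq_iff[OF injB] by simp
  qed
  have "finite (edges (contraction SG (B ` S)))"
    by (rule finite_subset[of _ "Pow (B ` S)"]) (auto simp: contraction_def finS)
  then have "card E \<le> card (edges (contraction SG (B ` S)))"
    using img inj by (metis card_inj_on_le)
  also have "\<dots> \<le> k * card (B ` S)" by (rule le)
  also have "\<dots> = k * card S" using injB by (simp add: card_image)
  finally show ?thesis .
qed

lemma card_UN_le_mult:
  assumes "finite I" "card I \<le> m" "\<And>i. i \<in> I \<Longrightarrow> card (f i) \<le> k"
  shows "card (\<Union>i\<in>I. f i) \<le> m * k"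
proof -
  have "card (\<Union>i\<in>I. f i) \<le> (\<Sum>i\<in>I. card (f i))" by (rule card_UN_le[OF assms(1)])
  also have "\<dots> \<le> card I * k" using sum_bounded_above[of I "\<lambda>i. card (f i)" k] assms(3) by simp
  also have "\<dots> \<le> m * k" using assms(2) by simp
  finally show ?thesis .
qed

text \<open>Take a maximal family of walks with disjoint interiors. By maximality the interior of
  every other walk meets one of the family; each member has at most \<open>Suc r\<close> inner
  vertices and each of these is inner to at most \<open>g\<close> walks. So it suffices that the
  family is sparse.\<close>

lemma congested_walks_sparse:
  assumes G: "simple_graph G" and md: "minor_density G r k" and S: "S \<subseteq> verts G"
    and E: "\<And>e. e \<in> E \<Longrightarrow> e \<subseteq> S \<and> card e = 2 \<and>
        (\<exists>u v. e = {u, v} \<and> walk G u (p e) v) \<and> length (p e) \<le> Suc r"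
    and cong: "\<And>z. card {e \<in> E. z \<in> internals (p e)} \<le> g"
  shows "card E \<le> (Suc r * g + 1) * (k + 1) * card S"
proof -
  define I where "I e = internals (p e)" for e
  have finS: "finite S" using G S by (auto simp: simple_graph_def intro: finite_subset)
  have finE: "finite E" by (rule finite_subset[of _ "Pow S"]) (use E finS in auto)
  define F where "F = {M. M \<subseteq> E \<and> (\<forall>e\<in>M. \<forall>f\<in>M. e \<noteq> f \<longrightarrow> I e \<inter> I f = {})}"
  have "finite F" by (rule finite_subset[of _ "Pow E"]) (auto simp: F_def finE)
  moreover have "{} \<in> F" by (simp add: F_def)
  ultimately obtain M where M: "M \<in> F" "\<And>M'. M' \<in> F \<Longrightarrow> M \<subseteq> M' \<Longrightarrow> M = M'"
    using finite_has_maximal[of F] by (metis empty_iff)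
  have ME: "M \<subseteq> E" and Mdisj: "\<And>e f. e \<in> M \<Longrightarrow> f \<in> M \<Longrightarrow> e \<noteq> f \<Longrightarrow> I e \<inter> I f = {}"
    using M(1) by (auto simp: F_def)
  have finM: "finite M" using ME finE finite_subset by blast
  have hit: "e \<in> M \<or> (\<exists>f\<in>M. I e \<inter> I f \<noteq> {})" if e: "e \<in> E" for e
  proof (rule ccontr)
    assume n: "\<not> ?thesis"
    then have "insert e M \<in> F" using e ME Mdisj by (auto simp: F_def)
    then have "M = insert e M" using M(2) by blast
    then show False using n by blast
  qed
  have "E \<subseteq> M \<union> (\<Union>f\<in>M. \<Union>z\<in>I f. {e \<in> E. z \<in> I e})"
  proof
    fix e assume e: "e \<in> E"
    show "e \<in> M \<union> (\<Union>f\<in>M. \<Union>z\<in>I f. {e \<in> E. z \<in> I e})" using hit[OF e] e by auto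
  qed
  moreover have "card (\<Union>f\<in>M. \<Union>z\<in>I f. {e \<in> E. z \<in> I e}) \<le> card M * (Suc r * g)"
  proof (intro card_UN_le_mult finM order_refl)
    fix f assume "f \<in> M"
    then have "length (p f) \<le> Suc r" using E ME by blast
    then show "card (I f) \<le> Suc r" unfolding I_def using card_internals order_trans by blast
    show "finite (I f)" by (simp add: I_def internals_def)
    show "card {e \<in> E. z \<in> I e} \<le> g" for z using cong by (simp add: I_def)
  qed
  ultimately have 1: "card E \<le> card M + card M * (Suc r * g)"
  proof -
    assume sub: "E \<subseteq> M \<union> (\<Union>f\<in>M. \<Union>z\<in>I f. {e \<in> E. z \<in> I e})"
    assume le: "card (\<Union>f\<in>M. \<Union>z\<in>I f. {e \<in> E. z \<in> I e}) \<le> card M * (Suc r * g)"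
    have "finite (M \<union> (\<Union>f\<in>M. \<Union>z\<in>I f. {e \<in> E. z \<in> I e}))"
      by (rule finite_subset[OF _ finE]) (use ME in auto)
    from card_mono[OF this sub] show ?thesis
      using card_Un_le[of M "\<Union>f\<in>M. \<Union>z\<in>I f. {e \<in> E. z \<in> I e}"] le by linarith
  qed
  \<comment> \<open>Members whose interior avoids \<open>S\<close> yield a minor. The others pick
    distinct vertices of \<open>S\<close> from their disjoint interiors, which turns
    \<open>k\<close> into \<open>k + 1\<close>.\<close>
  define M1 M2 where "M1 = {e \<in> M. I e \<inter> S = {}}" and "M2 = {e \<in> M. I e \<inter> S \<noteq> {}}"
  have "card M1 \<le> k * card S"
  proof (rule disjoint_walks_sparse[OF G md S, of _ p])
    fix e assume "e \<in> M1"
    then have "e \<in> E" "internals (p e) \<inter> S = {}" using ME by (auto simp: M1_def I_def)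
    then show "e \<subseteq> S \<and> card e = 2 \<and> (\<exists>u v. e = {u, v} \<and> walk G u (p e) v) \<and>
      length (p e) \<le> Suc r \<and> internals (p e) \<inter> S = {}" using E[of e] by simp
  next
    fix e f assume "e \<in> M1" "f \<in> M1" "e \<noteq> f"
    then show "internals (p e) \<inter> internals (p f) = {}" using Mdisj[of e f] by (simp add: M1_def I_def)
  qed
  moreover have "card M2 \<le> card S"
  proof (rule card_le_by_inj_disjoint[OF finS, of _ I])
    show "I e \<inter> S \<noteq> {}" if "e \<in> M2" for e using that by (simp add: M2_def)
    show "I e \<inter> I f = {}" if "e \<in> M2" "f \<in> M2" "e \<noteq> f" for e f
      using Mdisj[of e f] that by (simp add: M2_def)
  qed
  moreover have "card M = card M1 + card M2"
  proof -
    have "M = M1 \<union> M2" "M1 \<inter> M2 = {}" by (auto simp: M1_def M2_def)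
    then show ?thesis using finM by (metis card_Un_disjoint finite_Un)
  qed
  ultimately have "card M \<le> (k + 1) * card S" by simp
  then have "(Suc r * g + 1) * card M \<le> (Suc r * g + 1) * ((k + 1) * card S)" by (rule mult_le_mono2)
  then show ?thesis using 1 by (simp add: algebra_simps)
qed

text \<open>Sparsity of all subsets makes the pairs degenerate: some vertex has at most
  \<open>2 * k\<close> neighbors, its pairs are oriented away from it, and the rest follows by
  induction.\<close>

lemma sparse_orientation:
  assumes "finite V" and E: "\<And>e. e \<in> E \<Longrightarrow> e \<subseteq> V \<and> card e = 2"
    and sparse: "\<And>S. S \<subseteq> V \<Longrightarrow> card {e \<in> E. e \<subseteq> S} \<le> k * card S"
  shows "\<exists>out. (\<forall>v. out v \<subseteq> V \<and> card (out v) \<le> 2 * k \<and> v \<notin> out v) \<and>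
    (\<forall>u v. {u, v} \<in> E \<longleftrightarrow> v \<in> out u \<or> u \<in> out v)"
proof -
  have nE: "{u, u} \<notin> E" for u using E[of "{u, u}"] by auto
  \<comment> \<open>The equivalence restricted to \<open>S\<close> forces \<open>out v\<close> to be
    empty for \<open>v\<close> outside \<open>S\<close>, so the induction step can set the
    out-neighbors of the removed vertex without losing a pair.\<close>
  have "\<exists>out. (\<forall>v. out v \<subseteq> S \<and> card (out v) \<le> 2 * k \<and> v \<notin> out v) \<and>
      (\<forall>u v. {u, v} \<in> E \<and> u \<in> S \<and> v \<in> S \<longleftrightarrow> v \<in> out u \<or> u \<in> out v)" if "S \<subseteq> V" for S
    using that
  proof (induction "card S" arbitrary: S)
    case 0
    then have "S = {}" using assms(1) finite_subset by fastforce
    then show ?case by (intro exI[of _ "\<lambda>_. {}"]) auto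
  next
    case (Suc n)
    have finS: "finite S" using Suc.prems assms(1) finite_subset by blast
    define ES where "ES = {e \<in> E. e \<subseteq> S}"
    have finES: "finite ES" by (rule finite_subset[of _ "Pow S"]) (auto simp: ES_def finS)
    define N where "N v = {u \<in> S. {u, v} \<in> E}" for v
    have N_card: "card (N v) = card {e \<in> ES. v \<in> e}" if v: "v \<in> S" for v
    proof -
      have "{e \<in> ES. v \<in> e} = (\<lambda>u. {u, v}) ` N v"
      proof (intro equalityI subsetI)
        fix e assume "e \<in> {e \<in> ES. v \<in> e}"
        then have e: "e \<in> E" "e \<subseteq> S" "v \<in> e" by (auto simp: ES_def)
        then obtain x y where xy: "e = {x, y}" "x \<noteq> y" using E[of e] by (auto simp: card_2_iff)
        show "e \<in> (\<lambda>u. {u, v}) ` N v"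
        proof (cases "v = x")
          case True then show ?thesis using e xy
            by (intro image_eqI[of _ _ y]) (auto simp: N_def insert_commute)
        next
          case False then show ?thesis using e xy
            by (intro image_eqI[of _ _ x]) (auto simp: N_def)
        qed
      qed (use v in \<open>auto simp: N_def ES_def\<close>)
      moreover have "inj_on (\<lambda>u. {u, v}) (N v)"
        by (intro inj_onI) (auto simp: doubleton_eq_iff)
      ultimately show ?thesis by (simp add: card_image)
    qed
    \<comment> \<open>If all vertices had more than \<open>2 * k\<close> neighbors in
      \<open>S\<close>, the sum of the degrees would exceed twice the number of pairs inside
      \<open>S\<close>.\<close>
    have "\<exists>v\<in>S. card (N v) \<le> 2 * k"
    proof (rule ccontr)
      assume "\<not> ?thesis"
      then have "\<forall>v\<in>S. 2 * k + 1 \<le> card (N v)" by auto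
      then have "(\<Sum>v\<in>S. 2 * k + 1) \<le> (\<Sum>v\<in>S. card (N v))" by (intro sum_mono) simp
      also have "\<dots> = (\<Sum>v\<in>S. card {e \<in> ES. v \<in> e})" using N_card by simp
      also have "\<dots> = (\<Sum>v\<in>S. \<Sum>e\<in>ES. if v \<in> e then 1 else 0 :: nat)"
        using finES by (simp add: sum.If_cases Int_def)
      also have "\<dots> = (\<Sum>e\<in>ES. \<Sum>v\<in>S. if v \<in> e then 1 else 0 :: nat)" by (rule sum.swap)
      also have "\<dots> = (\<Sum>e\<in>ES. 2)"
      proof (rule sum.cong[OF refl])
        fix e assume "e \<in> ES"
        then have e: "e \<subseteq> S" "card e = 2" using E[of e] by (simp_all add: ES_def)
        have "(\<Sum>v\<in>S. if v \<in> e then 1 else 0 :: nat) = card (S \<inter> e)"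
          using finS by (simp add: sum.If_cases)
        then show "(\<Sum>v\<in>S. if v \<in> e then 1 else 0 :: nat) = 2" using e by (simp add: Int_absorb1)
      qed
      also have "\<dots> \<le> 2 * (k * card S)" using sparse[OF Suc.prems] by (simp add: ES_def)
      finally have "card S * (2 * k + 1) \<le> 2 * (k * card S)" by (simp only: sum_constant of_nat_id)
      moreover have "card S * (2 * k + 1) = 2 * (k * card S) + card S" by (simp add: algebra_simps)
      ultimately have "card S = 0" by linarith
      then show False using Suc.hyps(2) by simp
    qed
    then obtain v where v: "v \<in> S" "card (N v) \<le> 2 * k" by blast
    have "n = card (S - {v})" using Suc.hyps(2) v(1) finS by simp
    moreover have "S - {v} \<subseteq> V" using Suc.prems by blast
    ultimately have "\<exists>out. (\<forall>x. out x \<subseteq> S - {v} \<and> card (out x) \<le> 2 * k \<and> x \<notin> out x) \<and>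
      (\<forall>x y. {x, y} \<in> E \<and> x \<in> S - {v} \<and> y \<in> S - {v} \<longleftrightarrow> y \<in> out x \<or> x \<in> out y)"
      by (rule Suc.hyps(1))
    then obtain out where
      out: "\<forall>x. out x \<subseteq> S - {v} \<and> card (out x) \<le> 2 * k \<and> x \<notin> out x"
      and iff: "\<forall>x y. {x, y} \<in> E \<and> x \<in> S - {v} \<and> y \<in> S - {v} \<longleftrightarrow> y \<in> out x \<or> x \<in> out y"
      by (elim exE conjE) (rule that)
    define out' where "out' = out(v := N v)"
    have out'_simps: "out' v = N v" "\<And>x. x \<noteq> v \<Longrightarrow> out' x = out x" by (simp_all add: out'_def)
    have v_out: "v \<notin> out x" for x using out by blast
    have "{x, y} \<in> E \<and> x \<in> S \<and> y \<in> S \<longleftrightarrow> y \<in> out' x \<or> x \<in> out' y" for x y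
    proof -
      consider "x = v" | "x \<noteq> v" "y = v" | "x \<noteq> v" "y \<noteq> v" by blast
      then show ?thesis
      proof cases
        case 1
        have "y = v \<or> out' y = out y" using out'_simps(2) by blast
        then show ?thesis using 1 v(1) v_out[of y] nE[of v]
          by (auto simp: out'_simps(1) N_def insert_commute)
      next
        case 2
        then show ?thesis using v(1) v_out[of x] by (auto simp: out'_simps N_def)
      next
        case 3
        then show ?thesis using iff[rule_format, of x y] by (simp add: out'_simps)
      qed
    qed
    moreover have "out' x \<subseteq> S \<and> card (out' x) \<le> 2 * k \<and> x \<notin> out' x" for x
      using out v nE by (auto simp: out'_def N_def)
    ultimately show ?case by (intro exI[of _ out']) simp
  qed
  from this[OF order_refl] obtain out where
    out: "\<forall>v. out v \<subseteq> V \<and> card (out v) \<le> 2 * k \<and> v \<notin> out v"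
    "\<forall>u v. {u, v} \<in> E \<and> u \<in> V \<and> v \<in> V \<longleftrightarrow> v \<in> out u \<or> u \<in> out v" by (elim exE conjE) (rule that)
  have "{u, v} \<in> E \<longleftrightarrow> v \<in> out u \<or> u \<in> out v" for u v
    using out(2) E[of "{u, v}"] by auto
  then show ?thesis using out(1) by (intro exI[of _ out]) simp
qed

section \<open>Fraternal augmentation with bounded out-degree\<close>

text \<open>
  The pairs \<open>{z, u}\<close> with \<open>u \<in> out i z\<close> have distance at most \<open>i\<close>.
  They are witnessed by walks \<open>p i {z, u}\<close> such that each vertex is internal to at most \<open>g\<close> of them,
  although it may be an end of many: this is what keeps the pairs sparse.  Two out-neighbors
  of a vertex are again joined, at the level that is the sum of their levels.
\<close>
definition level_edges :: "('a \<Rightarrow> 'a set) \<Rightarrow> 'a set set" where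
  "level_edges out = {{z, u} | z u. u \<in> out z}"

definition fraternal ::
  "'a ugraph \<Rightarrow> nat \<Rightarrow> nat \<Rightarrow> nat \<Rightarrow> (nat \<Rightarrow> 'a \<Rightarrow> 'a set) \<Rightarrow> (nat \<Rightarrow> 'a set \<Rightarrow> 'a list) \<Rightarrow> bool" where
  "fraternal G L c g out p \<longleftrightarrow>
    (\<forall>i\<in>{1..L}. \<forall>z. out i z \<subseteq> verts G \<and> card (out i z) \<le> c \<and> z \<notin> out i z) \<and>
    (\<forall>i\<in>{1..L}. \<forall>e\<in>level_edges (out i).
       (\<exists>u v. e = {u, v} \<and> walk G u (p i e) v) \<and> length (p i e) \<le> Suc i) \<and>
    (\<forall>i\<in>{1..L}. \<forall>q. card {e \<in> level_edges (out i). q \<in> internals (p i e)} \<le> g) \<and>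
    (\<forall>a\<ge>1. \<forall>b\<ge>1. \<forall>z u v. a + b \<le> L \<and> u \<in> out a z \<and> v \<in> out b z \<and> u \<noteq> v \<longrightarrow>
       {u, v} \<in> level_edges (out (a + b))) \<and>
    (L \<ge> 1 \<longrightarrow> edges G \<subseteq> level_edges (out 1))"

lemma level_edges_iff: "{u, v} \<in> level_edges out \<longleftrightarrow> v \<in> out u \<or> u \<in> out v"
  by (auto simp: level_edges_def doubleton_eq_iff)

lemma fraternalD:
  assumes "fraternal G L c g out p" "i \<in> {1..L}"
  shows "out i z \<subseteq> verts G" "card (out i z) \<le> c" "z \<notin> out i z"
    "card {e \<in> level_edges (out i). q \<in> internals (p i e)} \<le> g"
proof -
  have 1: "\<forall>i\<in>{1..L}. \<forall>z. out i z \<subseteq> verts G \<and> card (out i z) \<le> c \<and> z \<notin> out i z"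
    using assms(1) unfolding fraternal_def by (elim conjE)
  have 2: "\<forall>i\<in>{1..L}. \<forall>q. card {e \<in> level_edges (out i). q \<in> internals (p i e)} \<le> g"
    using assms(1) unfolding fraternal_def by (elim conjE)
  show "out i z \<subseteq> verts G" "card (out i z) \<le> c" "z \<notin> out i z" using 1 assms(2) by simp_all
  show "card {e \<in> level_edges (out i). q \<in> internals (p i e)} \<le> g" using 2 assms(2) by simp
qed

text \<open>The walk is stored for the unordered pair, so its direction is arbitrary; reversing it
  keeps the interior.\<close>

lemma fraternal_walk:
  assumes "fraternal G L c g out p" "i \<in> {1..L}" "u \<in> out i z"
  shows "\<exists>w. walk G z w u \<and> length w \<le> Suc i \<and> internals w = internals (p i {z, u})"
proof -
  have "{z, u} \<in> level_edges (out i)" using assms(3) by (simp add: level_edges_iff)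
  then obtain x y where w: "{z, u} = {x, y}" "walk G x (p i {z, u}) y" "length (p i {z, u}) \<le> Suc i"
    using assms(1,2) unfolding fraternal_def by meson
  then consider "x = z" "y = u" | "x = u" "y = z" by (auto simp: doubleton_eq_iff)
  then show ?thesis
  proof cases
    case 1 then show ?thesis using w by (intro exI[of _ "p i {z, u}"]) simp
  next
    case 2 then show ?thesis using w walk_rev[of G x "p i {z, u}" y]
      by (intro exI[of _ "rev (p i {z, u})"]) (simp add: internals_rev)
  qed
qed

text \<open>The joined walk runs from \<open>u\<close> to \<open>z\<close> and on to
  \<open>v\<close>. Its interior is inherited from the two halves, whose congestion is known, except
  for \<open>z\<close>, where the out-degrees limit the number of joined walks.\<close>

lemma fraternal_walk_join:
  assumes fr: "fraternal G L c g out p" and "1 \<le> a" "1 \<le> b" "a + b = Suc L"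
    "u \<in> out a z" "v \<in> out b z"
  shows "\<exists>w. walk G u w v \<and> length w \<le> Suc (Suc L) \<and>
    internals w \<subseteq> internals (p a {z, u}) \<union> {z} \<union> internals (p b {z, v})"
proof -
  have ab: "a \<in> {1..L}" "b \<in> {1..L}" using assms(2-4) by auto
  obtain w1 where w1: "walk G z w1 u" "length w1 \<le> Suc a" "internals w1 = internals (p a {z, u})"
    using fraternal_walk[OF fr ab(1) assms(5)] by blast
  obtain w2 where w2: "walk G z w2 v" "length w2 \<le> Suc b" "internals w2 = internals (p b {z, v})"
    using fraternal_walk[OF fr ab(2) assms(6)] by blast
  have "u \<noteq> z" "v \<noteq> z" using fraternalD(3)[OF fr] ab assms(5,6) by metis+
  then have "internals (rev w1 @ tl w2) \<subseteq> internals w1 \<union> {z} \<union> internals w2"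
    by (rule internals_append[OF w1(1) w2(1)])
  moreover have "walk G u (rev w1 @ tl w2) v" by (rule walk_append[OF walk_rev[OF w1(1)] w2(1)])
  moreover have "length (rev w1 @ tl w2) \<le> Suc (Suc L)" using w1(2) w2(2) assms(4) by simp
  ultimately show ?thesis using w1(3) w2(3) by blast
qed

text \<open>Counts the pairs \<open>{u, v}\<close> whose joined walk can pass \<open>q\<close>
  inside the half between \<open>z\<close> and \<open>u\<close>: a level \<open>a\<close>, one of at
  most \<open>g\<close> pairs with \<open>q\<close> in the interior, the end that is
  \<open>z\<close>, the end that is \<open>u\<close>, and an out-neighbor of \<open>z\<close> at the
  complementary level.\<close>

lemma card_pairs_le:
  assumes fr: "fraternal G L c g out p" and G: "simple_graph G"
  shows "card (\<Union>a\<in>{1..L}. \<Union>e\<in>{e\<in>level_edges (out a). q \<in> internals (p a e)}.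
    \<Union>z\<in>e. \<Union>u\<in>e. (\<lambda>v. {u, v}) ` out (Suc L - a) z) \<le> L * (g * (2 * (2 * c)))"
proof (intro card_UN_le_mult)
  fix a assume a: "a \<in> {1..L}"
  have V: "finite (verts G)" using G by (simp add: simple_graph_def)
  have sub: "level_edges (out a) \<subseteq> {{z, u} | z u. z \<in> verts G \<and> u \<in> verts G \<and> z \<noteq> u}"
  proof
    fix e assume e: "e \<in> level_edges (out a)"
    then obtain z u where zu: "e = {z, u}" "u \<in> out a z" by (auto simp: level_edges_def)
    then have "z \<noteq> u" using fraternalD(3)[OF fr a, of z] by auto
    obtain w where "walk G z w u" using fraternal_walk[OF fr a zu(2)] by blast
    then have "z \<in> verts G" "u \<in> verts G" unfolding walk_def by auto
    with \<open>z \<noteq> u\<close> show "e \<in> {{z, u} | z u. z \<in> verts G \<and> u \<in> verts G \<and> z \<noteq> u}" using zu by blast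
  qed
  have "finite (level_edges (out a))"
    by (rule finite_subset[of _ "Pow (verts G)"]) (use sub V in auto)
  then show "finite {e \<in> level_edges (out a). q \<in> internals (p a e)}" by simp
  show "card {e \<in> level_edges (out a). q \<in> internals (p a e)} \<le> g"
    by (rule fraternalD[OF fr a])
  fix e assume "e \<in> {e \<in> level_edges (out a). q \<in> internals (p a e)}"
  then have "e \<in> {{z, u} | z u. z \<in> verts G \<and> u \<in> verts G \<and> z \<noteq> u}"
    using subsetD[OF sub] by simp
  then obtain x y where "e = {x, y}" "x \<noteq> y" by blast
  then show "finite e" "card e \<le> 2" "finite e" "card e \<le> 2" by simp_all
  fix z u
  have b: "Suc L - a \<in> {1..L}" using a by auto
  have "finite (out (Suc L - a) z)" using fraternalD(1)[OF fr b] V by (rule finite_subset)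
  then have "card ((\<lambda>v. {u, v}) ` out (Suc L - a) z) \<le> card (out (Suc L - a) z)" by (rule card_image_le)
  also have "\<dots> \<le> c" by (rule fraternalD(2)[OF fr b])
  finally show "card ((\<lambda>v. {u, v}) ` out (Suc L - a) z) \<le> c" .
qed simp_all

text \<open>An inner vertex \<open>q\<close> of a joined walk is either its middle, and then the
  ends are two out-neighbors of \<open>q\<close> (set \<open>A\<close>), or it is inner to one of
  the halves (set \<open>B\<close>).\<close>

lemma fraternal_congestion:
  assumes fr: "fraternal G L c g out p" and G: "simple_graph G"
    and F: "\<And>e. e \<in> F \<Longrightarrow> e = {u e, v e} \<and> 1 \<le> a e \<and> 1 \<le> b e \<and> a e + b e = Suc L \<and>
      u e \<in> out (a e) (z e) \<and> v e \<in> out (b e) (z e) \<and>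
      internals (w e) \<subseteq> internals (p (a e) {z e, u e}) \<union> {z e} \<union> internals (p (b e) {z e, v e})"
  shows "card {e \<in> F. q \<in> internals (w e)} \<le> L * (c * c) + 2 * (L * (g * (2 * (2 * c))))"
proof -
  define A where "A = (\<Union>a\<in>{1..L}. (\<lambda>(u, v). {u, v}) ` (out a q \<times> out (Suc L - a) q))"
  define B where "B = (\<Union>a\<in>{1..L}. \<Union>e\<in>{e\<in>level_edges (out a). q \<in> internals (p a e)}.
    \<Union>z\<in>e. \<Union>u\<in>e. (\<lambda>v. {u, v}) ` out (Suc L - a) z)"
  have V: "finite (verts G)" using G by (simp add: simple_graph_def)
  have out: "finite (out i z)" "card (out i z) \<le> c" if "i \<in> {1..L}" for i z
    using fraternalD(1,2)[OF fr that] V by (auto intro: finite_subset)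
  have cA: "card A \<le> L * (c * c)" unfolding A_def
  proof (rule card_UN_le_mult)
    fix a assume "a \<in> {1..L}"
    then have "a \<in> {1..L}" "Suc L - a \<in> {1..L}" by auto
    then have "card (out a q \<times> out (Suc L - a) q) \<le> c * c" "finite (out a q \<times> out (Suc L - a) q)"
      using out by (auto simp: card_cartesian_product intro!: mult_le_mono)
    then show "card ((\<lambda>(u, v). {u, v}) ` (out a q \<times> out (Suc L - a) q)) \<le> c * c"
      using card_image_le order_trans by blast
  qed auto
  have cB: "card B \<le> L * (g * (2 * (2 * c)))" unfolding B_def by (rule card_pairs_le[OF fr G])
  have fin: "finite A" "finite B"
  proof -
    have "A \<subseteq> Pow (verts G)"
    proof
      fix e assume "e \<in> A"
      then obtain a u v where *: "a \<in> {1..L}" "u \<in> out a q" "v \<in> out (Suc L - a) q" "e = {u, v}"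
        unfolding A_def by auto
      have "Suc L - a \<in> {1..L}" using *(1) by auto
      then show "e \<in> Pow (verts G)" using * fraternalD(1)[OF fr] by (metis PowI empty_subsetI insert_subset subsetD)
    qed
    then show "finite A" using V finite_subset by blast
    have "B \<subseteq> Pow (verts G)"
    proof
      fix e assume "e \<in> B"
      then obtain a e' z u v where *: "a \<in> {1..L}" "e' \<in> level_edges (out a)" "u \<in> e'" "e = {u, v}"
        "v \<in> out (Suc L - a) z" unfolding B_def by auto
      obtain x y where xy: "e' = {x, y}" "y \<in> out a x" using *(2) by (auto simp: level_edges_def)
      obtain w where "walk G x w y" using fraternal_walk[OF fr *(1) xy(2)] by blast
      then have "e' \<subseteq> verts G" using xy(1) unfolding walk_def by auto
      moreover have "Suc L - a \<in> {1..L}" using *(1) by auto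
      then have "v \<in> verts G" using fraternalD(1)[OF fr] *(5) by blast
      ultimately show "e \<in> Pow (verts G)" using * by auto
    qed
    then show "finite B" using V finite_subset by blast
  qed
  have "{e \<in> F. q \<in> internals (w e)} \<subseteq> A \<union> B"
  proof
    fix e assume e: "e \<in> {e \<in> F. q \<in> internals (w e)}"
    then have "e \<in> F" by simp
    note Fe = F[OF this, THEN conjunct1] F[OF this, THEN conjunct2, THEN conjunct1]
      F[OF this, THEN conjunct2, THEN conjunct2, THEN conjunct1]
      F[OF this, THEN conjunct2, THEN conjunct2, THEN conjunct2, THEN conjunct1]
      F[OF this, THEN conjunct2, THEN conjunct2, THEN conjunct2, THEN conjunct2, THEN conjunct1]
      F[OF this, THEN conjunct2, THEN conjunct2, THEN conjunct2, THEN conjunct2, THEN conjunct2, THEN conjunct1]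
      F[OF this, THEN conjunct2, THEN conjunct2, THEN conjunct2, THEN conjunct2, THEN conjunct2, THEN conjunct2]
    have ab: "a e \<in> {1..L}" "b e \<in> {1..L}" "Suc L - a e = b e" "Suc L - b e = a e" using Fe(2-4) by auto
    have "q \<in> internals (p (a e) {z e, u e}) \<or> q = z e \<or> q \<in> internals (p (b e) {z e, v e})"
      using subsetD[OF Fe(7), of q] e by auto
    then consider "q \<in> internals (p (a e) {z e, u e})" | "q = z e" | "q \<in> internals (p (b e) {z e, v e})"
      by blast
    then show "e \<in> A \<union> B"
    proof cases
      case 1
      have "{z e, u e} \<in> level_edges (out (a e))" using Fe(5) by (simp add: level_edges_iff)
      moreover have "e \<in> (\<lambda>v. {u e, v}) ` out (Suc L - a e) (z e)"
        by (rule image_eqI[of _ _ "v e"]) (rule Fe(1), use Fe(6) ab in simp)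
      ultimately have "e \<in> B" unfolding B_def
        by (intro UN_I[OF ab(1)] UN_I[of "{z e, u e}"] UN_I[of "z e"] UN_I[of "u e"] CollectI conjI 1)
          simp_all
      then show ?thesis by simp
    next
      case 2
      have "(u e, v e) \<in> out (a e) q \<times> out (Suc L - a e) q" using Fe(5,6) ab 2 by simp
      then have "e \<in> (\<lambda>(u, v). {u, v}) ` (out (a e) q \<times> out (Suc L - a e) q)"
        by (rule image_eqI[of _ _ "(u e, v e)", rotated]) (subst Fe(1), simp)
      then have "e \<in> A" unfolding A_def by (rule UN_I[OF ab(1)])
      then show ?thesis by simp
    next
      \<comment> \<open>The second half is covered by \<open>B\<close> as well, read with the roles
        of the two halves exchanged.\<close>
      case 3
      have "{z e, v e} \<in> level_edges (out (b e))" using Fe(6) by (simp add: level_edges_iff)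
      moreover have "e \<in> (\<lambda>x. {v e, x}) ` out (Suc L - b e) (z e)"
        by (rule image_eqI[of _ _ "u e"]) (subst insert_commute, rule Fe(1), use Fe(5) ab in simp)
      ultimately have "e \<in> B" unfolding B_def
        by (intro UN_I[OF ab(2)] UN_I[of "{z e, v e}"] UN_I[of "z e"] UN_I[of "v e"] CollectI conjI 3)
          simp_all
      then show ?thesis by simp
    qed
  qed
  then have "card {e \<in> F. q \<in> internals (w e)} \<le> card (A \<union> B)" using fin by (simp add: card_mono)
  also have "\<dots> \<le> card A + card B" by (rule card_Un_le)
  finally show ?thesis using cA cB by linarith
qed

text \<open>The new level consists of the pairs forced by earlier levels whose sum is
  \<open>Suc L\<close>. Their walks have at most \<open>Suc L\<close> edges and congestion
  \<open>g'\<close>, so \<open>congested_walks_sparse\<close> gives density \<open>m\<close> on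
  every vertex set, and an orientation with out-degree \<open>2 * m\<close> exists.\<close>

lemma fraternal_step:
  assumes G: "simple_graph G" and md: "minor_density G (Suc L) k" and fr: "fraternal G L c g out p"
  defines "g' \<equiv> L * (c * c) + 2 * (L * (g * (2 * (2 * c))))"
  defines "m \<equiv> (Suc (Suc L) * g' + 1) * (k + 1)"
  shows "\<exists>out p. fraternal G (Suc L) (max c (2 * m)) (max g g') out p"
proof -
  \<comment> \<open>Two levels that are at least 1 never sum to 1, so level 1 consists of the edges
    of \<open>G\<close> instead, and one of \<open>E0\<close> and \<open>F0\<close> is always
    empty.\<close>
  define E0 where "E0 = (if L = 0 then edges G else {})"
  define F0 where "F0 = {{u, v} | u v z a b. 1 \<le> a \<and> 1 \<le> b \<and> a + b = Suc L \<and>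
      u \<in> out a z \<and> v \<in> out b z \<and> u \<noteq> v}"
  define F where "F = E0 \<union> F0"
  have EF: "E0 = {} \<or> F0 = {}" by (auto simp: E0_def F0_def)
  have V: "finite (verts G)" using G by (simp add: simple_graph_def)
  have F2: "e \<subseteq> verts G \<and> card e = 2" if e: "e \<in> F" for e
  proof (cases "e \<in> E0")
    case True then show ?thesis using G by (auto simp: E0_def simple_graph_def split: if_splits)
  next
    case False
    then obtain u v z a b where *: "e = {u, v}" "1 \<le> a" "1 \<le> b" "a + b = Suc L"
      "u \<in> out a z" "v \<in> out b z" "u \<noteq> v" using e unfolding F_def F0_def by blast
    have "a \<in> {1..L}" "b \<in> {1..L}" using *(2-4) by auto
    then have "u \<in> verts G" "v \<in> verts G" using fraternalD(1)[OF fr] *(5,6) by blast+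
    then show ?thesis using * by simp
  qed
  have "\<exists>w. (\<forall>e\<in>F. (\<exists>u v. e = {u, v} \<and> walk G u (w e) v) \<and> length (w e) \<le> Suc (Suc L)) \<and>
      (\<forall>q. card {e \<in> F. q \<in> internals (w e)} \<le> g')"
  proof (cases "F0 = {}")
    case True
    have "\<exists>w. (\<exists>u v. e = {u, v} \<and> walk G u w v) \<and> length w \<le> Suc (Suc L) \<and> internals w = {}"
      if e: "e \<in> F" for e
    proof -
      have "e \<in> edges G" using e True by (auto simp: F_def E0_def split: if_splits)
      moreover obtain u v where uv: "e = {u, v}" using F2[OF e] by (auto simp: card_2_iff)
      ultimately have "walk G u [u, v] v" using F2[OF e] by (auto simp: walk_def less_Suc_eq)
      then show ?thesis using uv by (intro exI[of _ "[u, v]"]) (auto simp: internals_def)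
    qed
    then obtain w where w: "\<And>e. e \<in> F \<Longrightarrow> (\<exists>u v. e = {u, v} \<and> walk G u (w e) v) \<and>
      length (w e) \<le> Suc (Suc L) \<and> internals (w e) = {}" by metis
    have "{e \<in> F. q \<in> internals (w e)} = {}" for q using w by auto
    then show ?thesis using w by (intro exI[of _ w]) (metis card.empty le0)
  next
    case False
    then have FF: "F = F0" using EF by (auto simp: F_def)
    let ?P = "\<lambda>e (u, v, z, a, b, w). e = {u, v} \<and> 1 \<le> a \<and> 1 \<le> b \<and> a + b = Suc L \<and>
        u \<in> out a z \<and> v \<in> out b z \<and> walk G u w v \<and> length w \<le> Suc (Suc L) \<and>
        internals w \<subseteq> internals (p a {z, u}) \<union> {z} \<union> internals (p b {z, v})"
    have "\<exists>x. ?P e x" if e: "e \<in> F" for e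
    proof -
      obtain u v z a b where *: "e = {u, v}" "1 \<le> a" "1 \<le> b" "a + b = Suc L"
        "u \<in> out a z" "v \<in> out b z" using e unfolding FF F0_def by blast
      obtain w where "walk G u w v" "length w \<le> Suc (Suc L)"
        "internals w \<subseteq> internals (p a {z, u}) \<union> {z} \<union> internals (p b {z, v})"
        using fraternal_walk_join[OF fr *(2-6)] by blast
      then have "?P e (u, v, z, a, b, w)" using * by simp
      then show ?thesis by blast
    qed
    then have "\<forall>e\<in>F. \<exists>x. ?P e x" by (rule ballI)
    then have "\<exists>h. \<forall>e\<in>F. ?P e (h e)" by (rule bchoice)
    then obtain h where h: "\<forall>e\<in>F. ?P e (h e)" by (rule exE)
    define u v z a b w where "u e = fst (h e)" and "v e = fst (snd (h e))"
      and "z e = fst (snd (snd (h e)))" and "a e = fst (snd (snd (snd (h e))))"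
      and "b e = fst (snd (snd (snd (snd (h e)))))" and "w e = snd (snd (snd (snd (snd (h e)))))" for e
    have P: "e = {u e, v e} \<and> 1 \<le> a e \<and> 1 \<le> b e \<and> a e + b e = Suc L \<and>
        u e \<in> out (a e) (z e) \<and> v e \<in> out (b e) (z e) \<and> walk G (u e) (w e) (v e) \<and>
        length (w e) \<le> Suc (Suc L) \<and>
        internals (w e) \<subseteq> internals (p (a e) {z e, u e}) \<union> {z e} \<union> internals (p (b e) {z e, v e})"
      if "e \<in> F" for e
      using bspec[OF h that]
      unfolding u_def v_def z_def a_def b_def w_def case_prod_beta fst_conv snd_conv .
    have "card {e \<in> F. q \<in> internals (w e)} \<le> g'" for q
      unfolding g'_def
    proof (rule fraternal_congestion[OF fr G, of F u v a b z w])
      show "e = {u e, v e} \<and> 1 \<le> a e \<and> 1 \<le> b e \<and> a e + b e = Suc L \<and>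
        u e \<in> out (a e) (z e) \<and> v e \<in> out (b e) (z e) \<and>
        internals (w e) \<subseteq> internals (p (a e) {z e, u e}) \<union> {z e} \<union> internals (p (b e) {z e, v e})"
        if "e \<in> F" for e using P[OF that] by (elim conjE) (intro conjI)
    qed
    moreover have "(\<exists>x y. e = {x, y} \<and> walk G x (w e) y) \<and> length (w e) \<le> Suc (Suc L)" if "e \<in> F" for e
      using P[OF that] by (elim conjE) (intro conjI exI[of _ "u e"] exI[of _ "v e"])
    ultimately show ?thesis by blast
  qed
  then obtain w where w: "\<And>e. e \<in> F \<Longrightarrow> (\<exists>u v. e = {u, v} \<and> walk G u (w e) v) \<and> length (w e) \<le> Suc (Suc L)"
    and cong: "\<And>q. card {e \<in> F. q \<in> internals (w e)} \<le> g'" by blast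
  have sparse: "card {e \<in> F. e \<subseteq> S} \<le> m * card S" if S: "S \<subseteq> verts G" for S
    unfolding m_def
  proof (rule congested_walks_sparse[OF G md S, of _ w])
    show "e \<subseteq> S \<and> card e = 2 \<and> (\<exists>u v. e = {u, v} \<and> walk G u (w e) v) \<and> length (w e) \<le> Suc (Suc L)"
      if "e \<in> {e \<in> F. e \<subseteq> S}" for e using that F2[of e] w[of e] by simp
    fix q
    have "finite F" by (rule finite_subset[of _ "Pow (verts G)"]) (use F2 V in auto)
    then have "card {e \<in> {e \<in> F. e \<subseteq> S}. q \<in> internals (w e)} \<le> card {e \<in> F. q \<in> internals (w e)}"
      by (intro card_mono) auto
    then show "card {e \<in> {e \<in> F. e \<subseteq> S}. q \<in> internals (w e)} \<le> g'" using cong[of q] by linarith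
  qed
  obtain o1 where o1: "\<forall>v. o1 v \<subseteq> verts G \<and> card (o1 v) \<le> 2 * m \<and> v \<notin> o1 v"
    and o1F: "\<forall>u v. {u, v} \<in> F \<longleftrightarrow> v \<in> o1 u \<or> u \<in> o1 v"
    using sparse_orientation[OF V, of F m] F2 sparse by blast
  have leF: "level_edges o1 = F"
  proof (intro equalityI subsetI)
    fix e assume "e \<in> F"
    moreover then obtain u v where "e = {u, v}" using F2 by (meson card_2_iff)
    ultimately show "e \<in> level_edges o1" using o1F level_edges_iff by metis
  qed (use o1F in \<open>auto simp: level_edges_def\<close>)
  define out' p' where "out' = out(Suc L := o1)" and "p' = p(Suc L := w)"
  have old: "out' i = out i" "p' i = p i" if "i \<noteq> Suc L" for i using that by (auto simp: out'_def p'_def)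
  have new: "out' (Suc L) = o1" "p' (Suc L) = w" by (auto simp: out'_def p'_def)
  have cases: "i = Suc L \<or> i \<in> {1..L} \<and> i \<noteq> Suc L" if "i \<in> {1..Suc L}" for i using that by auto
  have "fraternal G (Suc L) (max c (2 * m)) (max g g') out' p'"
    unfolding fraternal_def
  proof (intro conjI ballI allI impI)
    fix i x assume i: "i \<in> {1..Suc L}"
    show "out' i x \<subseteq> verts G" "card (out' i x) \<le> max c (2 * m)" "x \<notin> out' i x"
      using cases[OF i] o1 fraternalD(1-3)[OF fr, of i x] old[of i] new by (auto simp: le_max_iff_disj)
  next
    fix i e assume i: "i \<in> {1..Suc L}" and e: "e \<in> level_edges (out' i)"
    have *: "(\<exists>u v. e = {u, v} \<and> walk G u (p' i e) v) \<and> length (p' i e) \<le> Suc i"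
      using cases[OF i]
    proof (elim disjE conjE)
      assume "i = Suc L"
      then show ?thesis using w[of e] e new leF by simp
    next
      assume il: "i \<in> {1..L}" "i \<noteq> Suc L"
      have "\<forall>i\<in>{1..L}. \<forall>e\<in>level_edges (out i).
          (\<exists>u v. e = {u, v} \<and> walk G u (p i e) v) \<and> length (p i e) \<le> Suc i"
        using fr unfolding fraternal_def by (elim conjE)
      from bspec[OF bspec[OF this il(1)] e[unfolded old[OF il(2)]]] show ?thesis
        unfolding old[OF il(2)] .
    qed
    from * show "\<exists>u v. e = {u, v} \<and> walk G u (p' i e) v" by (rule conjunct1)
    from * show "length (p' i e) \<le> Suc i" by (rule conjunct2)
  next
    fix i q assume i: "i \<in> {1..Suc L}"
    show "card {e \<in> level_edges (out' i). q \<in> internals (p' i e)} \<le> max g g'"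
      using cases[OF i]
    proof (elim disjE conjE)
      assume "i = Suc L"
      then show ?thesis using cong[of q] new leF by simp
    next
      assume "i \<in> {1..L}" "i \<noteq> Suc L"
      then have "card {e \<in> level_edges (out' i). q \<in> internals (p' i e)} \<le> g"
        using fraternalD(4)[OF fr] old by simp
      then show ?thesis by simp
    qed
  next
    fix a b :: nat and z u v assume ab: "1 \<le> a" "1 \<le> b"
      and *: "a + b \<le> Suc L \<and> u \<in> out' a z \<and> v \<in> out' b z \<and> u \<noteq> v"
    then have **: "u \<in> out a z" "v \<in> out b z" using old[of a] old[of b] by auto
    show "{u, v} \<in> level_edges (out' (a + b))"
    proof (cases "a + b = Suc L")
      case True
      then have "{u, v} \<in> F" using ab * ** unfolding F_def F0_def by blast
      then show ?thesis using True new leF by simp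
    next
      case False
      then have "a + b \<le> L" using * by simp
      then have "{u, v} \<in> level_edges (out (a + b))"
        using fr ab * ** unfolding fraternal_def by blast
      then show ?thesis using old False by simp
    qed
  next
    show "edges G \<subseteq> level_edges (out' 1)"
    proof (cases "L = 0")
      case True
      then have "edges G \<subseteq> F" by (simp add: F_def E0_def)
      then show ?thesis using True new leF by simp
    next
      case False
      then have "edges G \<subseteq> level_edges (out 1)" using fr unfolding fraternal_def by simp
      then show ?thesis using False old by simp
    qed
  qed
  then show ?thesis by blast
qed

text \<open>The constants come before \<open>G\<close>: each level consumes the density bound of one
  more depth, and that bound is uniform over the class.\<close>

lemma fraternal_exists:
  assumes "\<And>G. G \<in> C \<Longrightarrow> simple_graph G" "\<And>r. \<exists>k. \<forall>G\<in>C. minor_density G r k"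
  shows "\<exists>c g. \<forall>G\<in>C. \<exists>out p. fraternal G L c g out p"
proof (induction L)
  case 0
  show ?case by (simp add: fraternal_def)
next
  case (Suc L)
  then obtain c g where cg: "\<And>G. G \<in> C \<Longrightarrow> \<exists>out p. fraternal G L c g out p" by blast
  obtain k where k: "\<And>G. G \<in> C \<Longrightarrow> minor_density G (Suc L) k" using assms(2) by blast
  show ?case using fraternal_step assms(1) cg k by meson
qed

section \<open>Directed paths in the augmentation and common hubs\<close>

inductive reach :: "(nat \<Rightarrow> 'a \<Rightarrow> 'a set) \<Rightarrow> nat \<Rightarrow> 'a \<Rightarrow> 'a \<Rightarrow> bool" for out where
  start: "reach out 0 x x"
| arc: "1 \<le> a \<Longrightarrow> z \<in> out a x \<Longrightarrow> reach out i z w \<Longrightarrow> reach out (a + i) x w"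

lemma reach_snoc:
  "reach out i x y \<Longrightarrow> 1 \<le> a \<Longrightarrow> z \<in> out a y \<Longrightarrow> reach out (i + a) x z"
proof (induction rule: reach.induct)
  case (start x)
  show ?case using reach.arc[OF start reach.start[of out z]] by simp
next
  case (arc b z' x i w)
  then show ?case using reach.arc[of b z' out x "i + a" z] by (simp add: add.assoc)
qed

lemma reach_walk:
  assumes "reach out i x w" "fraternal G L c g out p" "i \<le> L" "x \<in> verts G"
  shows "\<exists>q. walk G x q w \<and> length q \<le> Suc i"
  using assms(1,3,4)
proof (induction rule: reach.induct)
  case (start x)
  then show ?case using walk_single[of x G] by (intro exI[of _ "[x]"]) simp
next
  case (arc a z x i w)
  have a: "a \<in> {1..L}" using arc by auto
  obtain q1 where q1: "walk G x q1 z" "length q1 \<le> Suc a"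
    using fraternal_walk[OF assms(2) a arc.hyps(2)] by blast
  then have "z \<in> verts G" unfolding walk_def by auto
  then obtain q2 where q2: "walk G z q2 w" "length q2 \<le> Suc i" using arc by auto
  have "walk G x (q1 @ tl q2) w" using q1 q2 by (auto intro: walk_append)
  then show ?case using q1 q2 by (intro exI[of _ "q1 @ tl q2"]) simp
qed

text \<open>At most \<open>L * c\<close> arcs leave a vertex, counted over all levels, and each uses
  up at least 1 of the remaining length.\<close>

lemma card_reach:
  assumes fr: "fraternal G L c g out p" and G: "simple_graph G"
  shows "i \<le> L \<Longrightarrow> finite {w. reach out i x w} \<and> card {w. reach out i x w} \<le> (1 + L * c) ^ i"
proof (induction i arbitrary: x rule: less_induct)
  case (less i)
  show ?case
  proof (cases "i = 0")
    case True
    have "{w. reach out 0 x w} \<subseteq> {x}" by (auto elim: reach.cases)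
    then have "finite {w. reach out 0 x w}" "card {w. reach out 0 x w} \<le> card {x}"
      by (auto intro: finite_subset card_mono simp del: card.insert)
    then show ?thesis using True by simp
  next
    case False
    define U where "U = (\<Union>a\<in>{1..i}. \<Union>z\<in>out a x. {w. reach out (i - a) z w})"
    have sub: "{w. reach out i x w} \<subseteq> U"
    proof
      fix w assume "w \<in> {w. reach out i x w}"
      then have "reach out i x w" by simp
      then obtain a z j where *: "1 \<le> a" "z \<in> out a x" "reach out j z w" "i = a + j"
        using False by (cases rule: reach.cases) auto
      then show "w \<in> U" unfolding U_def by (intro UN_I[of a] UN_I[of z]) auto
    qed
    have out: "finite (out a x)" "card (out a x) \<le> c" if "a \<in> {1..i}" for a
    proof -
      have a: "a \<in> {1..L}" using that less.prems by simp
      show "card (out a x) \<le> c" by (rule fraternalD(2)[OF fr a])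
      show "finite (out a x)" using fraternalD(1)[OF fr a] G
        by (auto simp: simple_graph_def intro: finite_subset)
    qed
    have IH: "finite {w. reach out (i - a) z w}" "card {w. reach out (i - a) z w} \<le> (1 + L * c) ^ (i - 1)"
      if "a \<in> {1..i}" for a z
    proof -
      have "i - a < i" "i - a \<le> L" using that less.prems by auto
      note * = less.IH[OF this]
      show "finite {w. reach out (i - a) z w}" using * by blast
      have "card {w. reach out (i - a) z w} \<le> (1 + L * c) ^ (i - a)" using * by blast
      also have "\<dots> \<le> (1 + L * c) ^ (i - 1)" using that by (intro power_increasing) auto
      finally show "card {w. reach out (i - a) z w} \<le> (1 + L * c) ^ (i - 1)" .
    qed
    have finU: "finite U" unfolding U_def using out IH by blast
    have "card U \<le> i * (c * (1 + L * c) ^ (i - 1))" unfolding U_def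
      by (intro card_UN_le_mult out IH) auto
    also have "\<dots> \<le> (L * c) * (1 + L * c) ^ (i - 1)"
      using less.prems by (simp add: mult.assoc)
    also have "\<dots> \<le> (1 + L * c) * (1 + L * c) ^ (i - 1)" by simp
    also have "\<dots> = (1 + L * c) ^ i" using False by (metis power_minus_mult mult.commute neq0_conv)
    finally show ?thesis using sub finU by (meson card_mono finite_subset order_trans)
  qed
qed

text \<open>If the pair is oriented from \<open>y\<close> to \<open>x\<close>, prepend it to the
  path. Otherwise it leaves \<open>x\<close>, as does the first arc of the path, to
  \<open>x'\<close> say. Then \<open>y\<close> and \<open>x'\<close> are equal or are joined at the
  sum of the two levels, so \<open>x\<close> is skipped at no cost and a shorter path remains. If
  the path is trivial, \<open>y\<close> itself becomes the hub, and \<open>z\<close> reaches it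
  through \<open>x\<close>.\<close>

lemma reach_extend:
  assumes fr: "fraternal G L c g out p"
  shows "reach out i x w \<Longrightarrow> y \<noteq> x \<Longrightarrow> {y, x} \<in> level_edges (out l) \<Longrightarrow> 1 \<le> l \<Longrightarrow>
    reach out j z w \<Longrightarrow> l + i + j \<le> L \<Longrightarrow>
    \<exists>w' i' j'. reach out i' y w' \<and> reach out j' z w' \<and> i' + j' \<le> l + i + j"
proof (induction i arbitrary: x l rule: less_induct)
  case (less i)
  show ?case
  proof (cases "x \<in> out l y")
    case True
    then have "reach out (l + i) y w" using less.prems by (intro reach.arc) auto
    then show ?thesis using less.prems by (intro exI[of _ w] exI[of _ "l + i"] exI[of _ j]) simp
  next
    case False
    then have y: "y \<in> out l x" using less.prems by (simp add: level_edges_iff)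
    from less.prems(1) show ?thesis
    proof (cases rule: reach.cases)
      case start
      then have "reach out (j + l) z y" using y less.prems by (intro reach_snoc[of out j z w]) auto
      then show ?thesis using reach.start[of out y] less.prems
        by (intro exI[of _ y] exI[of _ 0] exI[of _ "j + l"]) simp
    next
      case (arc a x' k)
      show ?thesis
      proof (cases "x' = y")
        case True
        then show ?thesis using arc less.prems
          by (intro exI[of _ w] exI[of _ k] exI[of _ j]) simp
      next
        case neq: False
        have "\<forall>a\<ge>1. \<forall>b\<ge>1. \<forall>z u v. a + b \<le> L \<and> u \<in> out a z \<and> v \<in> out b z \<and> u \<noteq> v \<longrightarrow>
            {u, v} \<in> level_edges (out (a + b))" using fr unfolding fraternal_def by (elim conjE)
        from this[rule_format, of l a y x x'] have "{y, x'} \<in> level_edges (out (l + a))"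
          using y arc neq less.prems by simp
        from less.IH[of k x' "l + a", OF _ arc(4) _ this] show ?thesis
          using arc neq less.prems by (simp add: add.assoc)
      qed
    qed
  qed
qed

text \<open>One end moves along the walk by single edges, which are pairs of level 1; the common hub
  may change at each step, but the sum of the lengths grows by at most 1.\<close>

lemma walk_common_hub:
  assumes fr: "fraternal G L c g out p" and G: "simple_graph G"
  shows "walk G x q y \<Longrightarrow> length q \<le> Suc n \<Longrightarrow> n \<le> L \<Longrightarrow>
    \<exists>w i j. reach out i x w \<and> reach out j y w \<and> i + j \<le> n"
proof (induction n arbitrary: x q)
  case 0
  then have "q = [x]" "x = y" by (auto simp: walk_def length_Suc_conv le_Suc_eq)
  then show ?case using reach.start by fastforce
next
  case (Suc n)
  show ?case
  proof (cases "length q \<le> Suc n")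
    case True
    then obtain w i j where "reach out i x w" "reach out j y w" "i + j \<le> n"
      using Suc.IH[OF Suc.prems(1) True] Suc.prems(3) by auto
    then show ?thesis by (intro exI[of _ w] exI[of _ i] exI[of _ j]) simp
  next
    case False
    then obtain x' q' where q: "q = x # x' # q'" using Suc.prems(1)
      by (cases q; cases "tl q") (auto simp: walk_def)
    have e: "{x, x'} \<in> edges G" using Suc.prems(1) q by (auto simp: walk_def)
    have w': "walk G x' (x' # q') y" using Suc.prems(1) unfolding q walk_def by fastforce
    obtain w i j where *: "reach out i x' w" "reach out j y w" "i + j \<le> n"
      using Suc.IH[OF w'] Suc.prems q by auto
    have "x \<noteq> x'" using G e by (auto simp: simple_graph_def)
    moreover have "edges G \<subseteq> level_edges (out 1)" using fr Suc.prems(3) unfolding fraternal_def by simp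
    then have "{x, x'} \<in> level_edges (out 1)" using e by blast
    ultimately obtain w' i' j' where "reach out i' x w'" "reach out j' y w'" "i' + j' \<le> 1 + i + j"
      using reach_extend[OF fr *(1) _ _ _ *(2), of x 1] * Suc.prems(3) by auto
    then show ?thesis using *(3) by (intro exI[of _ w'] exI[of _ i'] exI[of _ j']) simp
  qed
qed

text \<open>Vertices and hubs have independent types, so that a labelling can be pulled back to
  vertex numbers and to positions in a list.\<close>

definition hub_labelling :: "'b set \<Rightarrow> nat \<Rightarrow> nat \<Rightarrow> ('b \<Rightarrow> ('w \<times> nat) set) \<Rightarrow> ('b \<Rightarrow> 'b \<Rightarrow> bool) \<Rightarrow> bool" where
  "hub_labelling V c d lab adj \<longleftrightarrow>
    (\<forall>x\<in>V. finite (lab x) \<and> card (lab x) \<le> c \<and> snd ` lab x \<subseteq> {..d}) \<and>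
    (\<forall>x\<in>V. \<forall>y\<in>V. adj x y \<longleftrightarrow> (\<exists>w i j. (w, i) \<in> lab x \<and> (w, j) \<in> lab y \<and> i + j \<le> d))"

text \<open>Division by zero yields zero, so the ratio says nothing if
  \<open>card (verts M) = 0\<close>; there the finiteness of the partition shows that
  \<open>M\<close> is empty.\<close>

lemma minor_density_of_bounded_expansion:
  assumes "\<And>G. G \<in> C \<Longrightarrow> simple_graph G" "bounded_expansion C"
  shows "\<exists>k. \<forall>G\<in>C. minor_density G r k"
proof -
  obtain k :: real where k: "\<And>G M. G \<in> C \<Longrightarrow> depth_minor r M G \<Longrightarrow>
      real (card (edges M)) / real (card (verts M)) \<le> k"
    using assms(2) unfolding bounded_expansion_def by metis
  have "card (edges M) \<le> nat \<lceil>k\<rceil> * card (verts M)" if G: "G \<in> C" and M: "depth_minor r M G" for G M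
  proof (cases "card (verts M) = 0")
    case True
    obtain S P where SP: "subgraph S G" "partition_on (verts S) P" "M = contraction S P"
      using M unfolding depth_minor_def by blast
    have "finite (verts S)" using SP(1) by (auto simp: subgraph_def simple_graph_def)
    then have "finite P" using SP(2) finite_elements by blast
    then have "P = {}" using True SP(3) by (simp add: contraction_def)
    then show ?thesis using SP(3) by (simp add: contraction_def)
  next
    case False
    have "real (card (edges M)) \<le> k * real (card (verts M))"
      using k[OF G M] False by (simp add: field_simps)
    also have "\<dots> \<le> real (nat \<lceil>k\<rceil>) * real (card (verts M))"
      by (intro mult_right_mono) (auto simp: real_nat_ceiling_ge)
    finally show ?thesis by (metis of_nat_le_iff of_nat_mult)
  qed
  then show ?thesis unfolding minor_density_def by blast
qed

text \<open>The labels of \<open>x\<close> are the ends of directed paths of length at most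
  \<open>d\<close>, each with all of its possible lengths: \<open>Suc d\<close> lengths with at most
  \<open>(1 + d * c) ^ d\<close> ends for each.\<close>

theorem bounded_expansion_hub_labelling:
  assumes "\<And>G. G \<in> C \<Longrightarrow> simple_graph G" "bounded_expansion C"
  shows "\<exists>c. \<forall>G\<in>C. \<exists>lab :: 'a \<Rightarrow> ('a \<times> nat) set.
    hub_labelling (verts G) c d lab (\<lambda>x y. gdist G x y \<le> enat d)"
proof -
  have "\<And>r. \<exists>k. \<forall>G\<in>C. minor_density G r k"
    using minor_density_of_bounded_expansion assms by blast
  from fraternal_exists[OF assms(1) this] obtain c g where
    fr: "\<And>G. G \<in> C \<Longrightarrow> \<exists>out p. fraternal G d c g out p" by blast
  have "\<exists>lab :: 'a \<Rightarrow> ('a \<times> nat) set.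
      hub_labelling (verts G) (Suc d * (1 + d * c) ^ d) d lab (\<lambda>x y. gdist G x y \<le> enat d)"
    if GC: "G \<in> C" for G
  proof -
    have G: "simple_graph G" using assms(1) GC by blast
    obtain out p where frG: "fraternal G d c g out p" using fr[OF GC] by blast
    define lab where "lab x = (\<Union>i\<in>{..d}. (\<lambda>w. (w, i)) ` {w. reach out i x w})" for x
    have lab: "(w, i) \<in> lab x \<longleftrightarrow> i \<le> d \<and> reach out i x w" for w i x by (auto simp: lab_def)
    have fin: "finite (lab x)" for x unfolding lab_def using card_reach[OF frG G] by blast
    have card: "card (lab x) \<le> Suc d * (1 + d * c) ^ d" for x unfolding lab_def
    proof (intro card_UN_le_mult)
      fix i assume "i \<in> {..d}"
      then have i: "i \<le> d" by simp
      have "card ((\<lambda>w. (w, i)) ` {w. reach out i x w}) \<le> card {w. reach out i x w}"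
        using card_reach[OF frG G i] by (blast intro: card_image_le)
      also have "\<dots> \<le> (1 + d * c) ^ i" using card_reach[OF frG G i] by blast
      also have "\<dots> \<le> (1 + d * c) ^ d" using i by (intro power_increasing) auto
      finally show "card ((\<lambda>w. (w, i)) ` {w. reach out i x w}) \<le> (1 + d * c) ^ d" .
    qed auto
    have "gdist G x y \<le> enat d \<longleftrightarrow> (\<exists>w i j. (w, i) \<in> lab x \<and> (w, j) \<in> lab y \<and> i + j \<le> d)"
      if x: "x \<in> verts G" and y: "y \<in> verts G" for x y
    proof
      assume "gdist G x y \<le> enat d"
      then obtain q where "walk G x q y" "length q \<le> Suc d" unfolding gdist_le_iff by blast
      from walk_common_hub[OF frG G this] obtain w i j where
        "reach out i x w" "reach out j y w" "i + j \<le> d" by auto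
      then show "\<exists>w i j. (w, i) \<in> lab x \<and> (w, j) \<in> lab y \<and> i + j \<le> d"
        by (intro exI[of _ w] exI[of _ i] exI[of _ j]) (simp add: lab)
    next
      assume "\<exists>w i j. (w, i) \<in> lab x \<and> (w, j) \<in> lab y \<and> i + j \<le> d"
      then obtain w i j where *: "reach out i x w" "reach out j y w" "i + j \<le> d" by (auto simp: lab)
      obtain q1 where q1: "walk G x q1 w" "length q1 \<le> Suc i"
        using reach_walk[OF *(1) frG _ x] *(3) by auto
      obtain q2 where q2: "walk G y q2 w" "length q2 \<le> Suc j"
        using reach_walk[OF *(2) frG _ y] *(3) by auto
      have "walk G x (q1 @ tl (rev q2)) y" by (rule walk_append[OF q1(1) walk_rev[OF q2(1)]])
      moreover have "length (q1 @ tl (rev q2)) \<le> Suc d" using q1(2) q2(2) *(3) by simp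
      ultimately show "gdist G x y \<le> enat d" unfolding gdist_le_iff by blast
    qed
    then have "hub_labelling (verts G) (Suc d * (1 + d * c) ^ d) d lab (\<lambda>x y. gdist G x y \<le> enat d)"
      unfolding hub_labelling_def using fin card lab by (auto simp: lab)
    then show ?thesis by blast
  qed
  then show ?thesis by blast
qed

section \<open>Neighborhood classes in hub graphs\<close>

definition dif :: "('b \<Rightarrow> 'b \<Rightarrow> bool) \<Rightarrow> 'b set \<Rightarrow> 'b \<Rightarrow> 'b \<Rightarrow> nat" where
  "dif adj X x y = card {z \<in> X. adj x z \<noteq> adj y z}"

definition near :: "('b \<Rightarrow> 'b \<Rightarrow> bool) \<Rightarrow> 'b set \<Rightarrow> 'b \<Rightarrow> nat \<Rightarrow> 'b set" where
  "near adj X s q = {x \<in> X. dif adj X s x * q \<le> card X}"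

text \<open>A clique for whatever \<open>T\<close>, so a wrong choice of center or scale can only
  make the output small, never incorrect.\<close>

definition universal :: "('b \<Rightarrow> 'b \<Rightarrow> bool) \<Rightarrow> 'b set \<Rightarrow> 'b set" where
  "universal adj T = {x \<in> T. \<forall>y\<in>T. adj x y}"

definition weight :: "('b \<Rightarrow> ('w \<times> nat) set) \<Rightarrow> 'b set \<Rightarrow> 'w \<Rightarrow> nat" where
  "weight lab X w = card {z \<in> X. w \<in> fst ` lab z}"

text \<open>The fraction \<open>1 / N\<close> of \<open>X\<close> is the threshold; a hub that is
  not heavy satisfies \<open>weight lab X w * N \<le> card X\<close>.\<close>

definition heavy :: "('b \<Rightarrow> ('w \<times> nat) set) \<Rightarrow> 'b set \<Rightarrow> nat \<Rightarrow> 'w set" where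
  "heavy lab X N = {w. weight lab X w * N > card X}"

definition heavy_type :: "('b \<Rightarrow> ('w \<times> nat) set) \<Rightarrow> 'b set \<Rightarrow> nat \<Rightarrow> 'b \<Rightarrow> ('w \<times> nat) set" where
  "heavy_type lab X N x = {p \<in> lab x. fst p \<in> heavy lab X N}"

text \<open>The number of subsets of a product of \<open>c * N\<close> heavy hubs with
  \<open>Suc d\<close> labels.\<close>

definition type_bound :: "nat \<Rightarrow> nat \<Rightarrow> nat \<Rightarrow> nat" where
  "type_bound c d N = 2 ^ (c * N * Suc d)"

lemma dif_triangle:
  assumes "finite X"
  shows "dif adj X x z \<le> dif adj X x y + dif adj X y z"
proof -
  have "dif adj X x z \<le> card ({u \<in> X. adj x u \<noteq> adj y u} \<union> {u \<in> X. adj y u \<noteq> adj z u})"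
    unfolding dif_def using assms by (intro card_mono) auto
  then show ?thesis unfolding dif_def using card_Un_le le_trans by blast
qed

section \<open>Degeneracy of hub graphs\<close>

locale hub_graph =
  fixes V :: "'b set" and c d :: nat and lab :: "'b \<Rightarrow> ('w \<times> nat) set" and adj :: "'b \<Rightarrow> 'b \<Rightarrow> bool"
  assumes hub: "hub_labelling V c d lab adj"
begin

lemma finite_lab: "x \<in> V \<Longrightarrow> finite (lab x)"
  using hub by (simp add: hub_labelling_def)

lemma card_hubs: "x \<in> V \<Longrightarrow> card (fst ` lab x) \<le> c"
  using hub card_image_le[of "lab x" fst] by (fastforce simp: hub_labelling_def)

lemma lab_le: "x \<in> V \<Longrightarrow> (w, i) \<in> lab x \<Longrightarrow> i \<le> d"
  using hub by (force simp: hub_labelling_def)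

lemma adj_iff: "x \<in> V \<Longrightarrow> y \<in> V \<Longrightarrow> adj x y \<longleftrightarrow> (\<exists>w i j. (w, i) \<in> lab x \<and> (w, j) \<in> lab y \<and> i + j \<le> d)"
  using hub by (simp add: hub_labelling_def)

text \<open>Every vertex has at most \<open>c\<close> hubs and thus at most
  \<open>c * \<omega>\<close> out-neighbors. Each adjacent pair is counted in \<open>A\<close> or
  its converse, and averaging over \<open>S\<close> costs the factor 2.\<close>

lemma degeneracy_le:
  assumes S: "S \<subseteq> V" "finite S" "S \<noteq> {}"
    and om: "\<And>A. A \<subseteq> S \<Longrightarrow> (\<And>x y. x \<in> A \<Longrightarrow> y \<in> A \<Longrightarrow> adj x y) \<Longrightarrow> card A \<le> \<omega>"
    and deg: "\<And>v. v \<in> S \<Longrightarrow> k \<le> card {u \<in> S. adj v u}"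
  shows "k \<le> 2 * c * \<omega>"
proof -
  define low where "low w = {u \<in> S. \<exists>j. (w, j) \<in> lab u \<and> 2 * j \<le> d}" for w
  have low: "card (low w) \<le> \<omega>" for w
  proof (rule om)
    show "low w \<subseteq> S" by (auto simp: low_def)
    fix x y assume "x \<in> low w" "y \<in> low w"
    then obtain i j where "x \<in> V" "y \<in> V" "(w, i) \<in> lab x" "(w, j) \<in> lab y" "2 * i \<le> d" "2 * j \<le> d"
      using S(1) by (auto simp: low_def)
    then show "adj x y" using adj_iff[of x y] by (metis add_le_mono mult_2 nat_mult_le_cancel_disj add_mult_distrib2 zero_less_numeral)
  qed
  define A where "A = (SIGMA v:S. \<Union>w\<in>fst ` lab v. low w)"
  have finA: "finite A" unfolding A_def
    by (rule finite_SigmaI) (use S in \<open>auto simp: low_def intro: finite_subset[of _ S]\<close>)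
  have cA: "card A \<le> card S * (c * \<omega>)"
  proof -
    have fin: "finite (\<Union>w\<in>fst ` lab v. low w)" for v
      by (rule finite_subset[of _ S]) (use S in \<open>auto simp: low_def\<close>)
    have "card A = (\<Sum>v\<in>S. card (\<Union>w\<in>fst ` lab v. low w))"
      unfolding A_def using fin S by (intro card_SigmaI) auto
    also have "\<dots> \<le> card S * (c * \<omega>)"
    proof (rule sum_bounded_above[where 'a = nat, simplified])
      fix v assume "v \<in> S"
      then have "v \<in> V" using S by blast
      then show "card (\<Union>w\<in>fst ` lab v. low w) \<le> c * \<omega>"
        by (intro card_UN_le_mult card_hubs low finite_imageI finite_lab)
    qed
    finally show ?thesis .
  qed
  have sub: "(SIGMA v:S. {u \<in> S. adj v u}) \<subseteq> A \<union> A\<inverse>"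
  proof
    fix p assume "p \<in> (SIGMA v:S. {u \<in> S. adj v u})"
    then obtain v u where p: "p = (v, u)" "v \<in> S" "u \<in> S" "adj v u" by auto
    then obtain w i j where w: "(w, i) \<in> lab v" "(w, j) \<in> lab u" "i + j \<le> d"
      using adj_iff[of v u] S(1) by blast
    have hubs: "w \<in> fst ` lab v" "w \<in> fst ` lab u" using w by force+
    show "p \<in> A \<union> A\<inverse>"
    proof (cases "2 * j \<le> d")
      case True
      then have "u \<in> low w" using p w by (auto simp: low_def)
      then have "(v, u) \<in> A" unfolding A_def using p(2) hubs(1) by blast
      then show ?thesis using p(1) by simp
    next
      case False
      then have "2 * i \<le> d" using w by simp
      then have "v \<in> low w" using p w by (auto simp: low_def)
      then have "(u, v) \<in> A" unfolding A_def using p(3) hubs(2) by blast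
      then show ?thesis using p(1) by simp
    qed
  qed
  have "card S * k \<le> (\<Sum>v\<in>S. card {u \<in> S. adj v u})"
    using sum_bounded_below[of S k "\<lambda>v. card {u \<in> S. adj v u}"] deg by simp
  also have "\<dots> = card (SIGMA v:S. {u \<in> S. adj v u})" using S by (intro card_SigmaI[symmetric]) auto
  also have "\<dots> \<le> card (A \<union> A\<inverse>)" using sub finA by (intro card_mono) auto
  also have "\<dots> \<le> card A + card (A\<inverse>)" by (rule card_Un_le)
  also have "\<dots> \<le> card S * (2 * c * \<omega>)" using cA by (simp add: card_inverse)
  finally show ?thesis using S by (simp add: card_gt_0_iff)
qed

end

section \<open>Heavy hubs, light hubs and types inside a vertex set\<close>

locale hub_subset = hub_graph +
  fixes X :: "'b set"
  assumes X: "X \<subseteq> V" "finite X" "X \<noteq> {}"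
begin

lemma XV: "x \<in> X \<Longrightarrow> x \<in> V" using X by blast

lemma sum_weight_le:
  assumes "finite U"
  shows "(\<Sum>w\<in>U. weight lab X w) \<le> c * card X"
proof -
  have "(\<Sum>w\<in>U. weight lab X w) = (\<Sum>w\<in>U. \<Sum>z\<in>X. if w \<in> fst ` lab z then 1 else 0 :: nat)"
    using X by (simp add: weight_def sum.If_cases Int_def)
  also have "\<dots> = (\<Sum>z\<in>X. \<Sum>w\<in>U. if w \<in> fst ` lab z then 1 else 0 :: nat)" by (rule sum.swap)
  also have "\<dots> = (\<Sum>z\<in>X. card (U \<inter> fst ` lab z))"
    using assms by (simp add: sum.If_cases)
  also have "\<dots> \<le> (\<Sum>z\<in>X. c)"
  proof (rule sum_mono)
    fix z assume "z \<in> X"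
    then have "finite (fst ` lab z)" "card (fst ` lab z) \<le> c" using XV finite_lab card_hubs by auto
    then show "card (U \<inter> fst ` lab z) \<le> c" by (meson card_mono inf_le2 order_trans)
  qed
  finally show ?thesis by (simp add: mult.commute)
qed

lemma heavy_finite: "finite (heavy lab X N)"
proof (rule finite_subset)
  show "heavy lab X N \<subseteq> (\<Union>z\<in>X. fst ` lab z)"
  proof
    fix w assume "w \<in> heavy lab X N"
    then have "weight lab X w \<noteq> 0" by (intro notI) (simp add: heavy_def)
    then have "{z \<in> X. w \<in> fst ` lab z} \<noteq> {}" unfolding weight_def by (metis card.empty)
    then show "w \<in> (\<Union>z\<in>X. fst ` lab z)" by blast
  qed
qed (use X XV finite_lab in auto)

text \<open>The weights sum up to at most \<open>c * card X\<close>, and a heavy hub takes more than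
  the fraction \<open>1 / N\<close> of \<open>X\<close>.\<close>

lemma card_heavy: "card (heavy lab X N) \<le> c * N"
proof -
  have "card (heavy lab X N) * card X \<le> (\<Sum>w\<in>heavy lab X N. weight lab X w * N)"
    using sum_bounded_below[of "heavy lab X N" "card X" "\<lambda>w. weight lab X w * N"]
    by (simp add: heavy_def less_imp_le)
  also have "\<dots> = (\<Sum>w\<in>heavy lab X N. weight lab X w) * N" by (simp add: sum_distrib_right)
  also have "\<dots> \<le> c * card X * N" by (intro mult_right_mono sum_weight_le heavy_finite) simp
  finally have "card (heavy lab X N) * card X \<le> c * N * card X" by (simp add: mult_ac)
  then show ?thesis using X by (simp add: card_gt_0_iff)
qed

lemma card_types:
  assumes "S \<subseteq> X"
  shows "finite (heavy_type lab X N ` S)" "card (heavy_type lab X N ` S) \<le> type_bound c d N"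
proof -
  let ?P = "Pow (heavy lab X N \<times> {..d})"
  have fin: "finite ?P" using heavy_finite by simp
  have sub: "heavy_type lab X N ` S \<subseteq> ?P"
  proof
    fix t assume "t \<in> heavy_type lab X N ` S"
    then obtain x where x: "x \<in> V" "t = heavy_type lab X N x" using assms X by blast
    show "t \<in> ?P" unfolding x heavy_type_def using lab_le[OF x(1)] by auto
  qed
  show "finite (heavy_type lab X N ` S)" using sub fin finite_subset by blast
  have "card (heavy_type lab X N ` S) \<le> card ?P" by (rule card_mono[OF fin sub])
  also have "\<dots> = 2 ^ (card (heavy lab X N) * Suc d)"
    using heavy_finite by (simp add: card_Pow card_cartesian_product)
  also have "\<dots> \<le> type_bound c d N" unfolding type_bound_def
    using card_heavy by (intro power_increasing mult_right_mono) auto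
  finally show "card (heavy_type lab X N ` S) \<le> type_bound c d N" .
qed

lemma card_light:
  assumes "x \<in> V" "L \<subseteq> fst ` lab x" "\<And>w. w \<in> L \<Longrightarrow> weight lab X w * N \<le> k"
  shows "card (\<Union>w\<in>L. {z \<in> X. w \<in> fst ` lab z}) * N \<le> c * k"
proof -
  have finL: "finite L" using assms finite_lab by (meson finite_imageI finite_subset)
  have cL: "card L \<le> c" using assms card_hubs finite_lab by (meson card_mono finite_imageI order_trans)
  have "card (\<Union>w\<in>L. {z \<in> X. w \<in> fst ` lab z}) \<le> (\<Sum>w\<in>L. weight lab X w)"
    unfolding weight_def by (rule card_UN_le[OF finL])
  then have "card (\<Union>w\<in>L. {z \<in> X. w \<in> fst ` lab z}) * N \<le> (\<Sum>w\<in>L. weight lab X w) * N" by simp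
  also have "\<dots> = (\<Sum>w\<in>L. weight lab X w * N)" by (simp add: sum_distrib_right)
  also have "\<dots> \<le> card L * k"
    using sum_bounded_above[of L "\<lambda>w. weight lab X w * N" k] assms(3) by simp
  also have "\<dots> \<le> c * k" using cL by simp
  finally show ?thesis .
qed

text \<open>A vertex adjacent to just one of \<open>x\<close> and \<open>y\<close> cannot owe this
  to a hub that is heavy at \<open>N0\<close>, where their labels agree; so it sees one of at most
  \<open>2 * c\<close> light hubs. The threshold \<open>N\<close> for lightness is kept separate
  from \<open>N0\<close>: both coincide in a packing, and they are the two sides of a gap in the
  search for a clique.\<close>

lemma dif_same_type:
  assumes x: "x \<in> X" and y: "y \<in> X" and eq: "heavy_type lab X N0 x = heavy_type lab X N0 y"
    and light: "\<And>w. w \<in> fst ` lab x \<union> fst ` lab y \<Longrightarrow> w \<notin> heavy lab X N0 \<Longrightarrow> weight lab X w * N \<le> card X"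
  shows "dif adj X x y * N \<le> 2 * c * card X"
proof -
  define L where "L v = fst ` lab v - heavy lab X N0" for v
  define B where "B v = (\<Union>w\<in>L v. {z \<in> X. w \<in> fst ` lab z})" for v
  have cross: "z \<in> B u" if u: "u \<in> X" and v: "v \<in> X" and t: "heavy_type lab X N0 u = heavy_type lab X N0 v"
    and z: "z \<in> X" "adj u z" "\<not> adj v z" for u v z
  proof -
    obtain w i j where w: "(w, i) \<in> lab u" "(w, j) \<in> lab z" "i + j \<le> d"
      using adj_iff XV u z by blast
    have "w \<notin> heavy lab X N0"
    proof
      assume "w \<in> heavy lab X N0"
      then have "(w, i) \<in> heavy_type lab X N0 u" using w by (simp add: heavy_type_def)
      then have "(w, i) \<in> lab v" unfolding t by (simp add: heavy_type_def)
      then have "adj v z" using w adj_iff XV v z(1) by blast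
      then show False using z by blast
    qed
    moreover have "w \<in> fst ` lab u" "w \<in> fst ` lab z" using w by force+
    ultimately show ?thesis using z unfolding B_def L_def by blast
  qed
  have fin: "finite (B x \<union> B y)" by (rule finite_subset[of _ X]) (use X in \<open>auto simp: B_def\<close>)
  have "{z \<in> X. adj x z \<noteq> adj y z} \<subseteq> B x \<union> B y"
    using cross[OF x y eq] cross[OF y x eq[symmetric]] by blast
  then have "dif adj X x y \<le> card (B x) + card (B y)"
    unfolding dif_def using fin card_Un_le by (meson card_mono order_trans)
  then have "dif adj X x y * N \<le> card (B x) * N + card (B y) * N"
    by (metis add_mult_distrib mult_le_mono1)
  moreover have "card (B x) * N \<le> c * card X" unfolding B_def
    using light by (intro card_light[OF XV[OF x]]) (auto simp: L_def)
  moreover have "card (B y) * N \<le> c * card X" unfolding B_def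
    using light by (intro card_light[OF XV[OF y]]) (auto simp: L_def)
  ultimately show ?thesis by linarith
qed

text \<open>At threshold \<open>2 * c * Q\<close>, vertices of equal type differ on at most the
  fraction \<open>1 / Q\<close> of \<open>X\<close>. Separated vertices hence have distinct
  types.\<close>

lemma packing:
  assumes S: "S \<subseteq> X" and c: "c > 0"
    and sep: "\<And>x y. x \<in> S \<Longrightarrow> y \<in> S \<Longrightarrow> x \<noteq> y \<Longrightarrow> card X < dif adj X x y * Q"
  shows "card S \<le> type_bound c d (2 * c * Q)"
proof -
  have "inj_on (heavy_type lab X (2 * c * Q)) S"
  proof (rule inj_onI, rule ccontr)
    fix x y assume xy: "x \<in> S" "y \<in> S" "heavy_type lab X (2 * c * Q) x = heavy_type lab X (2 * c * Q) y" "x \<noteq> y"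
    have "dif adj X x y * (2 * c * Q) \<le> 2 * c * card X"
      by (rule dif_same_type[OF _ _ xy(3)]) (use xy S in \<open>auto simp: heavy_def\<close>)
    then have "(2 * c) * (dif adj X x y * Q) \<le> (2 * c) * card X" by (simp add: mult_ac)
    then have "dif adj X x y * Q \<le> card X" using c by simp
    then show False using sep[OF xy(1,2,4)] by simp
  qed
  then have "card S = card (heavy_type lab X (2 * c * Q) ` S)" by (simp add: card_image)
  then show ?thesis using card_types(2)[OF S] by simp
qed

end

section \<open>A gap between thresholds and a large universal set\<close>

primrec scale :: "nat \<Rightarrow> nat \<Rightarrow> nat \<Rightarrow> nat \<Rightarrow> nat" where
  "scale c d \<kappa> 0 = 1"
| "scale c d \<kappa> (Suc j) = (2 * c + 1) * (6 * \<kappa> * type_bound c d (scale c d \<kappa> j) + 1)"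

lemma scale_le_Suc:
  assumes "c > 0" "\<kappa> > 0"
  shows "scale c d \<kappa> j \<le> scale c d \<kappa> (Suc j)"
proof -
  let ?N = "scale c d \<kappa> j"
  have "?N \<le> 2 ^ ?N" by (simp add: less_imp_le)
  also have "\<dots> \<le> type_bound c d ?N" unfolding type_bound_def
    using mult_le_mono[OF mult_le_mono[of 1 c ?N ?N], of 1 "Suc d"] assms
    by (intro power_increasing) auto
  also have "\<dots> \<le> 6 * \<kappa> * type_bound c d ?N + 1"
  proof -
    have "1 * type_bound c d ?N \<le> 6 * \<kappa> * type_bound c d ?N"
      using assms by (intro mult_le_mono1) simp
    then show ?thesis by linarith
  qed
  also have "\<dots> \<le> scale c d \<kappa> (Suc j)" by simp
  finally show ?thesis .
qed

lemma scale_mono: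
  assumes "c > 0" "\<kappa> > 0" "i \<le> j"
  shows "scale c d \<kappa> i \<le> scale c d \<kappa> j"
  using assms(3) by (rule lift_Suc_mono_le[of "scale c d \<kappa>", OF scale_le_Suc[OF assms(1,2)]])

context hub_subset
begin

text \<open>Each hub of a vertex lies in the gap between two consecutive scales for at most one pair of scales,
  so some gap is avoided by all hubs of most vertices.\<close>
lemma gap_exists:
  assumes J: "J > 0" and mono: "\<And>i j. i \<le> j \<Longrightarrow> N i \<le> (N j :: nat)"
  shows "\<exists>j<J. card {x \<in> X. fst ` lab x \<inter> (heavy lab X (N (Suc j)) - heavy lab X (N j)) \<noteq> {}} * J
    \<le> c * card X"
proof (rule ccontr)
  define M where "M j = {x \<in> X. fst ` lab x \<inter> (heavy lab X (N (Suc j)) - heavy lab X (N j)) \<noteq> {}}" for j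
  assume "\<not> ?thesis"
  then have big: "\<And>j. j < J \<Longrightarrow> c * card X < card (M j) * J" by (auto simp: M_def not_le)
  have hmono: "heavy lab X (N i) \<subseteq> heavy lab X (N j)" if "i \<le> j" for i j
    using mono[OF that] unfolding heavy_def by (auto intro: less_le_trans mult_le_mono2)
  have one: "card {j. j < J \<and> x \<in> M j} \<le> c" if x: "x \<in> X" for x
  proof -
    have "\<forall>j\<in>{j. j < J \<and> x \<in> M j}. \<exists>w. w \<in> fst ` lab x \<inter> (heavy lab X (N (Suc j)) - heavy lab X (N j))"
      by (auto simp: M_def)
    then obtain h where h: "\<And>j. j < J \<Longrightarrow> x \<in> M j \<Longrightarrow> h j \<in> fst ` lab x"
      "\<And>j. j < J \<Longrightarrow> x \<in> M j \<Longrightarrow> h j \<in> heavy lab X (N (Suc j))"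
      "\<And>j. j < J \<Longrightarrow> x \<in> M j \<Longrightarrow> h j \<notin> heavy lab X (N j)" by (metis (mono_tags, lifting) Diff_iff IntE mem_Collect_eq)
    \<comment> \<open>A hub in gap \<open>i\<close> is heavy at every later threshold, so it lies in
      no later gap.\<close>
    have neq: "h i \<noteq> h j" if "i < j" "i < J" "j < J" "x \<in> M i" "x \<in> M j" for i j
      using h(2)[of i] h(3)[of j] hmono[of "Suc i" j] that by auto
    have "inj_on h {j. j < J \<and> x \<in> M j}"
    proof (rule inj_onI)
      fix i j assume "i \<in> {j. j < J \<and> x \<in> M j}" "j \<in> {j. j < J \<and> x \<in> M j}" "h i = h j"
      then show "i = j" using neq[of i j] neq[of j i] by (cases i j rule: linorder_cases) auto
    qed
    moreover have "h ` {j. j < J \<and> x \<in> M j} \<subseteq> fst ` lab x" using h(1) by blast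
    ultimately have "card {j. j < J \<and> x \<in> M j} \<le> card (fst ` lab x)"
      using finite_lab[OF XV[OF x]] by (intro card_inj_on_le) auto
    then show ?thesis using card_hubs[OF XV[OF x]] by simp
  qed
  have "(\<Sum>j<J. card (M j)) = (\<Sum>j<J. \<Sum>x\<in>X. if x \<in> M j then 1 else 0 :: nat)"
    using X by (intro sum.cong) (auto simp: sum.If_cases M_def Int_def)
  also have "\<dots> = (\<Sum>x\<in>X. \<Sum>j<J. if x \<in> M j then 1 else 0 :: nat)" by (rule sum.swap)
  also have "\<dots> = (\<Sum>x\<in>X. card {j. j < J \<and> x \<in> M j})"
    by (intro sum.cong refl) (auto simp: sum.If_cases Int_def)
  also have "\<dots> \<le> card X * c" using sum_bounded_above[of X "\<lambda>x. card {j. j < J \<and> x \<in> M j}" c] one by simp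
  finally have "(\<Sum>j<J. card (M j)) * J \<le> card X * c * J" by simp
  moreover have "(\<Sum>j<J. c * card X) < (\<Sum>j<J. card (M j) * J)"
    using J big by (intro sum_strict_mono) auto
  moreover have "(\<Sum>j<J. card (M j) * J) = (\<Sum>j<J. card (M j)) * J" by (rule sum_distrib_right[symmetric])
  moreover have "(\<Sum>j<J. c * card X) = card X * c * J" by (simp add: mult_ac)
  ultimately show False by linarith
qed

lemma popular_fiber:
  assumes "finite K" "K \<noteq> {}" "finite (t ` K)" "card (t ` K) \<le> F"
  shows "\<exists>a\<in>t ` K. card K \<le> F * card {x \<in> K. t x = a}"
proof -
  let ?f = "\<lambda>a. card {x \<in> K. t x = a}"
  have "Max (?f ` t ` K) \<in> ?f ` t ` K" using assms by (intro Max_in) auto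
  then obtain a where a: "a \<in> t ` K" "?f a = Max (?f ` t ` K)" by force
  have "card (\<Union>b\<in>t ` K. {x \<in> K. t x = b}) \<le> F * ?f a"
    using assms a(2) by (intro card_UN_le_mult) auto
  moreover have "(\<Union>b\<in>t ` K. {x \<in> K. t x = b}) = K" by auto
  ultimately show ?thesis using a(1) by auto
qed

text \<open>The vertices of \<open>K\<close> that avoid the gap and have the most popular type form
  \<open>Kt\<close>; their neighborhoods nearly agree, so a center near one of them is near all. A
  vertex \<open>y\<close> near that center sees almost all of \<open>Kt\<close>, too many to see
  them through light hubs only, so it is adjacent to some \<open>z\<close> in \<open>Kt\<close>
  through a heavy hub. As all vertices of \<open>Kt\<close> have the labels of \<open>z\<close>
  there, \<open>y\<close> is adjacent to all of them.\<close>

theorem large_universal_set: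
  assumes c: "c > 0" and kap: "\<kappa> > 0" and K: "K \<subseteq> X" "\<And>x y. x \<in> K \<Longrightarrow> y \<in> K \<Longrightarrow> adj x y"
    and XK: "card X \<le> \<kappa> * card K"
  defines "Q \<equiv> scale c d \<kappa> (2 * c * \<kappa>)"
  assumes net: "\<And>x. x \<in> X \<Longrightarrow> \<exists>s\<in>ss. dif adj X s x * Q \<le> card X"
  shows "\<exists>s\<in>ss. \<exists>q\<in>{1..Q}.
    card X \<le> 2 * \<kappa> * type_bound c d Q * card (universal adj (near adj X s q))"
proof -
  \<comment> \<open>With \<open>2 * c * \<kappa>\<close> gaps to choose from, the vertices with a
    hub in the best gap are at most half as many as \<open>K\<close>.\<close>
  define J where "J = 2 * c * \<kappa>"
  define N where "N = scale c d \<kappa>"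
  have J: "J > 0" using c kap by (simp add: J_def)
  have mono: "N i \<le> N j" if "i \<le> j" for i j unfolding N_def by (rule scale_mono[OF c kap that])
  define med where "med j = {x \<in> X. fst ` lab x \<inter> (heavy lab X (N (Suc j)) - heavy lab X (N j)) \<noteq> {}}" for j
  obtain j where j: "j < J" "card (med j) * J \<le> c * card X"
    using gap_exists[of J N, OF J mono] unfolding med_def by blast
  define F where "F = type_bound c d (N j)"
  \<comment> \<open>Each of three exceptional sets below has at most \<open>card X / q\<close>
    vertices, while \<open>card X \<le> 2 * \<kappa> * F * card Kt\<close>; \<open>q\<close> is one
    more than what lets them cover \<open>Kt\<close>.\<close>
  define q where "q = 6 * \<kappa> * F + 1"
  have N': "N (Suc j) = (2 * c + 1) * q" by (simp add: N_def q_def F_def)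
  have NQ: "N (Suc j) \<le> Q" unfolding Q_def using mono[of "Suc j" J] j(1) by (simp add: N_def J_def)
  have qQ: "q \<le> Q" using NQ N' by simp
  have finK: "finite K" using K(1) X finite_subset by blast
  have cX: "card X > 0" using X by (simp add: card_gt_0_iff)
  then have cK: "card K > 0" using XK by (cases "card K") auto
  have "c * \<kappa> * (2 * card (med j)) \<le> c * \<kappa> * card K"
  proof -
    have "c * \<kappa> * (2 * card (med j)) = card (med j) * J" by (simp add: J_def mult_ac)
    also have "\<dots> \<le> c * card X" by (rule j(2))
    also have "\<dots> \<le> c * (\<kappa> * card K)" using XK by (rule mult_le_mono2)
    finally show ?thesis by (simp add: mult_ac)
  qed
  then have med_le: "2 * card (med j) \<le> card K" using c kap by simp
  define K' where "K' = K - med j"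
  have K'2: "card K \<le> 2 * card K'"
  proof -
    have "card K - card (med j) \<le> card K'" unfolding K'_def
      by (rule diff_card_le_card_Diff) (use X in \<open>auto simp: med_def\<close>)
    then show ?thesis using med_le by linarith
  qed
  then have "K' \<noteq> {}" using cK by auto
  have K'X: "K' \<subseteq> X" using K by (auto simp: K'_def)
  obtain tau where tau: "tau \<in> heavy_type lab X (N j) ` K'"
    "card K' \<le> F * card {x \<in> K'. heavy_type lab X (N j) x = tau}"
    using popular_fiber[of K' "heavy_type lab X (N j)" F] \<open>K' \<noteq> {}\<close> finK card_types[OF K'X]
    unfolding F_def K'_def by blast
  define Kt where "Kt = {x \<in> K'. heavy_type lab X (N j) x = tau}"
  have KtX: "Kt \<subseteq> X" and KtK: "Kt \<subseteq> K" using K'X by (auto simp: Kt_def K'_def)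
  have finKt: "finite Kt" using KtK finK finite_subset by blast
  have Xle: "card X \<le> 2 * \<kappa> * F * card Kt"
  proof -
    have "card X \<le> \<kappa> * card K" by (rule XK)
    also have "\<dots> \<le> \<kappa> * (2 * card K')" using K'2 by (rule mult_le_mono2)
    also have "\<dots> \<le> \<kappa> * (2 * (F * card Kt))" using tau(2) unfolding Kt_def by (intro mult_le_mono2)
    finally show ?thesis by (simp add: mult_ac)
  qed
  then have cKt: "card Kt > 0" using cX by (cases "card Kt") auto
  then obtain v where v: "v \<in> Kt" by (metis card.empty ex_in_conv less_irrefl)
  have light: "weight lab X w * N (Suc j) \<le> card X"
    if "x \<in> Kt" "w \<in> fst ` lab x" "w \<notin> heavy lab X (N j)" for x w
  proof -
    have "x \<in> X" "x \<notin> med j" using that(1) KtX by (auto simp: Kt_def K'_def)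
    then have "w \<notin> heavy lab X (N (Suc j))" using that unfolding med_def by blast
    then show ?thesis by (simp add: heavy_def)
  qed
  have ty: "heavy_type lab X (N j) x = tau" if "x \<in> Kt" for x using that by (simp add: Kt_def)
  obtain s where s: "s \<in> ss" "dif adj X s v * Q \<le> card X" using net[of v] v KtX by blast
  define T where "T = near adj X s q"
  have KtT: "x \<in> T" if x: "x \<in> Kt" for x
  proof -
    have "dif adj X v x * N (Suc j) \<le> 2 * c * card X"
    proof (rule dif_same_type[of v x "N j"])
      show "weight lab X w * N (Suc j) \<le> card X"
        if "w \<in> fst ` lab v \<union> fst ` lab x" "w \<notin> heavy lab X (N j)" for w
        using light[of v w] light[of x w] v x that by blast
    qed (use v x KtX ty in auto)
    moreover have "dif adj X s v * N (Suc j) \<le> card X"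
      using s(2) NQ by (meson mult_le_mono2 order_trans)
    moreover have "dif adj X s x * N (Suc j) \<le> dif adj X s v * N (Suc j) + dif adj X v x * N (Suc j)"
      using dif_triangle[OF X(2), of adj s x v] by (metis add_mult_distrib mult_le_mono1)
    \<comment> \<open>The factor \<open>2 * c + 1\<close> in \<open>scale\<close> is used up here:
      \<open>2 * c\<close> for equal types and 1 for the way from the center to
      \<open>v\<close>.\<close>
    ultimately have "dif adj X s x * N (Suc j) \<le> (2 * c + 1) * card X" by (simp add: algebra_simps)
    then have "(2 * c + 1) * (dif adj X s x * q) \<le> (2 * c + 1) * card X" unfolding N' by (simp only: mult_ac)
    then have "dif adj X s x * q \<le> card X" by (simp only: mult_le_cancel1)
    then show ?thesis using x KtX by (auto simp: T_def near_def)
  qed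
  have KtU: "adj x y" if x: "x \<in> Kt" and y: "y \<in> T" for x y
  proof (rule ccontr)
    assume nadj: "\<not> adj x y"
    have yX: "y \<in> X" using y by (auto simp: T_def near_def)
    \<comment> \<open>The vertex \<open>y\<close> may have hubs inside the gap, but shares none of
      these with \<open>Kt\<close>; only its light hubs have to be collected.\<close>
    define L where "L = {w \<in> fst ` lab y. weight lab X w * N (Suc j) \<le> card X}"
    define B where "B = (\<Union>w\<in>L. {z \<in> X. w \<in> fst ` lab z})"
    \<comment> \<open>The clique vertex \<open>v\<close> sees all of \<open>Kt\<close>. A vertex of
      \<open>Kt\<close> that \<open>y\<close> does not see therefore separates \<open>v\<close> from
      \<open>s\<close> or \<open>s\<close> from \<open>y\<close>.\<close>
    have "Kt \<subseteq> {z \<in> X. adj s z \<noteq> adj v z} \<union> {z \<in> X. adj s z \<noteq> adj y z} \<union> B"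
    proof
      fix z assume z: "z \<in> Kt"
      have zX: "z \<in> X" using z KtX by blast
      have vz: "adj v z" using K(2) v z KtK by blast
      show "z \<in> {z \<in> X. adj s z \<noteq> adj v z} \<union> {z \<in> X. adj s z \<noteq> adj y z} \<union> B"
      proof (cases "adj y z")
        case False
        then show ?thesis using vz zX by blast
      next
        case True
        then obtain w i k where w: "(w, i) \<in> lab y" "(w, k) \<in> lab z" "i + k \<le> d"
          using adj_iff XV yX zX by blast
        have hubs: "w \<in> fst ` lab y" "w \<in> fst ` lab z" using w by force+
        have "w \<notin> heavy lab X (N j)"
        proof
          assume "w \<in> heavy lab X (N j)"
          then have "(w, k) \<in> heavy_type lab X (N j) z" using w by (simp add: heavy_type_def)
          then have "(w, k) \<in> heavy_type lab X (N j) x" using ty x z by simp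
          then have "(w, k) \<in> lab x" by (simp add: heavy_type_def)
          then have "adj x y" using w adj_iff[of x y] XV x KtX yX by (metis add.commute subsetD)
          then show False using nadj by blast
        qed
        then have "w \<in> L" using light[OF z hubs(2)] hubs(1) by (simp add: L_def)
        then show ?thesis using hubs(2) zX unfolding B_def by blast
      qed
    qed
    then have "card Kt \<le> card ({z \<in> X. adj s z \<noteq> adj v z} \<union> {z \<in> X. adj s z \<noteq> adj y z} \<union> B)"
      using X(2) by (intro card_mono) (auto simp: B_def intro: finite_subset[of _ X])
    also have "\<dots> \<le> card ({z \<in> X. adj s z \<noteq> adj v z} \<union> {z \<in> X. adj s z \<noteq> adj y z}) + card B"
      by (rule card_Un_le)
    also have "\<dots> \<le> dif adj X s v + dif adj X s y + card B"
      unfolding dif_def by (intro add_right_mono card_Un_le)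
    finally have le: "card Kt * q \<le> dif adj X s v * q + dif adj X s y * q + card B * q"
      by (metis add_mult_distrib mult_le_mono1)
    have 1: "dif adj X s v * q \<le> card X" using s(2) qQ by (meson mult_le_mono2 order_trans)
    have 2: "dif adj X s y * q \<le> card X" using y by (simp add: T_def near_def)
    have "card B * N (Suc j) \<le> c * card X" unfolding B_def
      by (rule card_light[OF XV[OF yX]]) (auto simp: L_def)
    also have "\<dots> \<le> (2 * c + 1) * card X" by simp
    finally have "(2 * c + 1) * (card B * q) \<le> (2 * c + 1) * card X" unfolding N' by (simp only: mult_ac)
    then have 3: "card B * q \<le> card X" by (simp only: mult_le_cancel1)
    have "card Kt * q \<le> 3 * card X" using le 1 2 3 by linarith
    also have "\<dots> \<le> 3 * (2 * \<kappa> * F * card Kt)" by (rule mult_le_mono2[OF Xle])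
    also have "\<dots> < card Kt * q" using cKt by (simp add: q_def algebra_simps)
    finally show False by simp
  qed
  have "Kt \<subseteq> universal adj T" unfolding universal_def using KtT KtU by blast
  moreover have "finite (universal adj T)" using X(2) by (auto simp: universal_def T_def near_def)
  ultimately have "card Kt \<le> card (universal adj T)" by (simp add: card_mono)
  moreover have "F \<le> type_bound c d Q" unfolding F_def type_bound_def
    using mono[of j "Suc j"] NQ by (intro power_increasing mult_le_mono) auto
  ultimately have "2 * \<kappa> * F * card Kt \<le> 2 * \<kappa> * type_bound c d Q * card (universal adj T)"
    by (intro mult_le_mono) auto
  then have "card X \<le> 2 * \<kappa> * type_bound c d Q * card (universal adj T)" using Xle by linarith
  moreover have "q \<in> {1..Q}" using qQ by (simp add: q_def)
  ultimately show ?thesis using s(1) unfolding T_def by blast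
qed

end

section \<open>Reasoning about programs\<close>

text \<open>Total correctness: a terminating run exists, and the postcondition also speaks about its
  exact time.\<close>

definition wp :: "nat \<Rightarrow> com \<Rightarrow> (nat \<Rightarrow> state \<Rightarrow> bool) \<Rightarrow> state \<Rightarrow> bool" where
  "wp W c P s \<longleftrightarrow> (\<exists>t s'. exec W c s t s' \<and> P t s')"

lemma wp_mono: "wp W c P s \<Longrightarrow> (\<And>t s'. P t s' \<Longrightarrow> P' t s') \<Longrightarrow> wp W c P' s"
  unfolding wp_def by blast

lemma exec_iff:
  "exec W Skip s t s' \<longleftrightarrow> t = 1 \<and> s' = s"
  "exec W (Assign i e) s t s' \<longleftrightarrow>
    fits W e s \<and> t = cost e + 1 \<and> s' = s\<lparr>var := (var s)(i := eval e s)\<rparr>"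
  "exec W (Store a e) s t s' \<longleftrightarrow> fits W a s \<and> fits W e s \<and> t = cost a + cost e + 1 \<and>
    s' = s\<lparr>mem := (mem s)(eval a s := eval e s)\<rparr>"
  "exec W (Seq c1 c2) s t s' \<longleftrightarrow> (\<exists>t1 t2 s1. exec W c1 s t1 s1 \<and> exec W c2 s1 t2 s' \<and> t = t1 + t2)"
  "exec W (com.If e c1 c2) s t s' \<longleftrightarrow> fits W e s \<and>
    (\<exists>t1. exec W (if eval e s \<noteq> 0 then c1 else c2) s t1 s' \<and> t = cost e + 1 + t1)"
  by ((rule iffI, erule SkipE, simp, simp add: exec.Skip[simplified]),
      (rule iffI, erule AssignE, simp, metis exec.Assign),
      (rule iffI, erule StoreE, simp, metis exec.Store),
      (rule iffI, erule SeqE, blast, metis exec.Seq),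
      (rule iffI, erule IfE, simp, simp, cases "eval e s = 0", (metis exec.IfFalse exec.IfTrue)+))

lemma wp_Skip: "wp W Skip P s \<longleftrightarrow> P 1 s"
  by (simp add: wp_def exec_iff)

lemma wp_Assign: "wp W (Assign i e) P s \<longleftrightarrow> fits W e s \<and> P (cost e + 1) (s\<lparr>var := (var s)(i := eval e s)\<rparr>)"
  by (simp add: wp_def exec_iff)

lemma wp_Store: "wp W (Store a e) P s \<longleftrightarrow> fits W a s \<and> fits W e s \<and>
    P (cost a + cost e + 1) (s\<lparr>mem := (mem s)(eval a s := eval e s)\<rparr>)"
  by (simp add: wp_def exec_iff)

lemma wp_Seq: "wp W (Seq c1 c2) P s \<longleftrightarrow> wp W c1 (\<lambda>t1. wp W c2 (\<lambda>t2. P (t1 + t2))) s"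
  unfolding wp_def exec_iff by blast

lemma wp_If: "wp W (If e c1 c2) P s \<longleftrightarrow> fits W e s \<and>
    (if eval e s \<noteq> 0 then wp W c1 (\<lambda>t. P (cost e + 1 + t)) s else wp W c2 (\<lambda>t. P (cost e + 1 + t)) s)"
  by (auto simp: wp_def exec_iff)

lemmas wp_simps = wp_Skip wp_Assign wp_Store wp_Seq wp_If

text \<open>\<open>B\<close> bounds the remaining time.\<close>
lemma wp_While:
  assumes "I s"
    and fits: "\<And>s. I s \<Longrightarrow> fits W e s"
    and exit: "\<And>s. I s \<Longrightarrow> eval e s = 0 \<Longrightarrow> cost e + 1 \<le> B s"
    and body: "\<And>s. I s \<Longrightarrow> eval e s \<noteq> 0 \<Longrightarrow> wp W c (\<lambda>t s'. I s' \<and> cost e + 1 + t + B s' \<le> B s) s"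
  shows "wp W (While e c) (\<lambda>t s'. t \<le> B s \<and> I s' \<and> eval e s' = 0) s"
  using assms(1)
proof (induction "B s" arbitrary: s rule: less_induct)
  case less
  show ?case
  proof (cases "eval e s = 0")
    case True
    then show ?thesis unfolding wp_def using less.prems exec.WhileFalse[of W e s c] fits exit by blast
  next
    case False
    then obtain t s' where 1: "exec W c s t s'" "I s'" "cost e + 1 + t + B s' \<le> B s"
      using body[OF less.prems] unfolding wp_def by blast
    then have "B s' < B s" by simp
    from less.hyps[OF this 1(2)] obtain t' s'' where 2: "exec W (While e c) s' t' s''"
      "t' \<le> B s'" "I s''" "eval e s'' = 0" unfolding wp_def by blast
    have "exec W (While e c) s (cost e + 1 + t + t') s''"
      by (rule exec.WhileTrue[OF fits[OF less.prems] False 1(1) 2(1)])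
    moreover have "cost e + 1 + t + t' \<le> B s" using 1 2 by simp
    ultimately show ?thesis unfolding wp_def using 2 by blast
  qed
qed

text \<open>Truncated subtraction is nonzero exactly while the counter is below the bound. The bound
  register is read again at each test, so the body has to preserve it.\<close>

definition For :: "nat \<Rightarrow> nat \<Rightarrow> com \<Rightarrow> com" where
  "For i n c = Seq (Assign i (Const 0))
     (While (Minus (Var n) (Var i)) (Seq c (Assign i (Plus (Var i) (Const 1)))))"

text \<open>Each \<open>+ 8\<close> pays for one test and one increment, the final 8 for the
  initialization and the last test. The invariant holds at the test, so the body establishes it for
  the state after the increment. Individual times \<open>\<tau> j\<close> serve loops whose rounds
  differ in length.\<close>

lemma wp_For_sum:
  assumes W: "N \<le> W" "1 \<le> W"
    and init: "I 0 (s\<lparr>var := (var s)(i := 0)\<rparr>)"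
    and inv: "\<And>j s. I j s \<Longrightarrow> var s i = j \<and> var s n = N"
    and body: "\<And>j s. j < N \<Longrightarrow> I j s \<Longrightarrow>
      wp W c (\<lambda>t s'. t \<le> \<tau> j \<and> var s' i = j \<and> I (Suc j) (s'\<lparr>var := (var s')(i := Suc j)\<rparr>)) s"
  shows "wp W (For i n c) (\<lambda>t s'. t \<le> (\<Sum>j<N. \<tau> j + 8) + 8 \<and> I N s') s"
proof -
  let ?e = "Minus (Var n) (Var i)" and ?c = "Seq c (Assign i (Plus (Var i) (Const 1)))"
  let ?J = "\<lambda>s. \<exists>j\<le>N. I j s"
  define B where "B s = (\<Sum>j=var s i..<N. \<tau> j + 8) + 4" for s :: state
  have "wp W (While ?e ?c) (\<lambda>t s'. t \<le> B (s\<lparr>var := (var s)(i := 0)\<rparr>) \<and> ?J s' \<and> eval ?e s' = 0)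
      (s\<lparr>var := (var s)(i := 0)\<rparr>)"
  proof (rule wp_While)
    show "?J (s\<lparr>var := (var s)(i := 0)\<rparr>)" using init by blast
    show "fits W ?e s" if "?J s" for s using that inv W by fastforce
    show "cost ?e + 1 \<le> B s" for s by (simp add: B_def)
    fix s assume J: "?J s" and e: "eval ?e s \<noteq> 0"
    then obtain j where j: "I j s" "j < N" using inv by fastforce
    have "wp W c (\<lambda>t s'. t \<le> \<tau> j \<and> var s' i = j \<and> I (Suc j) (s'\<lparr>var := (var s')(i := Suc j)\<rparr>)) s"
      by (rule body[OF j(2,1)])
    then show "wp W ?c (\<lambda>t s'. ?J s' \<and> cost ?e + 1 + t + B s' \<le> B s) s"
      unfolding wp_Seq
    proof (rule wp_mono)
      fix t s' assume *: "t \<le> \<tau> j \<and> var s' i = j \<and> I (Suc j) (s'\<lparr>var := (var s')(i := Suc j)\<rparr>)"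
      have "var s i = j" using inv[OF j(1)] by simp
      then have B: "B s = (\<Sum>j=Suc j..<N. \<tau> j + 8) + (\<tau> j + 8) + 4"
        using j(2) unfolding B_def by (simp add: sum.atLeast_Suc_lessThan)
      have "\<exists>j'\<le>N. I j' (s'\<lparr>var := (var s')(i := Suc j)\<rparr>)" using * j(2) by (intro exI[of _ "Suc j"]) simp
      then show "wp W (Assign i (Plus (Var i) (Const 1)))
          (\<lambda>t2 s'. ?J s' \<and> cost ?e + 1 + (t + t2) + B s' \<le> B s) s'"
        using * j(2) W by (simp add: wp_Assign B) (simp add: B_def)
    qed
  qed
  then show ?thesis unfolding For_def wp_Seq wp_Assign
  proof (simp, elim wp_mono, goal_cases)
    case (1 t s')
    then obtain j where j: "j \<le> N" "I j s'" by blast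
    with inv[of j s'] 1 have "j = N" by simp
    then show ?case using 1 j by (simp add: B_def lessThan_atLeast0)
  qed
qed

lemma wp_For:
  assumes "N \<le> W" "1 \<le> W" "I 0 (s\<lparr>var := (var s)(i := 0)\<rparr>)"
    and "\<And>j s. I j s \<Longrightarrow> var s i = j \<and> var s n = N"
    and "\<And>j s. j < N \<Longrightarrow> I j s \<Longrightarrow>
      wp W c (\<lambda>t s'. t \<le> \<tau> \<and> var s' i = j \<and> I (Suc j) (s'\<lparr>var := (var s')(i := Suc j)\<rparr>)) s"
  shows "wp W (For i n c) (\<lambda>t s'. t \<le> (N + 1) * (\<tau> + 8) \<and> I N s') s"
proof (rule wp_mono[OF wp_For_sum[where I = I and \<tau> = "\<lambda>_. \<tau>", OF assms]])
  fix t s' assume *: "t \<le> (\<Sum>j<N. \<tau> + 8) + 8 \<and> I N s'"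
  have "(\<Sum>j<N. \<tau> + 8) = N * (\<tau> + 8)" by (simp only: sum_constant card_lessThan of_nat_id)
  then have "(\<Sum>j<N. \<tau> + 8) + 8 \<le> (N + 1) * (\<tau> + 8)" by (simp only: distrib_right) simp
  then show "t \<le> (N + 1) * (\<tau> + 8) \<and> I N s'" using * order_trans by blast
qed

text \<open>The frame condition for registers, with \<open>A\<close> the registers that a program
  may write; memory is framed separately by address ranges.\<close>

definition same :: "nat set \<Rightarrow> state \<Rightarrow> state \<Rightarrow> bool" where
  "same A s s0 \<longleftrightarrow> (\<forall>i. i \<notin> A \<longrightarrow> var s i = var s0 i)"

lemma sameD: "same A s s0 \<Longrightarrow> i \<notin> A \<Longrightarrow> var s i = var s0 i"
  by (simp add: same_def)

lemma same_upd: "i \<in> A \<Longrightarrow> same A (s\<lparr>var := (var s)(i := v)\<rparr>) s0 \<longleftrightarrow> same A s s0"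
  by (auto simp: same_def)

lemma same_mem: "same A (s\<lparr>mem := m\<rparr>) s0 \<longleftrightarrow> same A s s0"
  by (simp add: same_def)

lemma same_refl: "same A s s"
  by (simp add: same_def)

lemma same_trans: "same A s s1 \<Longrightarrow> same B s1 s0 \<Longrightarrow> A \<subseteq> C \<Longrightarrow> B \<subseteq> C \<Longrightarrow> same C s s0"
  unfolding same_def by (metis subsetD)

lemmas same_simps = same_upd same_mem same_refl

section \<open>The program\<close>

text \<open>
  Registers: 0 and 1 hold the size and the address of the best clique, 2 the number \<open>n\<close> of vertices, 3 to 8
  the addresses \<open>Z, ..., 6 * Z\<close> of the adjacency matrix, the remaining degrees, the current set \<open>X\<close>, its
  cover flags, the distances to the current center and the candidate cliques; 9 holds \<open>card X\<close>, 10 the peeled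
  vertex, 11 the center, 12 and 13 loop indices, 14 a distance, 15 the universality flag, 16 the scale
  (25 its predecessor), 17 the candidate size, 18 the round, 19 the minimum degree, 20 whether to continue,
  22 a degree, 23 and 24 the numbers of rounds and scales.
\<close>
definition adjE :: "expr \<Rightarrow> expr \<Rightarrow> expr" where
  "adjE ex ey = Mem (Plus (Plus (Var 3) (Times ex (Var 2))) ey)"

definition arrE :: "nat \<Rightarrow> expr \<Rightarrow> expr" where
  "arrE r e = Mem (Plus (Var r) e)"

text \<open>Subtraction is truncated, so the value is nonzero iff \<open>a \<le> b\<close>.\<close>
definition leE :: "expr \<Rightarrow> expr \<Rightarrow> expr" where
  "leE a b = Minus (Plus b (Const 1)) a"

lemma costs [simp]: "cost (adjE a b) = cost a + cost b + 6" "cost (arrE r e) = cost e + 3"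
  "cost (leE a b) = cost a + cost b + 3"
  by (simp_all add: adjE_def arrE_def leE_def)

definition incr :: "nat \<Rightarrow> com" where
  "incr i = Assign i (Plus (Var i) (Const 1))"

section \<open>Memory layout and the comparison of two neighborhoods\<close>

definition dif_prog :: com where
  "dif_prog = Seq (Assign 14 (Const 0)) (For 13 9
    (If (adjE (arrE 5 (Var 11)) (arrE 5 (Var 13)))
      (If (adjE (arrE 5 (Var 12)) (arrE 5 (Var 13))) Skip (incr 14))
      (If (adjE (arrE 5 (Var 12)) (arrE 5 (Var 13))) (incr 14) Skip)))"

text \<open>A block of \<open>Z\<close> cells has room for the matrix, for an array, or for the
  whole input, which has at most \<open>n * n + n + 3\<close> cells. All addresses in use lie below
  \<open>8 * Z\<close>, and \<open>Q * (n + 1)\<close> bounds the products of differences and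
  scales.\<close>

locale ram =
  fixes W n Z Q R :: nat and adj :: "nat \<Rightarrow> nat \<Rightarrow> bool"
  assumes n: "n \<ge> 1" and Z: "Z = n * n + n + 3"
    and W: "8 * Z \<le> W" "Q * (n + 1) \<le> W" "R \<le> W" "Q \<le> W"
begin

definition base :: "state \<Rightarrow> bool" where
  "base s \<longleftrightarrow> var s 2 = n \<and> var s 3 = Z \<and> var s 4 = 2 * Z \<and> var s 5 = 3 * Z \<and> var s 6 = 4 * Z \<and>
     var s 7 = 5 * Z \<and> var s 8 = 6 * Z \<and> var s 23 = R \<and> var s 24 = Q \<and>
     (\<forall>x<n. \<forall>y<n. mem s (Z + x * n + y) = of_bool (adj x y))"

lemma cell: "x < n \<Longrightarrow> y < n \<Longrightarrow> x * n + y < n * n"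
  by (metis add_less_cancel_left less_le_trans mult_Suc add.commute Suc_leI mult_le_mono1)

lemma nZ: "n < Z" "n * n < Z"
  using Z by auto

lemma baseD: assumes "base s"
  shows "var s 2 = n" "var s 3 = Z" "var s 4 = 2 * Z" "var s 5 = 3 * Z" "var s 6 = 4 * Z"
    "var s 7 = 5 * Z" "var s 8 = 6 * Z" "var s 23 = R" "var s 24 = Q"
  using assms by (auto simp: base_def)

lemma base_frame:
  assumes "base s" "same A s' s" "A \<inter> {2,3,4,5,6,7,8,23,24} = {}" "\<And>a. Z \<le> a \<Longrightarrow> a < 2 * Z \<Longrightarrow> mem s' a = mem s a"
  shows "base s'"
proof -
  have "mem s' (Z + x * n + y) = mem s (Z + x * n + y)" if "x < n" "y < n" for x y
    using cell[OF that] nZ by (intro assms(4)) auto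
  moreover have "var s' i = var s i" if "i \<in> {2,3,4,5,6,7,8,23,24}" for i
    using assms(2,3) that by (intro sameD) auto
  ultimately show ?thesis using assms(1) unfolding base_def by simp
qed

lemma adjE:
  assumes "base s" "fits W ex s" "fits W ey s" "eval ex s < n" "eval ey s < n"
  shows "fits W (adjE ex ey) s" "eval (adjE ex ey) s = of_bool (adj (eval ex s) (eval ey s))"
proof -
  have c: "eval ex s * n + eval ey s < n * n" by (rule cell[OF assms(4,5)])
  then have "Z + eval ex s * n + eval ey s \<le> W" "eval ex s * n \<le> W" "n \<le> W" "1 \<le> W" using nZ W by auto
  moreover have "mem s (Z + eval ex s * n + eval ey s) = of_bool (adj (eval ex s) (eval ey s))"
    using assms unfolding base_def by blast
  ultimately show "fits W (adjE ex ey) s" "eval (adjE ex ey) s = of_bool (adj (eval ex s) (eval ey s))"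
    using baseD[OF assms(1)] assms(2,3) by (auto simp: adjE_def of_bool_def)
qed

text \<open>Further arrays are indexed by positions in \<open>xs\<close> and not by vertices, so
  that all work on \<open>X\<close> has a cost depending on its size only.\<close>

definition list_at :: "nat list \<Rightarrow> state \<Rightarrow> bool" where
  "list_at xs s \<longleftrightarrow> var s 9 = length xs \<and> xs \<noteq> [] \<and> length xs \<le> n \<and> set xs \<subseteq> {..<n} \<and>
     (\<forall>i<length xs. mem s (3 * Z + i) = xs ! i)"

lemma list_at_frame:
  assumes "list_at xs s" "same A s' s" "9 \<notin> A" "\<And>a. 3 * Z \<le> a \<Longrightarrow> a < 4 * Z \<Longrightarrow> mem s' a = mem s a"
  shows "list_at xs s'"
proof -
  have "mem s' (3 * Z + i) = mem s (3 * Z + i)" if "i < length xs" for i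
    using that assms(1) nZ by (intro assms(4)) (auto simp: list_at_def)
  then show ?thesis using assms(1) sameD[OF assms(2,3)] unfolding list_at_def by simp
qed

lemma at_list:
  assumes "base s" "list_at xs s" "var s i < length xs"
  shows "fits W (arrE 5 (Var i)) s" "eval (arrE 5 (Var i)) s = xs ! var s i" "xs ! var s i < n"
proof -
  show "xs ! var s i < n" using assms(2,3) by (auto simp: list_at_def subset_iff)
  then show "fits W (arrE 5 (Var i)) s" "eval (arrE 5 (Var i)) s = xs ! var s i"
    using assms baseD[OF assms(1)] nZ W by (auto simp: arrE_def list_at_def)
qed

abbreviation ladj :: "nat list \<Rightarrow> nat \<Rightarrow> nat \<Rightarrow> bool" where
  "ladj xs i j \<equiv> adj (xs ! i) (xs ! j)"

lemma adj_list:
  assumes "base s" "list_at xs s" "var s i < length xs" "var s j < length xs"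
  shows "fits W (adjE (arrE 5 (Var i)) (arrE 5 (Var j))) s"
    "eval (adjE (arrE 5 (Var i)) (arrE 5 (Var j))) s = of_bool (ladj xs (var s i) (var s j))"
  using adjE[OF assms(1), of "arrE 5 (Var i)" "arrE 5 (Var j)"] at_list[OF assms(1,2,3)] at_list[OF assms(1,2,4)]
  by simp_all

lemma dif_prog:
  assumes s: "base s" "list_at xs s" "var s 11 < length xs" "var s 12 < length xs"
  shows "wp W dif_prog (\<lambda>t s'. t \<le> 50 * (length xs + 1) \<and> same {13,14} s' s \<and> mem s' = mem s \<and>
    var s' 14 = dif (ladj xs) {..<length xs} (var s 11) (var s 12)) s"
proof -
  define k where "k = length xs"
  define f where "f j = card {z. z < j \<and> ladj xs (var s 11) z \<noteq> ladj xs (var s 12) z}" for j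
  define I where "I j s' \<longleftrightarrow> j \<le> k \<and> same {13,14} s' s \<and> mem s' = mem s \<and> var s' 13 = j \<and> var s' 14 = f j" for j s'
  have kn: "k \<le> n" "n \<le> W" using s(2) nZ W by (auto simp: list_at_def k_def)
  have step: "f (Suc j) = f j + of_bool (ladj xs (var s 11) j \<noteq> ladj xs (var s 12) j)" for j
  proof -
    have "{z. z < Suc j \<and> ladj xs (var s 11) z \<noteq> ladj xs (var s 12) z} =
      {z. z < j \<and> ladj xs (var s 11) z \<noteq> ladj xs (var s 12) z} \<union>
      (if ladj xs (var s 11) j \<noteq> ladj xs (var s 12) j then {j} else {})" by (auto simp: less_Suc_eq)
    then show ?thesis by (simp add: card_insert_if f_def)
  qed
  have fk: "f j \<le> j" for j
    using card_mono[of "{..<j}" "{z. z < j \<and> ladj xs (var s 11) z \<noteq> ladj xs (var s 12) z}"] by (auto simp: f_def)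
  have body: "wp W (If (adjE (arrE 5 (Var 11)) (arrE 5 (Var 13)))
      (If (adjE (arrE 5 (Var 12)) (arrE 5 (Var 13))) Skip (incr 14))
      (If (adjE (arrE 5 (Var 12)) (arrE 5 (Var 13))) (incr 14) Skip))
      (\<lambda>t s'. t \<le> 40 \<and> var s' 13 = j \<and> I (Suc j) (s'\<lparr>var := (var s')(13 := Suc j)\<rparr>)) s'"
    if j: "j < k" and I: "I j s'" for j s'
  proof -
    have sm: "same {13,14} s' s" and m: "mem s' = mem s" and v: "var s' 13 = j" "var s' 14 = f j"
      using I by (auto simp: I_def)
    have b: "base s'" by (rule base_frame[OF s(1) sm]) (use m in auto)
    have l: "list_at xs s'" by (rule list_at_frame[OF s(2) sm]) (use m in auto)
    have v': "var s' 11 = var s 11" "var s' 12 = var s 12" by (rule sameD[OF sm], simp)+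
    note a1 = adj_list[OF b l, of 11 13] and a2 = adj_list[OF b l, of 12 13]
    show ?thesis
      using a1 a2 s(3,4) j v v' fk[of j] kn
      by (auto simp: wp_simps incr_def I_def same_simps sm m step k_def)
  qed
  define s1 where "s1 = s\<lparr>var := (var s)(14 := eval (Const 0) s)\<rparr>"
  have loop: "wp W (For 13 9 (If (adjE (arrE 5 (Var 11)) (arrE 5 (Var 13)))
      (If (adjE (arrE 5 (Var 12)) (arrE 5 (Var 13))) Skip (incr 14))
      (If (adjE (arrE 5 (Var 12)) (arrE 5 (Var 13))) (incr 14) Skip)))
      (\<lambda>t s'. t \<le> (k + 1) * (40 + 8) \<and> I k s') s1"
  proof (rule wp_For)
    show "k \<le> W" "1 \<le> W" using kn n by auto
    show "I 0 (s1\<lparr>var := (var s1)(13 := 0)\<rparr>)" by (simp add: s1_def I_def same_def f_def)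
    show "var s' 13 = j \<and> var s' 9 = k" if "I j s'" for j s'
      using that s(2) sameD[of "{13,14}" s' s 9] by (simp add: I_def list_at_def k_def)
  qed (rule body)
  show ?thesis unfolding dif_prog_def wp_Seq wp_Assign s1_def[symmetric]
    by (rule conjI, simp, rule wp_mono[OF loop]) (simp add: I_def k_def dif_def f_def)
qed

end

section \<open>Candidate cliques around one center\<close>

definition univ_prog :: com where
  "univ_prog = Seq (Assign 15 (Const 1)) (For 13 9
    (If (leE (Times (arrE 7 (Var 13)) (Var 16)) (Var 9))
      (If (adjE (arrE 5 (Var 12)) (arrE 5 (Var 13))) Skip (Assign 15 (Const 0))) Skip))"

text \<open>The candidate is written in the block indexed by the best size so far, which the best clique itself never occupies.\<close>
definition cand_prog :: com where
  "cand_prog = Seq (Assign 17 (Const 0)) (For 12 9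
    (If (leE (Times (arrE 7 (Var 12)) (Var 16)) (Var 9))
      (Seq univ_prog (If (Var 15)
        (Seq (Store (Plus (Plus (Var 8) (Times (Var 0) (Var 2))) (Var 17)) (arrE 5 (Var 12))) (incr 17))
        Skip)) Skip))"

definition best_prog :: com where
  "best_prog = Seq cand_prog (If (Minus (Var 17) (Var 0))
    (Seq (Assign 1 (Plus (Var 8) (Times (Var 0) (Var 2)))) (Assign 0 (Var 17))) Skip)"

definition scale_prog :: com where
  "scale_prog = For 25 24 (Seq (Assign 16 (Plus (Var 25) (Const 1))) best_prog)"

context ram
begin

definition dist_at :: "nat \<Rightarrow> (nat \<Rightarrow> nat) \<Rightarrow> state \<Rightarrow> bool" where
  "dist_at k ds s \<longleftrightarrow> (\<forall>i<k. mem s (5 * Z + i) = ds i \<and> ds i \<le> n)"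

lemma dist_at_frame:
  assumes "dist_at k ds s" "k \<le> n" "\<And>a. 5 * Z \<le> a \<Longrightarrow> a < 6 * Z \<Longrightarrow> mem s' a = mem s a"
  shows "dist_at k ds s'"
proof -
  have "mem s' (5 * Z + i) = mem s (5 * Z + i)" if "i < k" for i
    using that assms(2) nZ by (intro assms(3)) auto
  then show ?thesis using assms(1) unfolding dist_at_def by simp
qed

lemma near_cond:
  assumes s: "base s" "list_at xs s" "dist_at (length xs) ds s" and x: "var s x < length xs"
    and q: "var s 16 = q" "q \<le> Q"
  shows "fits W (leE (Times (arrE 7 (Var x)) (Var 16)) (Var 9)) s"
    "eval (leE (Times (arrE 7 (Var x)) (Var 16)) (Var 9)) s \<noteq> 0 \<longleftrightarrow> ds (var s x) * q \<le> length xs"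
proof -
  have k: "var s 9 = length xs" "length xs \<le> n" using s(2) by (auto simp: list_at_def)
  have d: "mem s (5 * Z + var s x) = ds (var s x)" "ds (var s x) \<le> n" using s(3) x by (auto simp: dist_at_def)
  have "ds (var s x) * q \<le> n * Q" using d(2) q(2) by (rule mult_le_mono)
  also have "\<dots> \<le> W" using W(2) by (simp add: algebra_simps)
  finally have "ds (var s x) * q \<le> W" .
  then show "fits W (leE (Times (arrE 7 (Var x)) (Var 16)) (Var 9)) s"
    using k d q W nZ x baseD[OF s(1)] n by (simp add: leE_def arrE_def)
  show "eval (leE (Times (arrE 7 (Var x)) (Var 16)) (Var 9)) s \<noteq> 0 \<longleftrightarrow> ds (var s x) * q \<le> length xs"
    using k d q baseD[OF s(1)] by (auto simp: leE_def arrE_def)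
qed

lemma univ_prog:
  assumes s: "base s" "list_at xs s" "dist_at (length xs) ds s" "var s 12 < length xs"
    and q: "var s 16 = q" "q \<le> Q"
  shows "wp W univ_prog (\<lambda>t s'. t \<le> 60 * (length xs + 1) \<and> same {13,15} s' s \<and> mem s' = mem s \<and>
    var s' 15 = of_bool (\<forall>y<length xs. ds y * q \<le> length xs \<longrightarrow> ladj xs (var s 12) y)) s"
proof -
  define k where "k = length xs"
  define f :: "nat \<Rightarrow> nat" where "f j = of_bool (\<forall>y<j. ds y * q \<le> k \<longrightarrow> ladj xs (var s 12) y)" for j
  define I where "I j s' \<longleftrightarrow> j \<le> k \<and> same {13,15} s' s \<and> mem s' = mem s \<and> var s' 13 = j \<and> var s' 15 = f j" for j s'
  have kn: "k \<le> n" "n \<le> W" using s(2) nZ W by (auto simp: list_at_def k_def)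
  have step: "f (Suc j) = (if ds j * q \<le> k \<and> \<not> ladj xs (var s 12) j then 0 else f j)" for j
    by (auto simp: f_def less_Suc_eq)
  define body where "body = If (leE (Times (arrE 7 (Var 13)) (Var 16)) (Var 9))
      (If (adjE (arrE 5 (Var 12)) (arrE 5 (Var 13))) Skip (Assign 15 (Const 0))) Skip"
  have body: "wp W body (\<lambda>t s'. t \<le> 40 \<and> var s' 13 = j \<and> I (Suc j) (s'\<lparr>var := (var s')(13 := Suc j)\<rparr>)) s'"
    if j: "j < k" and I: "I j s'" for j s'
  proof -
    have sm: "same {13,15} s' s" and m: "mem s' = mem s" and v: "var s' 13 = j" "var s' 15 = f j"
      using I by (auto simp: I_def)
    have b: "base s'" by (rule base_frame[OF s(1) sm]) (use m in auto)
    have l: "list_at xs s'" by (rule list_at_frame[OF s(2) sm]) (use m in auto)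
    have d: "dist_at (length xs) ds s'" using s(3) by (simp add: dist_at_def m)
    have v': "var s' 12 = var s 12" "var s' 16 = var s 16" by (rule sameD[OF sm], simp)+
    have len: "var s' 13 < length xs" "var s' 12 < length xs" "var s' 16 = q"
      using v v' j s(4) q by (auto simp: k_def)
    note a = adj_list[OF b l len(2,1)] and c = near_cond[OF b l d len(1,3) q(2)]
    show ?thesis unfolding body_def
      using a c v v' j
      by (auto simp: wp_simps I_def same_simps sm m step k_def)
  qed
  define s1 where "s1 = s\<lparr>var := (var s)(15 := eval (Const 1) s)\<rparr>"
  have loop: "wp W (For 13 9 body) (\<lambda>t s'. t \<le> (k + 1) * (40 + 8) \<and> I k s') s1"
  proof (rule wp_For)
    show "k \<le> W" "1 \<le> W" using kn n by auto
    show "I 0 (s1\<lparr>var := (var s1)(13 := 0)\<rparr>)" by (simp add: s1_def I_def same_def f_def)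
    show "var s' 13 = j \<and> var s' 9 = k" if "I j s'" for j s'
      using that s(2) sameD[of "{13,15}" s' s 9] by (simp add: I_def list_at_def k_def)
  qed (rule body)
  have "1 \<le> W" using kn n by simp
  then show ?thesis unfolding univ_prog_def body_def[symmetric] wp_Seq wp_Assign s1_def[symmetric]
    by (intro conjI, simp) (rule wp_mono[OF loop], simp add: I_def k_def f_def)
qed

text \<open>The entries are positions in \<open>xs\<close>; the parameter \<open>j\<close> cuts the
  search off after \<open>j\<close> positions and is the counter of the loop invariant.\<close>

definition cand_list :: "nat list \<Rightarrow> (nat \<Rightarrow> nat) \<Rightarrow> nat \<Rightarrow> nat \<Rightarrow> nat list" where
  "cand_list xs ds q j = filter (\<lambda>x. ds x * q \<le> length xs \<and>
     (\<forall>y<length xs. ds y * q \<le> length xs \<longrightarrow> ladj xs x y)) [0..<j]"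

lemma length_cand_list: "length (cand_list xs ds q j) \<le> j"
  using length_filter_le[of _ "[0..<j]"] unfolding cand_list_def by simp

text \<open>Only \<open>n\<close> cells from \<open>A\<close> on are written, which keeps everything
  stored before \<open>A\<close> intact. The time is quadratic, with one linear universality test
  for each near position.\<close>

lemma cand_prog:
  assumes s: "base s" "list_at xs s" "dist_at (length xs) ds s" and q: "var s 16 = q" "q \<le> Q"
    and best: "var s 0 \<le> n"
  defines "A \<equiv> 6 * Z + var s 0 * n"
  shows "wp W cand_prog (\<lambda>t s'. t \<le> 110 * ((length xs + 1) * (length xs + 1)) \<and> same {12,13,15,17} s' s \<and>
    (\<forall>a. a < A \<or> A + n \<le> a \<longrightarrow> mem s' a = mem s a) \<and>
    var s' 17 = length (cand_list xs ds q (length xs)) \<and>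
    (\<forall>i<length (cand_list xs ds q (length xs)). mem s' (A + i) = xs ! (cand_list xs ds q (length xs) ! i))) s"
proof -
  define k where "k = length xs"
  define f where "f j = cand_list xs ds q j" for j
  define I where "I j s' \<longleftrightarrow> j \<le> k \<and> same {12,13,15,17} s' s \<and>
    (\<forall>a. a < A \<or> A + n \<le> a \<longrightarrow> mem s' a = mem s a) \<and> var s' 12 = j \<and> var s' 17 = length (f j) \<and>
    (\<forall>i<length (f j). mem s' (A + i) = xs ! (f j ! i))" for j s'
  have kn: "k \<le> n" "n \<le> W" using s(2) nZ W by (auto simp: list_at_def k_def)
  \<comment> \<open>As the best size is at most \<open>n\<close>, the candidate ends at
    \<open>6 * Z + n * n + n\<close> at the latest, below \<open>7 * Z\<close>.\<close>
  have AZ: "6 * Z \<le> A" "A + n \<le> 7 * Z"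
  proof -
    have "var s 0 * n \<le> n * n" using best by (rule mult_le_mono1)
    then show "A + n \<le> 7 * Z" unfolding A_def using Z by linarith
  qed (simp add: A_def)
  have step: "f (Suc j) = (if ds j * q \<le> k \<and> (\<forall>y<k. ds y * q \<le> k \<longrightarrow> ladj xs j y) then f j @ [j] else f j)" for j
    by (simp add: f_def cand_list_def k_def)
  have len_f: "length (f j) \<le> j" for j unfolding f_def by (rule length_cand_list)
  define store where "store = Seq (Store (Plus (Plus (Var 8) (Times (Var 0) (Var 2))) (Var 17)) (arrE 5 (Var 12))) (incr 17)"
  define body where "body = If (leE (Times (arrE 7 (Var 12)) (Var 16)) (Var 9))
      (Seq univ_prog (If (Var 15) store Skip)) Skip"
  define t0 where "t0 = 60 * (k + 1) + 40"
  have body: "wp W body (\<lambda>t s'. t \<le> t0 \<and> var s' 12 = j \<and> I (Suc j) (s'\<lparr>var := (var s')(12 := Suc j)\<rparr>)) s'"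
    if j: "j < k" and I: "I j s'" for j s'
  proof -
    have sm: "same {12,13,15,17} s' s" and m: "\<And>a. a < A \<or> A + n \<le> a \<Longrightarrow> mem s' a = mem s a"
      and v: "var s' 12 = j" "var s' 17 = length (f j)"
      and out: "\<And>i. i < length (f j) \<Longrightarrow> mem s' (A + i) = xs ! (f j ! i)"
      using I by (auto simp: I_def)
    have b: "base s'" by (rule base_frame[OF s(1) sm]) (use m AZ in auto)
    have l: "list_at xs s'" by (rule list_at_frame[OF s(2) sm]) (use m AZ in auto)
    have d: "dist_at (length xs) ds s'"
      by (rule dist_at_frame[OF s(3)]) (use m AZ kn in \<open>auto simp: k_def\<close>)
    have v': "var s' 16 = var s 16" "var s' 0 = var s 0" by (rule sameD[OF sm], simp)+
    have len: "var s' 12 < length xs" "var s' 16 = q" using v v' j q by (auto simp: k_def)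
    note c = near_cond[OF b l d len(1,2) q(2)]
    show ?thesis
    proof (cases "ds j * q \<le> k")
      case False
      then have e: "eval (leE (Times (arrE 7 (Var 12)) (Var 16)) (Var 9)) s' = 0" using c(2) v by (simp add: k_def)
      have "f (Suc j) = f j" using False by (simp add: step)
      then show ?thesis unfolding body_def using c(1) e j v m out
        by (simp add: wp_If wp_Skip I_def same_simps sm t0_def k_def)
    next
      case True
      then have e: "eval (leE (Times (arrE 7 (Var 12)) (Var 16)) (Var 9)) s' \<noteq> 0" using c(2) v by (simp add: k_def)
      define u where "u \<longleftrightarrow> (\<forall>y<k. ds y * q \<le> k \<longrightarrow> ladj xs j y)"
      have fs: "f (Suc j) = (if u then f j @ [j] else f j)" using True by (simp add: step u_def)
      have U: "wp W univ_prog (\<lambda>t s''. t \<le> 60 * (k + 1) \<and> same {13,15} s'' s' \<and> mem s'' = mem s' \<and>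
          var s'' 15 = of_bool u) s'"
        using univ_prog[OF b l d len(1,2) q(2)] unfolding u_def k_def v .
      have "wp W (Seq univ_prog (If (Var 15) store Skip))
         (\<lambda>t s'. t \<le> 60 * (k + 1) + 24 \<and> var s' 12 = j \<and> I (Suc j) (s'\<lparr>var := (var s')(12 := Suc j)\<rparr>)) s'"
        unfolding wp_Seq
      proof (rule wp_mono[OF U])
        fix t s'' assume *: "t \<le> 60 * (k + 1) \<and> same {13,15} s'' s' \<and> mem s'' = mem s' \<and> var s'' 15 = of_bool u"
        then have sm2: "same {13,15} s'' s'" and m2: "mem s'' = mem s'" by auto
        have v2: "var s'' 12 = j" "var s'' 17 = length (f j)" "var s'' 0 = var s 0"
          using sameD[OF sm2] v v' by simp_all
        have b2: "base s''" by (rule base_frame[OF b sm2]) (use m2 in auto)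
        have l2: "list_at xs s''" by (rule list_at_frame[OF l sm2]) (use m2 in auto)
        have sm3: "same {12,13,15,17} s'' s" using same_trans[OF sm2 sm] by auto
        have len2: "var s'' 12 < length xs" using v2 j by (simp add: k_def)
        note al = at_list[OF b2 l2 len2]
        have W1: "1 \<le> W" using kn n by simp
        have A2: "6 * Z + var s 0 * n + length (f j) \<le> W" "6 * Z + var s 0 * n \<le> W" "6 * Z \<le> W" "var s 0 * n \<le> W"
          "var s 0 \<le> W" "Suc (length (f j)) \<le> W"
          using AZ len_f[of j] j kn W best unfolding A_def by simp_all
        have store: "wp W store (\<lambda>t s'. t \<le> 22 \<and> var s' 12 = j \<and>
            I (Suc j) (s'\<lparr>var := (var s')(12 := Suc j)\<rparr>)) s''" if u: "u"
        proof -
          let ?m = "(mem s'')(A + length (f j) := xs ! j)"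
          have 1: "?m a = mem s a" if "a < A \<or> A + n \<le> a" for a
            using that m m2 len_f[of j] j kn by auto
          have 3: "mem s'' a = mem s a" if "a < A" for a using m that by (simp add: m2)
          have 2: "?m (A + i) = xs ! ((f j @ [j]) ! i)" if "i < Suc (length (f j))" for i
            using that out m2 by (auto simp: nth_append less_Suc_eq)
          show ?thesis unfolding store_def incr_def
            using al A2 v2 baseD[OF b2] 1 2 3 j kn u W1 sm3
            by (simp add: wp_simps I_def same_def fs A_def)
        qed
        show "wp W (If (Var 15) store Skip) (\<lambda>t2 s'. t + t2 \<le> 60 * (k + 1) + 24 \<and> var s' 12 = j \<and>
            I (Suc j) (s'\<lparr>var := (var s')(12 := Suc j)\<rparr>)) s''"
        proof (cases u)
          case True
          show ?thesis unfolding wp_If using * True W1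
            by (simp, intro wp_mono[OF store[OF True]]) simp
        next
          case False
          show ?thesis unfolding wp_If wp_Skip using * False W1 v2 m m2 out j
            by (simp add: I_def same_simps sm3 fs)
        qed
      qed
      then show ?thesis unfolding body_def wp_If using c(1) e
        by (simp del: eval.simps fits.simps, elim wp_mono) (simp add: t0_def)
    qed
  qed
  define s1 where "s1 = s\<lparr>var := (var s)(17 := eval (Const 0) s)\<rparr>"
  have loop: "wp W (For 12 9 body) (\<lambda>t s'. t \<le> (k + 1) * (t0 + 8) \<and> I k s') s1"
  proof (rule wp_For)
    show "k \<le> W" "1 \<le> W" using kn n by auto
    show "I 0 (s1\<lparr>var := (var s1)(12 := 0)\<rparr>)" by (simp add: s1_def I_def same_def f_def cand_list_def)
    show "var s' 12 = j \<and> var s' 9 = k" if "I j s'" for j s'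
      using that s(2) sameD[of "{12,13,15,17}" s' s 9] by (simp add: I_def list_at_def k_def)
  qed (rule body)
  have t: "2 + t \<le> 110 * ((k + 1) * (k + 1))" if "t \<le> (k + 1) * (t0 + 8)" for t
  proof -
    have "(k + 1) * (t0 + 8) \<le> (k + 1) * (108 * (k + 1))" by (intro mult_le_mono2) (simp add: t0_def)
    moreover have "2 + 108 * ((k + 1) * (k + 1)) \<le> 110 * ((k + 1) * (k + 1))" by simp
    ultimately show ?thesis using that by (simp only: mult.left_commute)
  qed
  show ?thesis
    unfolding cand_prog_def store_def[symmetric] body_def[symmetric] wp_Seq wp_Assign s1_def[symmetric]
  proof (intro conjI)
    show "fits W (Const 0) s" by simp
    show "wp W (For 12 9 body) (\<lambda>t2 s'. cost (Const 0) + 1 + t2 \<le> 110 * ((length xs + 1) * (length xs + 1)) \<and>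
      same {12,13,15,17} s' s \<and> (\<forall>a. a < A \<or> A + n \<le> a \<longrightarrow> mem s' a = mem s a) \<and>
      var s' 17 = length (cand_list xs ds q (length xs)) \<and>
      (\<forall>i<length (cand_list xs ds q (length xs)). mem s' (A + i) = xs ! (cand_list xs ds q (length xs) ! i))) s1"
    proof (rule wp_mono[OF loop])
      fix t s' assume *: "t \<le> (k + 1) * (t0 + 8) \<and> I k s'"
      then have "2 + t \<le> 110 * ((k + 1) * (k + 1))" using t by blast
      then show "cost (Const 0) + 1 + t \<le> 110 * ((length xs + 1) * (length xs + 1)) \<and>
        same {12,13,15,17} s' s \<and> (\<forall>a. a < A \<or> A + n \<le> a \<longrightarrow> mem s' a = mem s a) \<and>
        var s' 17 = length (cand_list xs ds q (length xs)) \<and>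
        (\<forall>i<length (cand_list xs ds q (length xs)). mem s' (A + i) = xs ! (cand_list xs ds q (length xs) ! i))"
        using * by (simp add: I_def f_def k_def)
    qed
  qed
qed

end

section \<open>The greedy net of centers\<close>

definition uncovered_prog :: com where
  "uncovered_prog = Seq (Assign 11 (Const 0)) (For 12 9 (If (arrE 6 (Var 12)) Skip (Assign 11 (Var 12))))"

definition cover_prog :: com where
  "cover_prog = For 12 9 (Seq dif_prog (Seq (Store (Plus (Var 7) (Var 12)) (Var 14))
    (If (leE (Times (Var 14) (Var 24)) (Var 9)) (Store (Plus (Var 6) (Var 12)) (Const 1)) Skip)))"

definition round_prog :: com where
  "round_prog = Seq uncovered_prog (Seq cover_prog scale_prog)"

definition net_prog :: com where
  "net_prog = Seq (For 12 9 (Store (Plus (Var 6) (Var 12)) (Const 0))) (For 18 23 round_prog)"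

lemma dif_sym: "dif adj X x y = dif adj X y x"
  unfolding dif_def by (rule arg_cong[of _ _ card]) auto

lemma dif_le: "dif adj {..<k} x y \<le> k"
  using card_mono[of "{..<k}" "{z \<in> {..<k}. adj x z \<noteq> adj y z}"] by (auto simp: dif_def)

context ram
begin

text \<open>By the last conjunct the stored clique ends before block number \<open>var s 0\<close>,
  where the next candidate is written.\<close>

definition out_ok :: "state \<Rightarrow> bool" where
  "out_ok s \<longleftrightarrow> (\<exists>zs. length zs = var s 0 \<and> zs \<noteq> [] \<and> distinct zs \<and> set zs \<subseteq> {..<n} \<and>
     (\<forall>x\<in>set zs. \<forall>y\<in>set zs. adj x y) \<and> (\<forall>i<length zs. mem s (var s 1 + i) = zs ! i) \<and>
     6 * Z \<le> var s 1 \<and> var s 1 + var s 0 \<le> 6 * Z + var s 0 * n)"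

lemma out_ok_le: "out_ok s \<Longrightarrow> 1 \<le> var s 0 \<and> var s 0 \<le> n"
proof -
  assume "out_ok s"
  then obtain zs where zs: "length zs = var s 0" "zs \<noteq> []" "distinct zs" "set zs \<subseteq> {..<n}"
    unfolding out_ok_def by blast
  have "card (set zs) \<le> card {..<n}" using zs by (intro card_mono) auto
  then show ?thesis using zs distinct_card[of zs] by (cases zs) auto
qed

lemma out_ok_frame:
  assumes "out_ok s" "same A s' s" "0 \<notin> A" "1 \<notin> A"
    "\<And>a. 6 * Z \<le> a \<Longrightarrow> a < 6 * Z + var s 0 * n \<Longrightarrow> mem s' a = mem s a"
  shows "out_ok s'"
proof -
  obtain zs where zs: "length zs = var s 0" "zs \<noteq> []" "distinct zs" "set zs \<subseteq> {..<n}"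
     "\<forall>x\<in>set zs. \<forall>y\<in>set zs. adj x y" "\<forall>i<length zs. mem s (var s 1 + i) = zs ! i"
     "6 * Z \<le> var s 1" "var s 1 + var s 0 \<le> 6 * Z + var s 0 * n"
    using assms(1) unfolding out_ok_def by blast
  have v: "var s' 0 = var s 0" "var s' 1 = var s 1" using sameD[OF assms(2)] assms(3,4) by auto
  have "mem s' (var s 1 + i) = zs ! i" if "i < length zs" for i
    using zs(1,6,7,8) that assms(5)[of "var s 1 + i"] by simp
  then show ?thesis unfolding out_ok_def v using zs by (intro exI[of _ zs]) simp
qed

lemma cand_list_clique:
  assumes "x \<in> set (cand_list xs ds q (length xs))" "y \<in> set (cand_list xs ds q (length xs))"
  shows "ladj xs x y"
  using assms by (auto simp: cand_list_def)

lemma best_prog: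
  assumes s: "base s" "list_at xs s" "dist_at (length xs) ds s" and q: "var s 16 = q" "q \<le> Q"
    and out: "out_ok s" and xs: "distinct xs"
  shows "wp W best_prog (\<lambda>t s'. t \<le> 130 * ((length xs + 1) * (length xs + 1)) \<and> same {0,1,12,13,15,17} s' s \<and>
    (\<forall>a. a < 6 * Z \<longrightarrow> mem s' a = mem s a) \<and> out_ok s' \<and> var s 0 \<le> var s' 0 \<and>
    length (cand_list xs ds q (length xs)) \<le> var s' 0) s"
proof -
  define A where "A = 6 * Z + var s 0 * n"
  define ys where "ys = cand_list xs ds q (length xs)"
  define post where "post t s' \<longleftrightarrow> t \<le> 130 * ((length xs + 1) * (length xs + 1)) \<and> same {0,1,12,13,15,17} s' s \<and>
    (\<forall>a. a < 6 * Z \<longrightarrow> mem s' a = mem s a) \<and> out_ok s' \<and> var s 0 \<le> var s' 0 \<and> length ys \<le> var s' 0" for t s'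
  have best: "var s 0 \<le> n" using out_ok_le[OF out] by simp
  have kn: "length xs \<le> n" "n \<le> W" using s(2) nZ W by (auto simp: list_at_def)
  have sq: "length xs + 1 \<le> (length xs + 1) * (length xs + 1)" by simp
  have ysn: "length ys \<le> n" using length_cand_list[of xs ds q "length xs"] kn by (simp add: ys_def)
  have AZ: "A + n \<le> 7 * Z"
  proof -
    have "var s 0 * n \<le> n * n" using best by (rule mult_le_mono1)
    then show "A + n \<le> 7 * Z" unfolding A_def using Z by linarith
  qed
  note C = cand_prog[OF s q best, folded A_def ys_def]
  have "wp W best_prog post s" unfolding best_prog_def wp_Seq
  proof (rule wp_mono[OF C])
    fix t s' assume *: "t \<le> 110 * ((length xs + 1) * (length xs + 1)) \<and> same {12,13,15,17} s' s \<and>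
      (\<forall>a. a < A \<or> A + n \<le> a \<longrightarrow> mem s' a = mem s a) \<and> var s' 17 = length ys \<and>
      (\<forall>i<length ys. mem s' (A + i) = xs ! (ys ! i))"
    then have sm: "same {12,13,15,17} s' s" and m: "\<And>a. a < A \<Longrightarrow> mem s' a = mem s a"
      and v17: "var s' 17 = length ys" and mem: "\<And>i. i < length ys \<Longrightarrow> mem s' (A + i) = xs ! (ys ! i)" by auto
    have v: "var s' 0 = var s 0" "var s' 8 = var s 8" "var s' 2 = var s 2" using sameD[OF sm] by simp_all
    have t: "t + 20 \<le> 130 * ((length xs + 1) * (length xs + 1))" using * sq by linarith
    have sm': "same {0,1,12,13,15,17} s' s" by (rule same_trans[OF sm same_refl]) auto
    have low: "mem s' a = mem s a" if "a < 6 * Z" for a using m that by (simp add: A_def)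
    have b: "var s' 8 = 6 * Z" "var s' 2 = n" using baseD[OF s(1)] v by auto
    have out': "out_ok s'" by (rule out_ok_frame[OF out sm]) (use m in \<open>auto simp: A_def\<close>)
    show "wp W (If (Minus (Var 17) (Var 0)) (Seq (Assign 1 (Plus (Var 8) (Times (Var 0) (Var 2)))) (Assign 0 (Var 17))) Skip)
      (\<lambda>t2. post (t + t2)) s'"
    proof (cases "var s 0 < length ys")
      case False
      then show ?thesis using v v17 t sm' low out' best ysn kn
        by (simp add: wp_simps post_def)
    next
      case True
      define s2 where "s2 = s'\<lparr>var := (var s')(1 := A, 0 := length ys)\<rparr>"
      have sub: "set ys \<subseteq> {..<length xs}" by (auto simp: ys_def cand_list_def)
      have dys: "distinct ys" by (simp add: ys_def cand_list_def)
      have "out_ok s2" unfolding out_ok_def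
      proof (intro exI[of _ "map ((!) xs) ys"] conjI)
        have "inj_on ((!) xs) (set ys)" by (rule inj_on_nth[OF xs]) (use sub in auto)
        then show "distinct (map ((!) xs) ys)" using dys by (simp add: distinct_map)
        have "set (map ((!) xs) ys) \<subseteq> set xs" using sub by auto
        then show "set (map ((!) xs) ys) \<subseteq> {..<n}" using s(2) unfolding list_at_def by blast
        show "\<forall>x\<in>set (map ((!) xs) ys). \<forall>y\<in>set (map ((!) xs) ys). adj x y"
          using cand_list_clique[of _ xs ds q] by (auto simp: ys_def)
        show "map ((!) xs) ys \<noteq> []" using True by auto
        \<comment> \<open>The candidate was written to block \<open>var s 0\<close> and is longer
          than that number, so it ends before block \<open>length ys\<close>. It can thus be adopted
          in place, without copying.\<close>
        have "var s 0 * n + n \<le> length ys * n" using True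
          by (metis Suc_leI add.commute mult_Suc mult_le_mono1)
        then show "var s2 1 + var s2 0 \<le> 6 * Z + var s2 0 * n" using ysn by (simp add: s2_def A_def)
      qed (use mem in \<open>auto simp: s2_def A_def\<close>)
      moreover have "same {0,1,12,13,15,17} s2 s" using sm' by (auto simp: same_def s2_def)
      moreover have "A \<le> W" "n \<le> W" "6 * Z \<le> W" "var s 0 * n \<le> W" using AZ W kn by (auto simp: A_def)
      ultimately have "post (t + 15) s2" and fitsA: "A \<le> W" "6 * Z \<le> W" "var s 0 * n \<le> W"
        unfolding post_def using t low True by (auto simp: s2_def)
      then show ?thesis using v v17 b True kn best ysn t
        by (simp add: wp_simps s2_def A_def post_def)
    qed
  qed
  then show ?thesis unfolding post_def ys_def .
qed

lemma length_cand_list_dif: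
  "length (cand_list xs (dif (ladj xs) {..<length xs} a) q (length xs)) =
    card (universal (ladj xs) (near (ladj xs) {..<length xs} a q))"
proof -
  have "set (cand_list xs (dif (ladj xs) {..<length xs} a) q (length xs)) =
    universal (ladj xs) (near (ladj xs) {..<length xs} a q)"
    by (auto simp: cand_list_def universal_def near_def)
  moreover have "distinct (cand_list xs (dif (ladj xs) {..<length xs} a) q (length xs))"
    by (simp add: cand_list_def)
  ultimately show ?thesis by (metis distinct_card)
qed

definition found :: "nat list \<Rightarrow> nat \<Rightarrow> nat \<Rightarrow> bool" where
  "found xs a best \<longleftrightarrow> (\<forall>q\<in>{1..Q}. card (universal (ladj xs) (near (ladj xs) {..<length xs} a q)) \<le> best)"

lemma scale_prog:
  assumes s: "base s" "list_at xs s" "dist_at (length xs) (dif (ladj xs) {..<length xs} a) s"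
    and out: "out_ok s" and xs: "distinct xs"
  shows "wp W scale_prog (\<lambda>t s'. t \<le> (Q + 1) * (150 * ((length xs + 1) * (length xs + 1))) \<and>
    same {0,1,12,13,15,16,17,25} s' s \<and> (\<forall>a. a < 6 * Z \<longrightarrow> mem s' a = mem s a) \<and> out_ok s' \<and>
    var s 0 \<le> var s' 0 \<and> found xs a (var s' 0)) s"
proof -
  let ?ds = "dif (ladj xs) {..<length xs} a"
  define K where "K = (length xs + 1) * (length xs + 1)"
  have K: "1 \<le> K" by (simp add: K_def)
  define I where "I j s' \<longleftrightarrow> j \<le> Q \<and> same {0,1,12,13,15,16,17,25} s' s \<and> (\<forall>a. a < 6 * Z \<longrightarrow> mem s' a = mem s a) \<and>
    out_ok s' \<and> var s 0 \<le> var s' 0 \<and> var s' 25 = j \<and>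
    (\<forall>q\<in>{1..j}. length (cand_list xs ?ds q (length xs)) \<le> var s' 0)" for j s'
  have kn: "length xs \<le> n" using s(2) by (auto simp: list_at_def)
  have W1: "1 \<le> W" using n nZ W by auto
  have body: "wp W (Seq (Assign 16 (Plus (Var 25) (Const 1))) best_prog)
      (\<lambda>t s'. t \<le> 134 * K \<and> var s' 25 = j \<and> I (Suc j) (s'\<lparr>var := (var s')(25 := Suc j)\<rparr>)) s'"
    if j: "j < Q" and I: "I j s'" for j s'
  proof -
    define s1 where "s1 = s'\<lparr>var := (var s')(16 := Suc j)\<rparr>"
    have sm: "same {0,1,12,13,15,16,17,25} s1 s" and m: "\<And>a. a < 6 * Z \<Longrightarrow> mem s1 a = mem s a"
      and v: "var s1 25 = j" "var s' 25 = j" "var s 0 \<le> var s1 0" "var s1 16 = Suc j"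
      and prev: "\<And>q. q \<in> {1..j} \<Longrightarrow> length (cand_list xs ?ds q (length xs)) \<le> var s1 0"
      using I by (auto simp: I_def s1_def same_def)
    have b: "base s1" by (rule base_frame[OF s(1) sm]) (use m in auto)
    have l: "list_at xs s1" by (rule list_at_frame[OF s(2) sm]) (use m in auto)
    have d: "dist_at (length xs) ?ds s1" by (rule dist_at_frame[OF s(3) kn]) (use m in auto)
    have o: "out_ok s'" using I by (simp add: I_def)
    have o1: "out_ok s1" by (rule out_ok_frame[OF o, of "{16}"]) (auto simp: s1_def same_def)
    have "wp W best_prog (\<lambda>t s2. t + 4 \<le> 134 * K \<and> var s2 25 = j \<and>
        I (Suc j) (s2\<lparr>var := (var s2)(25 := Suc j)\<rparr>)) s1"
    proof (rule wp_mono[OF best_prog[OF b l d v(4) _ o1 xs]])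
      show "Suc j \<le> Q" using j by simp
      fix t s2 assume *: "t \<le> 130 * ((length xs + 1) * (length xs + 1)) \<and> same {0,1,12,13,15,17} s2 s1 \<and>
        (\<forall>a. a < 6 * Z \<longrightarrow> mem s2 a = mem s1 a) \<and> out_ok s2 \<and> var s1 0 \<le> var s2 0 \<and>
        length (cand_list xs ?ds (Suc j) (length xs)) \<le> var s2 0"
      then have sm2: "same {0,1,12,13,15,17} s2 s1" by simp
      have sm3: "same {0,1,12,13,15,16,17,25} s2 s" by (rule same_trans[OF sm2 sm]) auto
      define s3 where "s3 = s2\<lparr>var := (var s2)(25 := Suc j)\<rparr>"
      have "out_ok s3" by (rule out_ok_frame[of s2 "{25}"]) (use * in \<open>auto simp: s3_def same_def\<close>)
      moreover have "length (cand_list xs ?ds q (length xs)) \<le> var s2 0" if "q \<in> {1..Suc j}" for q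
      proof (cases "q = Suc j")
        case False
        then have "q \<in> {1..j}" using that by auto
        then show ?thesis using prev[of q] * by linarith
      qed (use * in simp)
      moreover have "same {0,1,12,13,15,16,17,25} s3 s" using sm3 by (auto simp: same_def s3_def)
      moreover have "var s2 25 = j" using sameD[OF sm2] v by simp
      moreover have "mem s3 a = mem s a" if "a < 6 * Z" for a using * m that by (simp add: s3_def)
      moreover have "var s 0 \<le> var s3 0" using * v by (simp add: s3_def)
      ultimately show "t + 4 \<le> 134 * K \<and> var s2 25 = j \<and> I (Suc j) (s2\<lparr>var := (var s2)(25 := Suc j)\<rparr>)"
        unfolding s3_def[symmetric] I_def using * K j by (auto simp: K_def s3_def)
    qed
    note best = this
    have e: "s'\<lparr>var := (var s')(16 := eval (Plus (Var 25) (Const 1)) s')\<rparr> = s1" by (simp add: s1_def v)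
    show ?thesis unfolding wp_Seq wp_Assign e
    proof (intro conjI)
      show "fits W (Plus (Var 25) (Const 1)) s'" using v j W W1 by simp
    qed (rule wp_mono[OF best], simp)
  qed
  have "wp W scale_prog (\<lambda>t s'. t \<le> (Q + 1) * (134 * K + 8) \<and> I Q s') s" unfolding scale_prog_def
  proof (rule wp_For)
    show "Q \<le> W" "1 \<le> W" using W W1 by auto
    show "I 0 (s\<lparr>var := (var s)(25 := 0)\<rparr>)"
    proof -
      have "out_ok (s\<lparr>var := (var s)(25 := 0)\<rparr>)"
        by (rule out_ok_frame[OF out, of "{25}"]) (auto simp: same_def)
      then show ?thesis by (simp add: I_def same_def)
    qed
    show "var s' 25 = j \<and> var s' 24 = Q" if "I j s'" for j s'
    proof -
      have "same {0,1,12,13,15,16,17,25} s' s" "var s' 25 = j" using that by (simp_all add: I_def)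
      then show ?thesis using sameD[of "{0,1,12,13,15,16,17,25}" s' s 24] baseD[OF s(1)] by simp
    qed
  qed (rule body)
  then show ?thesis
  proof (rule wp_mono)
    fix t s' assume *: "t \<le> (Q + 1) * (134 * K + 8) \<and> I Q s'"
    have "(Q + 1) * (134 * K + 8) \<le> (Q + 1) * (150 * K)" using K by (intro mult_le_mono2) simp
    then have "t \<le> (Q + 1) * (150 * K)" using * by linarith
    then show "t \<le> (Q + 1) * (150 * ((length xs + 1) * (length xs + 1))) \<and>
      same {0,1,12,13,15,16,17,25} s' s \<and> (\<forall>a. a < 6 * Z \<longrightarrow> mem s' a = mem s a) \<and> out_ok s' \<and>
      var s 0 \<le> var s' 0 \<and> found xs a (var s' 0)"
      using * by (simp add: I_def found_def length_cand_list_dif K_def)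
  qed
qed

definition flags_at :: "nat \<Rightarrow> (nat \<Rightarrow> nat) \<Rightarrow> state \<Rightarrow> bool" where
  "flags_at k cs s \<longleftrightarrow> (\<forall>i<k. mem s (4 * Z + i) = cs i \<and> cs i \<le> 1)"

lemma flags_at_frame:
  assumes "flags_at k cs s" "k \<le> n" "\<And>a. 4 * Z \<le> a \<Longrightarrow> a < 5 * Z \<Longrightarrow> mem s' a = mem s a"
  shows "flags_at k cs s'"
proof -
  have "mem s' (4 * Z + i) = mem s (4 * Z + i)" if "i < k" for i
    using that assms(2) nZ by (intro assms(3)) auto
  then show ?thesis using assms(1) unfolding flags_at_def by simp
qed

text \<open>Position 0 is the default when everything is covered. A round then still has a valid
  center, which permits a number of rounds fixed in advance.\<close>

lemma uncovered_prog:
  assumes s: "base s" "list_at xs s" "flags_at (length xs) cs s"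
  shows "wp W uncovered_prog (\<lambda>t s'. t \<le> 20 * (length xs + 1) \<and> same {11,12} s' s \<and> mem s' = mem s \<and>
    var s' 11 < length xs \<and> ((\<exists>i<length xs. cs i = 0) \<longrightarrow> cs (var s' 11) = 0)) s"
proof -
  define k where "k = length xs"
  have kn: "k \<le> n" "n \<le> W" "1 \<le> k" using s(2) nZ W by (auto simp: list_at_def k_def Suc_le_eq)
  define I where "I j s' \<longleftrightarrow> j \<le> k \<and> same {11,12} s' s \<and> mem s' = mem s \<and> var s' 12 = j \<and> var s' 11 < k \<and>
    ((\<exists>i<j. cs i = 0) \<longrightarrow> cs (var s' 11) = 0)" for j s'
  have body: "wp W (If (arrE 6 (Var 12)) Skip (Assign 11 (Var 12)))
      (\<lambda>t s'. t \<le> 8 \<and> var s' 12 = j \<and> I (Suc j) (s'\<lparr>var := (var s')(12 := Suc j)\<rparr>)) s'"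
    if j: "j < k" and I: "I j s'" for j s'
  proof -
    have sm: "same {11,12} s' s" and m: "mem s' = mem s" and v: "var s' 12 = j" "var s' 11 < k"
      and c: "(\<exists>i<j. cs i = 0) \<longrightarrow> cs (var s' 11) = 0" using I by (auto simp: I_def)
    have v6: "var s' 6 = 4 * Z" using sameD[OF sm] baseD[OF s(1)] by simp
    have cj: "mem s (4 * Z + j) = cs j" "cs j \<le> 1" using s(3) j by (auto simp: flags_at_def k_def)
    show ?thesis
    proof (cases "cs j = 0")
      case True
      then show ?thesis using sm m v v6 cj j kn nZ W
        by (simp add: wp_simps arrE_def I_def same_def)
    next
      case False
      have "(\<exists>i<Suc j. cs i = 0) \<longrightarrow> cs (var s' 11) = 0" using c False by (auto simp: less_Suc_eq)
      then show ?thesis using sm m v v6 cj j kn nZ W False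
        by (simp add: wp_simps arrE_def I_def same_def)
    qed
  qed
  define s1 where "s1 = s\<lparr>var := (var s)(11 := eval (Const 0) s)\<rparr>"
  have loop: "wp W (For 12 9 (If (arrE 6 (Var 12)) Skip (Assign 11 (Var 12))))
      (\<lambda>t s'. t \<le> (k + 1) * (8 + 8) \<and> I k s') s1"
  proof (rule wp_For)
    show "k \<le> W" "1 \<le> W" using kn by auto
    show "I 0 (s1\<lparr>var := (var s1)(12 := 0)\<rparr>)" using kn by (simp add: s1_def I_def same_def)
    show "var s' 12 = j \<and> var s' 9 = k" if "I j s'" for j s'
      using that s(2) sameD[of "{11,12}" s' s 9] by (simp add: I_def list_at_def k_def)
  qed (rule body)
  show ?thesis unfolding uncovered_prog_def wp_Seq wp_Assign s1_def[symmetric]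
    by (rule conjI, simp, rule wp_mono[OF loop]) (auto simp: I_def k_def)
qed

text \<open>Coverage is decided at the finest scale \<open>Q\<close>, where
  \<open>large_universal_set\<close> needs its net, whereas the stored distances serve all
  scales.\<close>

lemma cover_prog:
  assumes s: "base s" "list_at xs s" "flags_at (length xs) cs s" "var s 11 = a" "a < length xs"
  shows "wp W cover_prog (\<lambda>t s'. t \<le> 100 * ((length xs + 1) * (length xs + 1)) \<and> same {12,13,14} s' s \<and>
    (\<forall>a. a < 4 * Z \<or> 6 * Z \<le> a \<longrightarrow> mem s' a = mem s a) \<and>
    dist_at (length xs) (dif (ladj xs) {..<length xs} a) s' \<and>
    flags_at (length xs)
      (\<lambda>i. if dif (ladj xs) {..<length xs} a i * Q \<le> length xs then 1 else cs i) s') s"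
proof -
  define k where "k = length xs"
  let ?D = "dif (ladj xs) {..<length xs} a"
  define cs' where "cs' i = (if ?D i * Q \<le> length xs then 1 else cs i)" for i
  have kn: "k \<le> n" "n \<le> W" "1 \<le> k" using s(2) nZ W by (auto simp: list_at_def k_def Suc_le_eq)
  define I where "I j s' \<longleftrightarrow> j \<le> k \<and> same {12,13,14} s' s \<and> (\<forall>a. a < 4 * Z \<or> 6 * Z \<le> a \<longrightarrow> mem s' a = mem s a) \<and>
    var s' 12 = j \<and> (\<forall>i<j. mem s' (5 * Z + i) = ?D i) \<and>
    (\<forall>i<k. mem s' (4 * Z + i) = (if i < j then cs' i else cs i))" for j s'
  define rest where "rest = Seq (Store (Plus (Var 7) (Var 12)) (Var 14))
    (If (leE (Times (Var 14) (Var 24)) (Var 9)) (Store (Plus (Var 6) (Var 12)) (Const 1)) Skip)"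
  define t0 where "t0 = 50 * (k + 1) + 30"
  have cs1: "cs i \<le> 1" if "i < k" for i using s(3) that by (simp add: flags_at_def k_def)
  have body: "wp W (Seq dif_prog rest)
      (\<lambda>t s'. t \<le> t0 \<and> var s' 12 = j \<and> I (Suc j) (s'\<lparr>var := (var s')(12 := Suc j)\<rparr>)) s'"
    if j: "j < k" and I: "I j s'" for j s'
  proof -
    have sm: "same {12,13,14} s' s" and m: "\<And>a. a < 4 * Z \<or> 6 * Z \<le> a \<Longrightarrow> mem s' a = mem s a" and v: "var s' 12 = j"
      and D: "\<And>i. i < j \<Longrightarrow> mem s' (5 * Z + i) = ?D i"
      and F: "\<And>i. i < k \<Longrightarrow> mem s' (4 * Z + i) = (if i < j then cs' i else cs i)" using I by (auto simp: I_def)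
    have b: "base s'" by (rule base_frame[OF s(1) sm]) (use m in auto)
    have l: "list_at xs s'" by (rule list_at_frame[OF s(2) sm]) (use m in auto)
    have v11: "var s' 11 = a" using sameD[OF sm] s(4) by simp
    have len: "var s' 11 < length xs" "var s' 12 < length xs" using v v11 j s(5) by (auto simp: k_def)
    show ?thesis unfolding wp_Seq
    proof (rule wp_mono[OF dif_prog[OF b l len]])
      fix t s2 assume *: "t \<le> 50 * (length xs + 1) \<and> same {13,14} s2 s' \<and> mem s2 = mem s' \<and>
        var s2 14 = dif (ladj xs) {..<length xs} (var s' 11) (var s' 12)"
      then have sm2: "same {13,14} s2 s'" and m2: "mem s2 = mem s'" and v14: "var s2 14 = ?D j"
        and t: "t \<le> 50 * (k + 1)"
        using v v11 by (auto simp: k_def)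
      have sm3: "same {12,13,14} s2 s" by (rule same_trans[OF sm2 sm]) auto
      have v2: "var s2 12 = j" "var s2 7 = 5 * Z" "var s2 6 = 4 * Z" "var s2 24 = Q" "var s2 9 = k"
        using sameD[OF sm2] v baseD[OF b] l by (simp_all add: list_at_def k_def)
      have Dk: "?D j \<le> k" unfolding k_def by (rule dif_le)
      have "?D j * Q \<le> n * Q" using Dk kn by (intro mult_le_mono1) linarith
      also have "\<dots> \<le> W" using W(2) by (simp add: algebra_simps)
      finally have DQ: "?D j * Q \<le> W" .
      define m3 where "m3 = (mem s2)(5 * Z + j := ?D j)"
      define m4 where "m4 = (if ?D j * Q \<le> k then m3(4 * Z + j := 1) else m3)"
      have jZ: "j < Z" using j kn nZ by simp
      have kZ: "i < Z" if "i < k" for i using that kn nZ by simp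
      have 1: "m4 c = mem s c" if "c < 4 * Z \<or> 6 * Z \<le> c" for c
        using that m[of c] jZ by (auto simp: m4_def m3_def m2)
      have 2: "m4 (5 * Z + i) = ?D i" if "i < Suc j" for i
        using that D jZ by (auto simp: m4_def m3_def m2 less_Suc_eq)
      have 3: "m4 (4 * Z + i) = (if i < Suc j then cs' i else cs i)" if "i < k" for i
        using F[OF that] kZ[OF that] jZ by (auto simp: m4_def m3_def m2 less_Suc_eq cs'_def k_def)
      define s4 where "s4 = s2\<lparr>mem := m4\<rparr>"
      have I4: "I (Suc j) (s4\<lparr>var := (var s4)(12 := Suc j)\<rparr>)"
        using sm3 1 2 3 j by (simp add: I_def s4_def same_def)
      have fits: "5 * Z + j \<le> W" "4 * Z + j \<le> W" "Suc k \<le> W" "Q \<le> W" "k \<le> W" "5 * Z \<le> W" "4 * Z \<le> W" "j \<le> W"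
        "?D j \<le> W" "1 \<le> W"
        using jZ W kn nZ Dk by auto
      have m3s: "s2\<lparr>mem := (mem s2)(5 * Z + j := ?D j)\<rparr> = s2\<lparr>mem := m3\<rparr>" by (simp add: m3_def)
      show "wp W rest (\<lambda>t2 s'. t + t2 \<le> t0 \<and> var s' 12 = j \<and> I (Suc j) (s'\<lparr>var := (var s')(12 := Suc j)\<rparr>)) s2"
      proof (cases "?D j * Q \<le> k")
        case True
        then have "m3(4 * Z + j := 1) = m4" by (simp add: m4_def)
        then show ?thesis unfolding rest_def using t v2 v14 fits DQ True I4
          by (simp add: wp_simps leE_def m3s s4_def t0_def k_def)
      next
        case False
        then have "m3 = m4" by (simp add: m4_def)
        then show ?thesis unfolding rest_def using t v2 v14 fits DQ False I4
          by (simp add: wp_simps leE_def m3s s4_def t0_def k_def)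
      qed
    qed
  qed
  have loop: "wp W cover_prog (\<lambda>t s'. t \<le> (k + 1) * (t0 + 8) \<and> I k s') s"
    unfolding cover_prog_def rest_def[symmetric]
  proof (rule wp_For)
    show "k \<le> W" "1 \<le> W" using kn by auto
    show "I 0 (s\<lparr>var := (var s)(12 := 0)\<rparr>)" using s(3) by (simp add: I_def same_def flags_at_def k_def)
    show "var s' 12 = j \<and> var s' 9 = k" if "I j s'" for j s'
      using that s(2) sameD[of "{12,13,14}" s' s 9] by (simp add: I_def list_at_def k_def)
  qed (rule body)
  then show ?thesis
  proof (rule wp_mono)
    fix t s' assume *: "t \<le> (k + 1) * (t0 + 8) \<and> I k s'"
    have "(k + 1) * (t0 + 8) \<le> (k + 1) * (100 * (k + 1))" by (intro mult_le_mono2) (simp add: t0_def)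
    then have "t \<le> (k + 1) * (100 * (k + 1))" using * by linarith
    then have "t \<le> 100 * ((k + 1) * (k + 1))" by (simp only: mult.left_commute)
    moreover have "?D i \<le> n" for i using dif_le[of "ladj xs" k a i] kn by (simp add: k_def)
    ultimately show "t \<le> 100 * ((length xs + 1) * (length xs + 1)) \<and> same {12,13,14} s' s \<and>
      (\<forall>a. a < 4 * Z \<or> 6 * Z \<le> a \<longrightarrow> mem s' a = mem s a) \<and> dist_at (length xs) ?D s' \<and>
      flags_at (length xs) (\<lambda>i. if ?D i * Q \<le> length xs then 1 else cs i) s'"
      using * cs1 by (auto simp: I_def dist_at_def flags_at_def k_def cs'_def)
  qed
qed

lemma round_prog:
  assumes s: "base s" "list_at xs s" "flags_at (length xs) cs s" "out_ok s" and xs: "distinct xs"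
  shows "wp W round_prog (\<lambda>t s'. t \<le> (Q + 1) * (300 * ((length xs + 1) * (length xs + 1))) \<and>
    same {0,1,11,12,13,14,15,16,17,25} s' s \<and> (\<forall>a. a < 4 * Z \<longrightarrow> mem s' a = mem s a) \<and> out_ok s' \<and>
    var s 0 \<le> var s' 0 \<and>
    (\<exists>a<length xs. ((\<exists>i<length xs. cs i = 0) \<longrightarrow> cs a = 0) \<and> found xs a (var s' 0) \<and>
      flags_at (length xs)
        (\<lambda>i. if dif (ladj xs) {..<length xs} a i * Q \<le> length xs then 1 else cs i) s')) s"
proof -
  define k where "k = length xs"
  define K where "K = (k + 1) * (k + 1)"
  have kK: "k + 1 \<le> K" by (simp add: K_def)
  have kn: "k \<le> n" using s(2) by (simp add: list_at_def k_def)
  show ?thesis unfolding round_prog_def wp_Seq[of W uncovered_prog] k_def[symmetric] K_def[symmetric]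
  proof (rule wp_mono[OF uncovered_prog[OF s(1-3)]])
    fix t1 s1 assume *: "t1 \<le> 20 * (length xs + 1) \<and> same {11,12} s1 s \<and> mem s1 = mem s \<and>
      var s1 11 < length xs \<and> ((\<exists>i<length xs. cs i = 0) \<longrightarrow> cs (var s1 11) = 0)"
    define a where "a = var s1 11"
    let ?D = "dif (ladj xs) {..<length xs} a"
    define cs' where "cs' i = (if ?D i * Q \<le> k then 1 else cs i)" for i
    have t1: "t1 \<le> 20 * K" using * kK by (simp add: k_def)
    have sm1: "same {11,12} s1 s" and m1: "mem s1 = mem s" and a: "a < k" "(\<exists>i<k. cs i = 0) \<longrightarrow> cs a = 0"
      using * by (auto simp: a_def k_def)
    have b1: "base s1" by (rule base_frame[OF s(1) sm1]) (use m1 in auto)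
    have l1: "list_at xs s1" by (rule list_at_frame[OF s(2) sm1]) (use m1 in auto)
    have f1: "flags_at (length xs) cs s1" using s(3) by (simp add: flags_at_def m1)
    have o1: "out_ok s1" by (rule out_ok_frame[OF s(4) sm1]) (use m1 in auto)
    show "wp W (Seq cover_prog scale_prog) (\<lambda>t2 s'. t1 + t2 \<le> (Q + 1) * (300 * K) \<and>
      same {0,1,11,12,13,14,15,16,17,25} s' s \<and> (\<forall>a. a < 4 * Z \<longrightarrow> mem s' a = mem s a) \<and> out_ok s' \<and>
      var s 0 \<le> var s' 0 \<and>
      (\<exists>a<k. ((\<exists>i<k. cs i = 0) \<longrightarrow> cs a = 0) \<and> found xs a (var s' 0) \<and>
        flags_at k (\<lambda>i. if dif (ladj xs) {..<k} a i * Q \<le> k then 1 else cs i) s')) s1"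
      unfolding wp_Seq
    proof (rule wp_mono[OF cover_prog[OF b1 l1 f1 a_def[symmetric] a(1)[unfolded k_def]]])
      fix t2 s2 assume *: "t2 \<le> 100 * ((length xs + 1) * (length xs + 1)) \<and> same {12,13,14} s2 s1 \<and>
        (\<forall>a. a < 4 * Z \<or> 6 * Z \<le> a \<longrightarrow> mem s2 a = mem s1 a) \<and> dist_at (length xs) ?D s2 \<and>
        flags_at (length xs) (\<lambda>i. if ?D i * Q \<le> length xs then 1 else cs i) s2"
      have t2: "t2 \<le> 100 * K" using * by (simp add: k_def K_def)
      have sm2: "same {12,13,14} s2 s1" and m2: "\<And>a. a < 4 * Z \<or> 6 * Z \<le> a \<Longrightarrow> mem s2 a = mem s1 a"
        and d2: "dist_at (length xs) ?D s2"
        and f2: "flags_at (length xs) (\<lambda>i. if ?D i * Q \<le> length xs then 1 else cs i) s2" using * by auto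
      have b2: "base s2" by (rule base_frame[OF b1 sm2]) (use m2 in auto)
      have l2: "list_at xs s2" by (rule list_at_frame[OF l1 sm2]) (use m2 in auto)
      have o2: "out_ok s2" by (rule out_ok_frame[OF o1 sm2]) (use m2 in auto)
      have sm21: "same {11,12,13,14} s2 s" by (rule same_trans[OF sm2 sm1]) auto
      show "wp W scale_prog (\<lambda>t3 s'. t1 + (t2 + t3) \<le> (Q + 1) * (300 * K) \<and>
        same {0,1,11,12,13,14,15,16,17,25} s' s \<and> (\<forall>a. a < 4 * Z \<longrightarrow> mem s' a = mem s a) \<and> out_ok s' \<and>
        var s 0 \<le> var s' 0 \<and>
        (\<exists>a<k. ((\<exists>i<k. cs i = 0) \<longrightarrow> cs a = 0) \<and> found xs a (var s' 0) \<and>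
          flags_at k (\<lambda>i. if dif (ladj xs) {..<k} a i * Q \<le> k then 1 else cs i) s')) s2"
      proof (rule wp_mono[OF scale_prog[OF b2 l2 d2 o2 xs]])
        fix t3 s3 assume *: "t3 \<le> (Q + 1) * (150 * ((length xs + 1) * (length xs + 1))) \<and>
          same {0,1,12,13,15,16,17,25} s3 s2 \<and> (\<forall>a. a < 6 * Z \<longrightarrow> mem s3 a = mem s2 a) \<and> out_ok s3 \<and>
          var s2 0 \<le> var s3 0 \<and> found xs a (var s3 0)"
        then have sm3: "same {0,1,12,13,15,16,17,25} s3 s2" by simp
        have "same {0,1,11,12,13,14,15,16,17,25} s3 s" by (rule same_trans[OF sm3 sm21]) auto
        moreover have "t1 + (t2 + t3) \<le> (Q + 1) * (300 * K)"
        proof -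
          have "t3 \<le> (Q + 1) * (150 * K)" using * by (simp add: K_def k_def)
          moreover have "150 * K \<le> (Q + 1) * (150 * K)" by simp
          moreover have "(Q + 1) * (300 * K) = (Q + 1) * (150 * K) + (Q + 1) * (150 * K)" by (simp add: algebra_simps)
          ultimately show ?thesis using t1 t2 by linarith
        qed
        moreover have "flags_at k (\<lambda>i. if dif (ladj xs) {..<k} a i * Q \<le> k then 1 else cs i) s3"
          unfolding k_def by (rule flags_at_frame[OF f2]) (use * kn in \<open>auto simp: k_def\<close>)
        moreover have "var s 0 \<le> var s3 0" using * sameD[OF sm21, of 0] by simp
        moreover have "\<forall>a. a < 4 * Z \<longrightarrow> mem s3 a = mem s a" using * m2 m1 by simp
        ultimately show "t1 + (t2 + t3) \<le> (Q + 1) * (300 * K) \<and>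
          same {0,1,11,12,13,14,15,16,17,25} s3 s \<and> (\<forall>a. a < 4 * Z \<longrightarrow> mem s3 a = mem s a) \<and> out_ok s3 \<and>
          var s 0 \<le> var s3 0 \<and>
          (\<exists>a<k. ((\<exists>i<k. cs i = 0) \<longrightarrow> cs a = 0) \<and> found xs a (var s3 0) \<and>
            flags_at k (\<lambda>i. if dif (ladj xs) {..<k} a i * Q \<le> k then 1 else cs i) s3)"
          using * a by blast
      qed
    qed
  qed
qed

lemma found_mono: "found xs a b \<Longrightarrow> b \<le> b' \<Longrightarrow> found xs a b'"
  unfolding found_def by (meson order_trans)

definition netted :: "nat list \<Rightarrow> nat \<Rightarrow> bool" where
  "netted xs best \<longleftrightarrow> (\<exists>ss\<subseteq>{..<length xs}.
     (\<forall>x<length xs. \<exists>a\<in>ss. dif (ladj xs) {..<length xs} a x * Q \<le> length xs) \<and> (\<forall>a\<in>ss. found xs a best))"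

text \<open>As long as some position is uncovered, a round adds a center that is far from all
  earlier ones. By \<open>pack\<close> there cannot be \<open>R\<close> such centers, so
  \<open>R\<close> rounds cover everything.\<close>

lemma net_prog:
  assumes s: "base s" "list_at xs s" "out_ok s" and xs: "distinct xs"
    and pack: "\<And>S. S \<subseteq> {..<length xs} \<Longrightarrow>
      (\<And>x y. x \<in> S \<Longrightarrow> y \<in> S \<Longrightarrow> x \<noteq> y \<Longrightarrow> length xs < dif (ladj xs) {..<length xs} x y * Q) \<Longrightarrow> card S < R"
  shows "wp W net_prog (\<lambda>t s'. t \<le> (R + 1) * ((Q + 1) * (330 * ((length xs + 1) * (length xs + 1)))) \<and>
    same {0,1,11,12,13,14,15,16,17,18,25} s' s \<and> (\<forall>a. a < 4 * Z \<longrightarrow> mem s' a = mem s a) \<and> out_ok s' \<and>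
    var s 0 \<le> var s' 0 \<and> netted xs (var s' 0)) s"
proof -
  define k where "k = length xs"
  define K where "K = (k + 1) * (k + 1)"
  let ?D = "dif (ladj xs) {..<k}"
  let ?A = "{0,1,11,12,13,14,15,16,17,18,25} :: nat set"
  have kK: "k + 1 \<le> K" "1 \<le> K" by (simp_all add: K_def)
  have kn: "k \<le> n" "n \<le> W" "1 \<le> k" using s(2) nZ W by (auto simp: list_at_def k_def Suc_le_eq)
  define I0 where "I0 j s' \<longleftrightarrow> same {12} s' s \<and> (\<forall>a. a < 4 * Z \<or> 5 * Z \<le> a \<longrightarrow> mem s' a = mem s a) \<and>
    var s' 12 = j \<and> j \<le> k \<and> (\<forall>i<j. mem s' (4 * Z + i) = 0)" for j s'
  have clear: "wp W (For 12 9 (Store (Plus (Var 6) (Var 12)) (Const 0)))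
      (\<lambda>t s'. t \<le> (k + 1) * (10 + 8) \<and> I0 k s') s"
  proof (rule wp_For)
    show "k \<le> W" "1 \<le> W" using kn by auto
    show "I0 0 (s\<lparr>var := (var s)(12 := 0)\<rparr>)" by (simp add: I0_def same_def)
    show "var s' 12 = j \<and> var s' 9 = k" if "I0 j s'" for j s'
      using that s(2) sameD[of "{12}" s' s 9] by (simp add: I0_def list_at_def k_def)
    fix j s' assume j: "j < k" and I: "I0 j s'"
    have sm: "same {12} s' s" and v: "var s' 12 = j" using I by (auto simp: I0_def)
    have v6: "var s' 6 = 4 * Z" using sameD[OF sm] baseD[OF s(1)] by simp
    have jZ: "j < Z" using j kn nZ by simp
    show "wp W (Store (Plus (Var 6) (Var 12)) (Const 0)) (\<lambda>t s'. t \<le> 10 \<and> var s' 12 = j \<and>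
        I0 (Suc j) (s'\<lparr>var := (var s')(12 := Suc j)\<rparr>)) s'"
      using I v v6 j jZ W by (auto simp: wp_simps I0_def same_def less_Suc_eq)
  qed
  define J where "J j s' \<longleftrightarrow> same ?A s' s \<and> (\<forall>a. a < 4 * Z \<longrightarrow> mem s' a = mem s a) \<and> out_ok s' \<and>
    var s 0 \<le> var s' 0 \<and> var s' 18 = j \<and>
    (\<exists>ss\<subseteq>{..<k}. flags_at k (\<lambda>x. of_bool (\<exists>a\<in>ss. ?D a x * Q \<le> k)) s' \<and> (\<forall>a\<in>ss. found xs a (var s' 0)) \<and>
      ((\<forall>x<k. \<exists>a\<in>ss. ?D a x * Q \<le> k) \<or>
       card ss = j \<and> (\<forall>x\<in>ss. \<forall>y\<in>ss. x \<noteq> y \<longrightarrow> k < ?D x y * Q)))" for j s'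
  have body: "wp W round_prog (\<lambda>t s'. t \<le> (Q + 1) * (300 * K) \<and> var s' 18 = j \<and>
      J (Suc j) (s'\<lparr>var := (var s')(18 := Suc j)\<rparr>)) s1" if Jj: "J j s1" for j s1
  proof -
    obtain ss where sm: "same ?A s1 s" and m: "\<And>a. a < 4 * Z \<Longrightarrow> mem s1 a = mem s a" and o: "out_ok s1"
      and v: "var s 0 \<le> var s1 0" "var s1 18 = j" and ss: "ss \<subseteq> {..<k}"
      and f: "flags_at k (\<lambda>x. of_bool (\<exists>a\<in>ss. ?D a x * Q \<le> k)) s1" and fd: "\<forall>a\<in>ss. found xs a (var s1 0)"
      and alt: "(\<forall>x<k. \<exists>a\<in>ss. ?D a x * Q \<le> k) \<or> card ss = j \<and> (\<forall>x\<in>ss. \<forall>y\<in>ss. x \<noteq> y \<longrightarrow> k < ?D x y * Q)"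
      using Jj unfolding J_def by blast
    have b: "base s1" by (rule base_frame[OF s(1) sm]) (use m in auto)
    have l: "list_at xs s1" by (rule list_at_frame[OF s(2) sm]) (use m in auto)
    have RP: "wp W round_prog (\<lambda>t s2. t \<le> (Q + 1) * (300 * K) \<and>
        same {0,1,11,12,13,14,15,16,17,25} s2 s1 \<and> (\<forall>a. a < 4 * Z \<longrightarrow> mem s2 a = mem s1 a) \<and> out_ok s2 \<and>
        var s1 0 \<le> var s2 0 \<and>
        (\<exists>a<k. ((\<exists>i<k. of_bool (\<exists>b\<in>ss. ?D b i * Q \<le> k) = (0::nat)) \<longrightarrow> of_bool (\<exists>b\<in>ss. ?D b a * Q \<le> k) = (0::nat)) \<and>
          found xs a (var s2 0) \<and>
          flags_at k (\<lambda>i. if ?D a i * Q \<le> k then 1 else of_bool (\<exists>b\<in>ss. ?D b i * Q \<le> k)) s2)) s1"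
      using round_prog[OF b l f[unfolded k_def] o xs] unfolding k_def K_def .
    show ?thesis
    proof (rule wp_mono[OF RP])
      fix t s2 assume *: "t \<le> (Q + 1) * (300 * K) \<and>
        same {0,1,11,12,13,14,15,16,17,25} s2 s1 \<and> (\<forall>a. a < 4 * Z \<longrightarrow> mem s2 a = mem s1 a) \<and> out_ok s2 \<and>
        var s1 0 \<le> var s2 0 \<and>
        (\<exists>a<k. ((\<exists>i<k. of_bool (\<exists>b\<in>ss. ?D b i * Q \<le> k) = (0::nat)) \<longrightarrow> of_bool (\<exists>b\<in>ss. ?D b a * Q \<le> k) = (0::nat)) \<and>
          found xs a (var s2 0) \<and>
          flags_at k (\<lambda>i. if ?D a i * Q \<le> k then 1 else of_bool (\<exists>b\<in>ss. ?D b i * Q \<le> k)) s2)"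
      then obtain a where a: "a < k" "(\<exists>i<k. \<not> (\<exists>b\<in>ss. ?D b i * Q \<le> k)) \<longrightarrow> \<not> (\<exists>b\<in>ss. ?D b a * Q \<le> k)"
        "found xs a (var s2 0)" "flags_at k (\<lambda>i. if ?D a i * Q \<le> k then 1 else of_bool (\<exists>b\<in>ss. ?D b i * Q \<le> k)) s2"
        unfolding of_bool_eq_0_iff by blast
      have sm2: "same {0,1,11,12,13,14,15,16,17,25} s2 s1" using * by simp
      have "same ?A s2 s" by (rule same_trans[OF sm2 sm]) auto
      define s3 where "s3 = s2\<lparr>var := (var s2)(18 := Suc j)\<rparr>"
      have "out_ok s3" by (rule out_ok_frame[of s2 "{18}"]) (use * in \<open>auto simp: s3_def same_def\<close>)
      moreover have "same ?A s3 s" using \<open>same ?A s2 s\<close> by (auto simp: same_def s3_def)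
      moreover have "\<forall>a. a < 4 * Z \<longrightarrow> mem s3 a = mem s a" using * m by (simp add: s3_def)
      moreover have "var s 0 \<le> var s3 0" using * v by (simp add: s3_def)
      moreover have "var s3 18 = Suc j" by (simp add: s3_def)
      moreover have "flags_at k (\<lambda>x. of_bool (\<exists>b\<in>insert a ss. ?D b x * Q \<le> k)) s3"
      proof -
        have "(\<lambda>i. if ?D a i * Q \<le> k then 1 else of_bool (\<exists>b\<in>ss. ?D b i * Q \<le> k)) =
          (\<lambda>x. of_bool (\<exists>b\<in>insert a ss. ?D b x * Q \<le> k) :: nat)" by auto
        then show ?thesis using a(4) by (simp add: flags_at_def s3_def)
      qed
      moreover have "\<forall>b\<in>insert a ss. found xs b (var s3 0)"
        using fd a(3) * found_mono by (auto simp: s3_def)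
      moreover have "(\<forall>x<k. \<exists>b\<in>insert a ss. ?D b x * Q \<le> k) \<or>
        card (insert a ss) = Suc j \<and> (\<forall>x\<in>insert a ss. \<forall>y\<in>insert a ss. x \<noteq> y \<longrightarrow> k < ?D x y * Q)"
      proof (cases "\<forall>x<k. \<exists>b\<in>ss. ?D b x * Q \<le> k")
        \<comment> \<open>Something is uncovered, so the chosen position is uncovered as well: it is
          far from all earlier centers and in particular new.\<close>
        case False
        then have far: "\<And>b. b \<in> ss \<Longrightarrow> k < ?D b a * Q" using a(2) by (auto simp: not_le)
        have "?D a a = 0" by (simp add: dif_def)
        then have "a \<notin> ss" using far[of a] by auto
        moreover have "finite ss" using ss finite_subset by blast
        moreover have "k < ?D a b * Q" if "b \<in> ss" for b using far[OF that] dif_sym[of _ _ a b] by simp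
        ultimately show ?thesis using alt False far by auto
      qed blast
      moreover have "insert a ss \<subseteq> {..<k}" using ss a(1) by auto
      ultimately have "J (Suc j) s3" unfolding J_def by blast
      moreover have "var s2 18 = j" using sameD[OF sm2] v by simp
      ultimately show "t \<le> (Q + 1) * (300 * K) \<and> var s2 18 = j \<and> J (Suc j) (s2\<lparr>var := (var s2)(18 := Suc j)\<rparr>)"
        using * by (simp add: s3_def)
    qed
  qed
  have W1: "1 \<le> W" using kn by simp
  show ?thesis unfolding net_prog_def wp_Seq k_def[symmetric] K_def[symmetric]
  proof (rule wp_mono[OF clear])
    fix t1 s1 assume *: "t1 \<le> (k + 1) * (10 + 8) \<and> I0 k s1"
    then have sm1: "same {12} s1 s" and m1: "\<And>a. a < 4 * Z \<or> 5 * Z \<le> a \<Longrightarrow> mem s1 a = mem s a"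
      and z1: "\<And>i. i < k \<Longrightarrow> mem s1 (4 * Z + i) = 0" by (auto simp: I0_def)
    have "t1 \<le> 18 * (k + 1)" using * by simp
    then have t1: "t1 \<le> 18 * K" by (rule order_trans[OF _ mult_le_mono2[OF kK(1)]])
    have loop: "wp W (For 18 23 round_prog) (\<lambda>t s'. t \<le> (R + 1) * ((Q + 1) * (300 * K) + 8) \<and> J R s') s1"
    proof (rule wp_For)
      show "R \<le> W" "1 \<le> W" using W W1 by auto
      show "var s' 18 = j \<and> var s' 23 = R" if "J j s'" for j s'
      proof -
        have "same ?A s' s" "var s' 18 = j" using that by (simp_all add: J_def)
        then show ?thesis using sameD[of ?A s' s 23] baseD[OF s(1)] by simp
      qed
      define s2 where "s2 = s1\<lparr>var := (var s1)(18 := 0)\<rparr>"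
      have sm2: "same {12,18} s2 s" using sm1 by (auto simp: s2_def same_def)
      have "out_ok s2" by (rule out_ok_frame[OF s(3) sm2]) (use m1 in \<open>auto simp: s2_def\<close>)
      moreover have "same ?A s2 s" using sm2 by (simp add: same_def)
      moreover have "flags_at k (\<lambda>x. of_bool (\<exists>a\<in>{}. ?D a x * Q \<le> k)) s2" using z1 by (simp add: flags_at_def s2_def)
      moreover have "var s 0 \<le> var s2 0" using sameD[OF sm2] by simp
      ultimately show "J 0 (s1\<lparr>var := (var s1)(18 := 0)\<rparr>)" unfolding s2_def[symmetric] J_def
        using m1 by (intro conjI exI[of _ "{}"]) (auto simp: s2_def)
    qed (rule body)
    show "wp W (For 18 23 round_prog) (\<lambda>t2 s'. t1 + t2 \<le> (R + 1) * ((Q + 1) * (330 * K)) \<and> same ?A s' s \<and>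
      (\<forall>a. a < 4 * Z \<longrightarrow> mem s' a = mem s a) \<and> out_ok s' \<and> var s 0 \<le> var s' 0 \<and> netted xs (var s' 0)) s1"
    proof (rule wp_mono[OF loop])
      fix t2 s2 assume *: "t2 \<le> (R + 1) * ((Q + 1) * (300 * K) + 8) \<and> J R s2"
      have "t1 + t2 \<le> (R + 1) * ((Q + 1) * (330 * K))"
      proof -
        have q: "K \<le> (Q + 1) * K" by simp
        have "18 * K \<le> (R + 1) * (18 * ((Q + 1) * K))" using q
          by (metis (no_types, opaque_lifting) add.commute le_add1 mult.commute mult_le_mono mult_le_mono2 nat_mult_1 plus_1_eq_Suc)
        moreover have "(R + 1) * ((Q + 1) * (300 * K) + 8) \<le> (R + 1) * (308 * ((Q + 1) * K))"
          using q kK by (intro mult_le_mono2) (simp add: algebra_simps)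
        moreover have "(R + 1) * (18 * ((Q + 1) * K)) + (R + 1) * (308 * ((Q + 1) * K)) = (R + 1) * (326 * ((Q + 1) * K))"
          by (simp add: algebra_simps)
        moreover have "(R + 1) * (326 * ((Q + 1) * K)) \<le> (R + 1) * ((Q + 1) * (330 * K))"
          by (intro mult_le_mono2) (simp add: algebra_simps)
        ultimately show ?thesis using t1 * by linarith
      qed
      moreover have "netted xs (var s2 0)"
      proof -
        obtain ss where ss: "ss \<subseteq> {..<k}" "\<forall>a\<in>ss. found xs a (var s2 0)"
          "(\<forall>x<k. \<exists>a\<in>ss. ?D a x * Q \<le> k) \<or> card ss = R \<and> (\<forall>x\<in>ss. \<forall>y\<in>ss. x \<noteq> y \<longrightarrow> k < ?D x y * Q)"
          using * unfolding J_def by blast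
        then have "\<forall>x<k. \<exists>a\<in>ss. ?D a x * Q \<le> k" using pack[of ss] unfolding k_def by blast
        then show ?thesis unfolding netted_def using ss by (auto simp: k_def)
      qed
      ultimately show "t1 + t2 \<le> (R + 1) * ((Q + 1) * (330 * K)) \<and> same ?A s2 s \<and>
        (\<forall>a. a < 4 * Z \<longrightarrow> mem s2 a = mem s a) \<and> out_ok s2 \<and> var s 0 \<le> var s2 0 \<and> netted xs (var s2 0)"
        using * by (simp add: J_def)
    qed
  qed
qed

end

section \<open>One round of peeling\<close>

definition scan_prog :: com where
  "scan_prog = Seq (Assign 19 (Var 2)) (For 12 2 (If (arrE 4 (Var 12))
    (If (Minus (Var 19) (arrE 4 (Var 12))) (Seq (Assign 19 (arrE 4 (Var 12))) (Assign 10 (Var 12))) Skip) Skip))"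

definition build_prog :: com where
  "build_prog = Seq (Assign 9 (Const 0)) (For 12 2 (If (adjE (Var 10) (Var 12))
    (If (arrE 4 (Var 12)) (Seq (Store (Plus (Var 5) (Var 9)) (Var 12)) (incr 9)) Skip) Skip))"

definition dec_prog :: com where
  "dec_prog = Seq (For 12 9 (Store (Plus (Var 4) (arrE 5 (Var 12))) (Minus (arrE 4 (arrE 5 (Var 12))) (Const 1))))
    (Store (Plus (Var 4) (Var 10)) (Const 0))"

text \<open>Register 19 starts at \<open>n\<close>, which exceeds every degree, so the test fails
  exactly when all degrees are 0.\<close>

definition peel_prog :: com where
  "peel_prog = Seq scan_prog (If (Minus (Var 2) (Var 19)) (Seq build_prog (Seq net_prog dec_prog)) (Assign 20 (Const 0)))"

context ram
begin

definition deg_at :: "(nat \<Rightarrow> nat) \<Rightarrow> state \<Rightarrow> bool" where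
  "deg_at dg s \<longleftrightarrow> (\<forall>i<n. mem s (2 * Z + i) = dg i \<and> dg i < n)"

lemma deg_at_frame:
  assumes "deg_at dg s" "\<And>a. 2 * Z \<le> a \<Longrightarrow> a < 3 * Z \<Longrightarrow> mem s' a = mem s a"
  shows "deg_at dg s'"
proof -
  have "mem s' (2 * Z + i) = mem s (2 * Z + i)" if "i < n" for i
    using that nZ by (intro assms(2)) auto
  then show ?thesis using assms(1) unfolding deg_at_def by simp
qed

lemma scan_prog:
  assumes s: "base s" "deg_at dg s"
  shows "wp W scan_prog (\<lambda>t s'. t \<le> 40 * (n + 1) \<and> same {10,12,19} s' s \<and> mem s' = mem s \<and>
    ((\<forall>i<n. dg i = 0) \<and> var s' 19 = n \<or>
     var s' 10 < n \<and> dg (var s' 10) \<noteq> 0 \<and> var s' 19 = dg (var s' 10) \<and>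
       (\<forall>i<n. dg i \<noteq> 0 \<longrightarrow> dg (var s' 10) \<le> dg i))) s"
proof -
  have nW: "n \<le> W" "1 \<le> W" using nZ W n by auto
  define P where "P j s' \<longleftrightarrow> (\<forall>i<j. dg i = 0) \<and> var s' 19 = n \<or>
     var s' 10 < j \<and> dg (var s' 10) \<noteq> 0 \<and> var s' 19 = dg (var s' 10) \<and>
       (\<forall>i<j. dg i \<noteq> 0 \<longrightarrow> dg (var s' 10) \<le> dg i)" for j and s' :: state
  define I where "I j s' \<longleftrightarrow> same {10,12,19} s' s \<and> mem s' = mem s \<and> var s' 12 = j \<and> j \<le> n \<and> P j s'" for j s'
  define body where "body = If (arrE 4 (Var 12))
    (If (Minus (Var 19) (arrE 4 (Var 12))) (Seq (Assign 19 (arrE 4 (Var 12))) (Assign 10 (Var 12))) Skip) Skip"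
  have body: "wp W body (\<lambda>t s'. t \<le> 30 \<and> var s' 12 = j \<and> I (Suc j) (s'\<lparr>var := (var s')(12 := Suc j)\<rparr>)) s'"
    if j: "j < n" and I: "I j s'" for j s'
  proof -
    have sm: "same {10,12,19} s' s" and m: "mem s' = mem s" and v: "var s' 12 = j" and P: "P j s'"
      using I by (auto simp: I_def)
    have v4: "var s' 4 = 2 * Z" using sameD[OF sm] baseD[OF s(1)] by simp
    have dj: "mem s (2 * Z + j) = dg j" "dg j < n" using s(2) j by (auto simp: deg_at_def)
    have v19: "var s' 19 \<le> n" using P s(2) j unfolding P_def deg_at_def by (auto intro: less_imp_le)
    have f: "fits W (arrE 4 (Var 12)) s'" "eval (arrE 4 (Var 12)) s' = dg j"
      using v v4 m dj j nW nZ W by (simp_all add: arrE_def)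
    consider "dg j = 0" | "dg j \<noteq> 0" "var s' 19 \<le> dg j" | "dg j \<noteq> 0" "dg j < var s' 19" by linarith
    then show ?thesis
    proof cases
      case 1
      have "P (Suc j) s'" using P 1 unfolding P_def by (auto simp: less_Suc_eq)
      then show ?thesis unfolding body_def using f 1 sm m v j by (simp add: wp_simps I_def same_def P_def)
    next
      case 2
      have "P (Suc j) s'" using P 2 dj unfolding P_def by (auto simp: less_Suc_eq)
      then show ?thesis unfolding body_def using f 2 sm m v j v19 nW by (simp add: wp_simps I_def same_def P_def)
    next
      case 3
      have "\<forall>i<Suc j. dg i \<noteq> 0 \<longrightarrow> dg j \<le> dg i" using P 3(2) unfolding P_def
        by (auto simp: less_Suc_eq intro: less_imp_le less_le_trans)
      then show ?thesis unfolding body_def using f 3 sm m v j v19 nW by (simp add: wp_simps I_def same_def P_def)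
    qed
  qed
  define s1 where "s1 = s\<lparr>var := (var s)(19 := eval (Var 2) s)\<rparr>"
  have v2: "var s 2 = n" using baseD[OF s(1)] by simp
  have loop: "wp W (For 12 2 body) (\<lambda>t s'. t \<le> (n + 1) * (30 + 8) \<and> I n s') s1"
  proof (rule wp_For)
    show "n \<le> W" "1 \<le> W" using nW by auto
    show "I 0 (s1\<lparr>var := (var s1)(12 := 0)\<rparr>)" using v2 by (simp add: s1_def I_def same_def P_def)
    show "var s' 12 = j \<and> var s' 2 = n" if "I j s'" for j s'
      using that v2 sameD[of "{10,12,19}" s' s 2] by (simp add: I_def)
  qed (rule body)
  show ?thesis unfolding scan_prog_def body_def[symmetric] wp_Seq wp_Assign s1_def[symmetric]
  proof (intro conjI)
    show "fits W (Var 2) s" using v2 nW by simp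
  qed (rule wp_mono[OF loop], auto simp: I_def P_def)
qed

text \<open>The diagonal of the matrix is set, so \<open>b\<close> belongs to its own list and the
  list is nonempty.\<close>

lemma build_prog:
  assumes s: "base s" "deg_at dg s" and b: "var s 10 = b" "b < n" "dg b \<noteq> 0" "adj b b"
  defines "xs \<equiv> filter (\<lambda>x. adj b x \<and> dg x \<noteq> 0) [0..<n]"
  shows "wp W build_prog (\<lambda>t s'. t \<le> 50 * (n + 1) \<and> same {9,12} s' s \<and>
    (\<forall>a. a < 3 * Z \<or> 4 * Z \<le> a \<longrightarrow> mem s' a = mem s a) \<and> list_at xs s') s"
proof -
  have nW: "n \<le> W" "1 \<le> W" using nZ W n by auto
  define f where "f j = filter (\<lambda>x. adj b x \<and> dg x \<noteq> 0) [0..<j]" for j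
  have len_f: "length (f j) \<le> j" for j using length_filter_le[of _ "[0..<j]"] unfolding f_def by simp
  define I where "I j s' \<longleftrightarrow> same {9,12} s' s \<and> (\<forall>a. a < 3 * Z \<or> 4 * Z \<le> a \<longrightarrow> mem s' a = mem s a) \<and>
    var s' 12 = j \<and> j \<le> n \<and> var s' 9 = length (f j) \<and> (\<forall>i<length (f j). mem s' (3 * Z + i) = f j ! i)" for j s'
  define body where "body = If (adjE (Var 10) (Var 12))
    (If (arrE 4 (Var 12)) (Seq (Store (Plus (Var 5) (Var 9)) (Var 12)) (incr 9)) Skip) Skip"
  have step: "f (Suc j) = (if adj b j \<and> dg j \<noteq> 0 then f j @ [j] else f j)" for j by (simp add: f_def)
  have body: "wp W body (\<lambda>t s'. t \<le> 35 \<and> var s' 12 = j \<and> I (Suc j) (s'\<lparr>var := (var s')(12 := Suc j)\<rparr>)) s'"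
    if j: "j < n" and I: "I j s'" for j s'
  proof -
    have sm: "same {9,12} s' s" and m: "\<And>a. a < 3 * Z \<or> 4 * Z \<le> a \<Longrightarrow> mem s' a = mem s a"
      and v: "var s' 12 = j" "var s' 9 = length (f j)"
      and F: "\<And>i. i < length (f j) \<Longrightarrow> mem s' (3 * Z + i) = f j ! i" using I by (auto simp: I_def)
    have b': "base s'" by (rule base_frame[OF s(1) sm]) (use m in auto)
    have d': "deg_at dg s'" by (rule deg_at_frame[OF s(2)]) (use m in auto)
    have v10: "var s' 10 = b" using sameD[OF sm] b by simp
    have dj: "mem s' (2 * Z + j) = dg j" "dg j < n" using d' j by (auto simp: deg_at_def)
    have g: "fits W (arrE 4 (Var 12)) s'" "eval (arrE 4 (Var 12)) s' = dg j"
      using v baseD[OF b'] dj j nW nZ W by (simp_all add: arrE_def)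
    have a: "fits W (adjE (Var 10) (Var 12)) s'" "eval (adjE (Var 10) (Var 12)) s' = of_bool (adj b j)"
      using adjE[OF b', of "Var 10" "Var 12"] v10 v b j nW by auto
    show ?thesis
    proof (cases "adj b j \<and> dg j \<noteq> 0")
      case False
      then have fs: "f (Suc j) = f j" by (simp add: step)
      have 3: "mem s' a = mem s a" if "a < 3 * Z" for a using m that by simp
      show ?thesis unfolding body_def using False a g sm m F v j 3
        by (auto simp: wp_simps I_def same_def fs)
    next
      case True
      then have fs: "f (Suc j) = f j @ [j]" by (simp add: step)
      let ?m = "(mem s')(3 * Z + length (f j) := j)"
      have 1: "?m c = mem s c" if "c < 3 * Z \<or> 4 * Z \<le> c" for c using that m len_f[of j] j nZ by auto
      have 2: "?m (3 * Z + i) = (f j @ [j]) ! i" if "i < Suc (length (f j))" for i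
        using that F by (auto simp: nth_append less_Suc_eq)
      have 3: "mem s' c = mem s c" if "c < 3 * Z" for c using m that by simp
      have fits: "3 * Z + length (f j) \<le> W" "Suc (length (f j)) \<le> W" "j \<le> W" "3 * Z \<le> W" "length (f j) \<le> W"
        using len_f[of j] j nZ W by auto
      show ?thesis unfolding body_def using True a g sm 1 2 3 v j fits baseD[OF b'] nW
        by (simp add: wp_simps incr_def I_def same_def fs)
    qed
  qed
  define s1 where "s1 = s\<lparr>var := (var s)(9 := eval (Const 0) s)\<rparr>"
  have v2: "var s 2 = n" using baseD[OF s(1)] by simp
  have loop: "wp W (For 12 2 body) (\<lambda>t s'. t \<le> (n + 1) * (35 + 8) \<and> I n s') s1"
  proof (rule wp_For)
    show "n \<le> W" "1 \<le> W" using nW by auto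
    show "I 0 (s1\<lparr>var := (var s1)(12 := 0)\<rparr>)" by (simp add: s1_def I_def same_def f_def)
    show "var s' 12 = j \<and> var s' 2 = n" if "I j s'" for j s'
      using that v2 sameD[of "{9,12}" s' s 2] by (simp add: I_def)
  qed (rule body)
  have xs: "f n = xs" by (simp add: f_def xs_def)
  have xs_props: "xs \<noteq> []" "length xs \<le> n" "set xs \<subseteq> {..<n}"
  proof -
    have "b \<in> set xs" using b by (simp add: xs_def)
    then show "xs \<noteq> []" by auto
    show "length xs \<le> n" using len_f[of n] xs by simp
  qed (auto simp: xs_def)
  show ?thesis unfolding build_prog_def body_def[symmetric] wp_Seq wp_Assign s1_def[symmetric]
  proof (intro conjI)
    show "fits W (Const 0) s" by simp
  qed (rule wp_mono[OF loop], use xs_props in \<open>auto simp: I_def xs list_at_def\<close>)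
qed

text \<open>Distinctness makes each listed degree drop only once; the last store overrides whatever
  the loop did to \<open>b\<close>.\<close>

lemma dec_prog:
  assumes s: "base s" "deg_at dg s" "list_at xs s" and b: "var s 10 = b" "b < n" and xs: "distinct xs"
  shows "wp W dec_prog (\<lambda>t s'. t \<le> 50 * (n + 1) \<and> same {12} s' s \<and>
    (\<forall>a. a < 2 * Z \<or> 3 * Z \<le> a \<longrightarrow> mem s' a = mem s a) \<and>
    deg_at (\<lambda>i. if i = b then 0 else if i \<in> set xs then dg i - 1 else dg i) s') s"
proof -
  have nW: "n \<le> W" "1 \<le> W" using nZ W n by auto
  define k where "k = length xs"
  have kn: "k \<le> n" "set xs \<subseteq> {..<n}" "var s 9 = k" using s(3) by (auto simp: list_at_def k_def)
  define I where "I j s' \<longleftrightarrow> same {12} s' s \<and> (\<forall>a. a < 2 * Z \<or> 3 * Z \<le> a \<longrightarrow> mem s' a = mem s a) \<and>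
    var s' 12 = j \<and> j \<le> k \<and> (\<forall>i<n. mem s' (2 * Z + i) = (if i \<in> set (take j xs) then dg i - 1 else dg i))" for j s'
  define body where "body = Store (Plus (Var 4) (arrE 5 (Var 12))) (Minus (arrE 4 (arrE 5 (Var 12))) (Const 1))"
  have body: "wp W body (\<lambda>t s'. t \<le> 20 \<and> var s' 12 = j \<and> I (Suc j) (s'\<lparr>var := (var s')(12 := Suc j)\<rparr>)) s'"
    if j: "j < k" and I: "I j s'" for j s'
  proof -
    have sm: "same {12} s' s" and m: "\<And>a. a < 2 * Z \<or> 3 * Z \<le> a \<Longrightarrow> mem s' a = mem s a"
      and v: "var s' 12 = j"
      and F: "\<And>i. i < n \<Longrightarrow> mem s' (2 * Z + i) = (if i \<in> set (take j xs) then dg i - 1 else dg i)"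
      using I by (auto simp: I_def)
    have b': "base s'" by (rule base_frame[OF s(1) sm]) (use m in auto)
    have l': "list_at xs s'" by (rule list_at_frame[OF s(3) sm]) (use m in auto)
    have len: "var s' 12 < length xs" using v j by (simp add: k_def)
    note al = at_list[OF b' l' len]
    define x where "x = xs ! j"
    have x: "x < n" "eval (arrE 5 (Var 12)) s' = x" using al v by (simp_all add: x_def)
    have xnt: "x \<notin> set (take j xs)" using xs j unfolding x_def k_def
      by (auto simp: in_set_conv_nth nth_eq_iff_index_eq)
    have tk: "set (take (Suc j) xs) = insert x (set (take j xs))"
      using j by (simp add: take_Suc_conv_app_nth x_def k_def)
    have dx: "mem s' (2 * Z + x) = dg x" "dg x < n" using F[OF x(1)] xnt s(2) x(1) by (auto simp: deg_at_def)
    have e: "eval (arrE 4 (arrE 5 (Var 12))) s' = dg x" "fits W (arrE 4 (arrE 5 (Var 12))) s'"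
      using x al baseD[OF b'] dx nW nZ W unfolding arrE_def[of 4] by simp_all
    let ?m = "(mem s')(2 * Z + x := dg x - 1)"
    have 1: "?m c = mem s c" if "c < 2 * Z \<or> 3 * Z \<le> c" for c using that m x(1) nZ by auto
    have 2: "?m (2 * Z + i) = (if i \<in> set (take (Suc j) xs) then dg i - 1 else dg i)" if "i < n" for i
      using F[OF that] by (auto simp: tk)
    have f: "2 * Z + x \<le> W" "2 * Z \<le> W" using x(1) nZ W by auto
    have 3: "mem s' c = mem s c" if "c < 2 * Z" for c using m that by simp
    show ?thesis unfolding body_def using 1 2 3 e f x al baseD[OF b'] v j nW sm
      by (simp add: wp_simps I_def same_def)
  qed
  have loop: "wp W (For 12 9 body) (\<lambda>t s'. t \<le> (k + 1) * (20 + 8) \<and> I k s') s"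
  proof (rule wp_For)
    show "k \<le> W" "1 \<le> W" using kn nW by auto
    show "I 0 (s\<lparr>var := (var s)(12 := 0)\<rparr>)" using s(2) by (simp add: I_def same_def deg_at_def)
    show "var s' 12 = j \<and> var s' 9 = k" if "I j s'" for j s'
      using that kn sameD[of "{12}" s' s 9] by (simp add: I_def)
  qed (rule body)
  show ?thesis unfolding dec_prog_def body_def[symmetric] wp_Seq
  proof (rule wp_mono[OF loop])
    fix t s' assume *: "t \<le> (k + 1) * (20 + 8) \<and> I k s'"
    have sm: "same {12} s' s" and m: "\<And>a. a < 2 * Z \<or> 3 * Z \<le> a \<Longrightarrow> mem s' a = mem s a"
      and F: "\<And>i. i < n \<Longrightarrow> mem s' (2 * Z + i) = (if i \<in> set xs then dg i - 1 else dg i)"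
      using * by (auto simp: I_def k_def)
    have b': "base s'" by (rule base_frame[OF s(1) sm]) (use m in auto)
    have v10: "var s' 10 = b" using sameD[OF sm] b by simp
    have "(k + 1) * (20 + 8) \<le> (n + 1) * (20 + 8)" using kn(1) by (intro mult_le_mono1) simp
    then have t: "t + 10 \<le> 50 * (n + 1)" using * by simp
    let ?s = "s'\<lparr>mem := (mem s')(2 * Z + b := 0)\<rparr>"
    have "deg_at (\<lambda>i. if i = b then 0 else if i \<in> set xs then dg i - 1 else dg i) ?s"
      unfolding deg_at_def
    proof (intro allI impI)
      fix i assume i: "i < n"
      have "dg i < n" using s(2) i by (simp add: deg_at_def)
      then show "mem ?s (2 * Z + i) = (if i = b then 0 else if i \<in> set xs then dg i - 1 else dg i) \<and>
        (if i = b then 0 else if i \<in> set xs then dg i - 1 else dg i) < n"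
        using F[OF i] b(2) by auto
    qed
    moreover have "mem ?s c = mem s c" if "c < 2 * Z \<or> 3 * Z \<le> c" for c using that m b(2) nZ by auto
    moreover have "2 * Z + b \<le> W" "2 * Z \<le> W" "b \<le> W" using b(2) nZ W by auto
    moreover have "mem s' c = mem s c" if "c < 2 * Z" for c using m that by simp
    ultimately show "wp W (Store (Plus (Var 4) (Var 10)) (Const 0)) (\<lambda>t2 s'. t + t2 \<le> 50 * (n + 1) \<and> same {12} s' s \<and>
      (\<forall>a. a < 2 * Z \<or> 3 * Z \<le> a \<longrightarrow> mem s' a = mem s a) \<and>
      deg_at (\<lambda>i. if i = b then 0 else if i \<in> set xs then dg i - 1 else dg i) s') s'"
      using baseD[OF b'] v10 t sm by (simp add: wp_simps same_def)
  qed
qed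

end

section \<open>Invariant and amortized time of the peeling\<close>

locale peeling = ram +
  assumes sym: "x < n \<Longrightarrow> y < n \<Longrightarrow> adj x y \<longleftrightarrow> adj y x"
    and adj_refl: "x < n \<Longrightarrow> adj x x"
    and pack: "distinct xs \<Longrightarrow> set xs \<subseteq> {..<n} \<Longrightarrow> S \<subseteq> {..<length xs} \<Longrightarrow>
      (\<And>x y. x \<in> S \<Longrightarrow> y \<in> S \<Longrightarrow> x \<noteq> y \<Longrightarrow> length xs < dif (ladj xs) {..<length xs} x y * Q) \<Longrightarrow> card S < R"
begin

text \<open>Degree 0 marks peeled and isolated vertices alike; neither lies in a remaining clique of two vertices.\<close>
definition degs_ok :: "(nat \<Rightarrow> nat) \<Rightarrow> bool" where
  "degs_ok dg \<longleftrightarrow> (\<forall>i<n. dg i \<noteq> 0 \<longrightarrow> dg i = card {u. u < n \<and> u \<noteq> i \<and> adj i u \<and> dg u \<noteq> 0})"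

definition cliq :: "nat set \<Rightarrow> bool" where
  "cliq K \<longleftrightarrow> K \<subseteq> {..<n} \<and> 2 \<le> card K \<and> (\<forall>x\<in>K. \<forall>y\<in>K. adj x y)"

text \<open>Records the moment when the first vertex of \<open>K\<close> is peeled. \<open>S\<close>
  is the set of remaining vertices; its degrees will bound \<open>length xs\<close> through
  degeneracy. Neither hubs nor the clique number are mentioned, so the analysis of the program stays
  independent of them.\<close>

definition certified :: "nat set \<Rightarrow> nat \<Rightarrow> bool" where
  "certified K best \<longleftrightarrow> (\<exists>xs S. distinct xs \<and> K \<subseteq> set xs \<and> set xs \<subseteq> S \<and> S \<subseteq> {..<n} \<and>
     (\<forall>v\<in>S. length xs \<le> card {u \<in> S. adj v u}) \<and> netted xs best)"

lemma netted_mono: "netted xs b \<Longrightarrow> b \<le> b' \<Longrightarrow> netted xs b'"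
  unfolding netted_def using found_mono by blast

lemma certified_mono: "certified K b \<Longrightarrow> b \<le> b' \<Longrightarrow> certified K b'"
  unfolding certified_def using netted_mono by blast

definition closed_nbrs :: "(nat \<Rightarrow> nat) \<Rightarrow> nat \<Rightarrow> nat list" where
  "closed_nbrs dg b = filter (\<lambda>x. adj b x \<and> dg x \<noteq> 0) [0..<n]"

definition peel_deg :: "(nat \<Rightarrow> nat) \<Rightarrow> nat \<Rightarrow> nat \<Rightarrow> nat" where
  "peel_deg dg b i = (if i = b then 0 else if i \<in> set (closed_nbrs dg b) then dg i - 1 else dg i)"

lemma closed_nbrs:
  "set (closed_nbrs dg b) = {x. x < n \<and> adj b x \<and> dg x \<noteq> 0}" "distinct (closed_nbrs dg b)"
  by (auto simp: closed_nbrs_def)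

context
  fixes dg b
  assumes ok: "degs_ok dg" and b: "b < n" "dg b \<noteq> 0"
    and bmin: "\<forall>i<n. dg i \<noteq> 0 \<longrightarrow> dg b \<le> dg i"
begin

lemma peel_closed_degree:
  assumes "v < n" "dg v \<noteq> 0"
  shows "card {u. u < n \<and> adj v u \<and> dg u \<noteq> 0} = dg v + 1"
proof -
  have "{u. u < n \<and> adj v u \<and> dg u \<noteq> 0} = insert v {u. u < n \<and> u \<noteq> v \<and> adj v u \<and> dg u \<noteq> 0}"
    using assms adj_refl by auto
  then show ?thesis using ok assms by (simp add: degs_ok_def)
qed

lemma peel_length: "length (closed_nbrs dg b) = dg b + 1"
  using peel_closed_degree[OF b] closed_nbrs by (metis distinct_card)

text \<open>A neighbor of \<open>b\<close> that has another remaining neighbor has degree at least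
  2, so it is still positive after the decrement.\<close>

lemma peel_survive:
  assumes "i < n" "u < n" "i \<noteq> b" "u \<noteq> b" "i \<noteq> u" "adj u i" "dg i \<noteq> 0" "dg u \<noteq> 0"
  shows "peel_deg dg b u \<noteq> 0"
proof (cases "u \<in> set (closed_nbrs dg b)")
  case False
  then show ?thesis using assms by (simp add: peel_deg_def)
next
  case True
  then have "adj u b" using sym[of b u] assms b closed_nbrs by auto
  then have "{b, i} \<subseteq> {w. w < n \<and> w \<noteq> u \<and> adj u w \<and> dg w \<noteq> 0}" using assms b by auto
  then have "card {b, i} \<le> card {w. w < n \<and> w \<noteq> u \<and> adj u w \<and> dg w \<noteq> 0}" by (intro card_mono) auto
  then have "2 \<le> dg u" using ok assms by (simp add: degs_ok_def)
  then show ?thesis using assms True by (simp add: peel_deg_def)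
qed

lemma peel_deg_le: "peel_deg dg b u \<noteq> 0 \<Longrightarrow> dg u \<noteq> 0"
  by (auto simp: peel_deg_def split: if_splits)

text \<open>A vertex that drops to 0 together with \<open>b\<close> had no other remaining neighbor,
  so no further degree counts it and the stored degrees stay exact.\<close>

lemma peel_degs_ok: "degs_ok (peel_deg dg b)"
  unfolding degs_ok_def
proof (intro allI impI)
  fix i assume i: "i < n" "peel_deg dg b i \<noteq> 0"
  then have ib: "i \<noteq> b" "dg i \<noteq> 0" using peel_deg_le by (auto simp: peel_deg_def split: if_splits)
  let ?N = "{u. u < n \<and> u \<noteq> i \<and> adj i u \<and> dg u \<noteq> 0}"
  have "{u. u < n \<and> u \<noteq> i \<and> adj i u \<and> peel_deg dg b u \<noteq> 0} = ?N - {b}"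
  proof (intro equalityI subsetI)
    fix u assume "u \<in> {u. u < n \<and> u \<noteq> i \<and> adj i u \<and> peel_deg dg b u \<noteq> 0}"
    then show "u \<in> ?N - {b}" using peel_deg_le by (auto simp: peel_deg_def)
  next
    fix u assume u: "u \<in> ?N - {b}"
    then have "peel_deg dg b u \<noteq> 0" using peel_survive[of i u] sym[of i u] i ib by auto
    then show "u \<in> {u. u < n \<and> u \<noteq> i \<and> adj i u \<and> peel_deg dg b u \<noteq> 0}" using u by auto
  qed
  moreover have "card ?N = dg i" using ok i ib by (simp add: degs_ok_def)
  moreover have "b \<in> ?N \<longleftrightarrow> i \<in> set (closed_nbrs dg b)" using closed_nbrs i ib b sym[of i b] by auto
  ultimately show "peel_deg dg b i = card {u. u < n \<and> u \<noteq> i \<and> adj i u \<and> peel_deg dg b u \<noteq> 0}"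
    using ib by (simp add: peel_deg_def card_Diff_singleton_if)
qed

lemma peel_sum: "(\<Sum>i<n. peel_deg dg b i) + 2 * dg b = (\<Sum>i<n. dg i)"
proof -
  have "dg i = peel_deg dg b i + (if i = b then dg b else 0) + (if i \<in> set (closed_nbrs dg b) - {b} then 1 else 0)" for i
    using closed_nbrs by (auto simp: peel_deg_def)
  then have "(\<Sum>i<n. dg i) = (\<Sum>i<n. peel_deg dg b i + (if i = b then dg b else 0) + (if i \<in> set (closed_nbrs dg b) - {b} then 1 else 0))"
    by (rule sum.cong[OF refl])
  also have "\<dots> = (\<Sum>i<n. peel_deg dg b i) + dg b + card ({..<n} \<inter> (set (closed_nbrs dg b) - {b}))"
    using b by (simp add: sum.distrib sum.If_cases) (rule arg_cong[of _ _ card], auto)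
  also have "{..<n} \<inter> (set (closed_nbrs dg b) - {b}) = set (closed_nbrs dg b) - {b}" using closed_nbrs by auto
  also have "card (set (closed_nbrs dg b) - {b}) = dg b"
  proof -
    have "b \<in> set (closed_nbrs dg b)" using closed_nbrs b adj_refl by auto
    then show ?thesis using peel_length distinct_card[OF closed_nbrs(2)] by (simp add: card_Diff_singleton)
  qed
  finally show ?thesis by simp
qed

text \<open>As long as no vertex of \<open>K\<close> is peeled, its vertices keep each other's
  degrees positive; this takes at least two of them. When one is peeled, its closed neighborhood
  contains \<open>K\<close>, and by minimality all remaining vertices have at least as large a
  closed neighborhood.\<close>

lemma peel_clique:
  assumes K: "cliq K" "\<And>x. x \<in> K \<Longrightarrow> dg x \<noteq> 0" and best: "netted (closed_nbrs dg b) best"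
  shows "(\<forall>x\<in>K. peel_deg dg b x \<noteq> 0) \<or> certified K best"
proof (cases "b \<in> K")
  case True
  let ?S = "{u. u < n \<and> dg u \<noteq> 0}"
  have "K \<subseteq> set (closed_nbrs dg b)" using K True closed_nbrs by (auto simp: cliq_def)
  moreover have "length (closed_nbrs dg b) \<le> card {u \<in> ?S. adj v u}" if "v \<in> ?S" for v
  proof -
    have "{u \<in> ?S. adj v u} = {u. u < n \<and> adj v u \<and> dg u \<noteq> 0}" by auto
    then show ?thesis using that peel_closed_degree[of v] bmin peel_length by simp
  qed
  ultimately have "certified K best" unfolding certified_def using closed_nbrs best
    by (intro exI[of _ "closed_nbrs dg b"] exI[of _ ?S]) auto
  then show ?thesis by simp
next
  case False
  have "peel_deg dg b x \<noteq> 0" if x: "x \<in> K" for x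
  proof -
    have "K \<noteq> {x}" using K(1) by (auto simp: cliq_def)
    then obtain y where y: "y \<in> K" "y \<noteq> x" using x by blast
    have "x < n" "y < n" "adj x y" using K(1) x y by (auto simp: cliq_def)
    then show ?thesis using peel_survive[of y x] K(2) x y False by blast
  qed
  then show ?thesis by simp
qed

lemmas peel = peel_length peel_degs_ok peel_sum peel_clique
lemmas peel_facts = peel[unfolded peel_deg_def closed_nbrs_def]

end

definition time_const :: nat where
  "time_const = 2000 * ((R + 1) * (Q + 1))"

text \<open>Each clique is either fully present or certified. The loop ends with all degrees 0,
  where only the second alternative is left.\<close>

definition peel_inv :: "state \<Rightarrow> bool" where
  "peel_inv s \<longleftrightarrow> base s \<and> out_ok s \<and> var s 20 \<le> 1 \<and> (\<exists>dg. deg_at dg s \<and> degs_ok dg \<and>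
    (\<forall>K. cliq K \<longrightarrow> (\<forall>x\<in>K. dg x \<noteq> 0) \<or> certified K (var s 0)) \<and> (var s 20 = 0 \<longrightarrow> (\<forall>i<n. dg i = 0)))"

text \<open>Peeling a vertex of degree \<open>k\<close> takes time \<open>O(n * k)\<close> and lowers the sum of the degrees by \<open>2 * k\<close>.\<close>
definition peel_time :: "state \<Rightarrow> nat" where
  "peel_time s = time_const * n * ((\<Sum>i<n. mem s (2 * Z + i)) + var s 20) + 2"

lemma deg_sum: "deg_at dg s \<Longrightarrow> (\<Sum>i<n. mem s (2 * Z + i)) = (\<Sum>i<n. dg i)"
  by (simp add: deg_at_def)

text \<open>Here \<open>e + 1\<close> is the size of the closed neighborhood. Since
  \<open>e + 2\<close> is at most \<open>3 * e\<close> and at most \<open>3 * n\<close>, the net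
  costs 2970 and the linear scans cost 400 units of \<open>n * e\<close>, together less than the
  4000 available.\<close>

lemma peel_time_arith:
  assumes "1 \<le> e" "e \<le> n"
  shows "200 * (n + 1) + (R + 1) * ((Q + 1) * (330 * ((e + 1 + 1) * (e + 1 + 1)))) \<le> time_const * n * (2 * e)"
proof -
  define M where "M = (R + 1) * (Q + 1)"
  have "(e + 1 + 1) * (e + 1 + 1) \<le> (3 * n) * (3 * e)" using assms by (intro mult_le_mono) auto
  then have "M * (330 * ((e + 1 + 1) * (e + 1 + 1))) \<le> M * (330 * ((3 * n) * (3 * e)))"
    by (intro mult_le_mono2)
  also have "\<dots> = 2970 * (M * (n * e))" by (simp add: mult_ac)
  finally have 1: "M * (330 * ((e + 1 + 1) * (e + 1 + 1))) \<le> 2970 * (M * (n * e))" .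
  have "n * 1 \<le> n * e" using assms by (intro mult_le_mono2) simp
  then have "200 * (n + 1) \<le> 400 * (n * e)"
  proof -
    have "200 * (n + 1) = 200 * n + 200" by simp
    then show ?thesis using n \<open>n * 1 \<le> n * e\<close> by linarith
  qed
  also have "n * e \<le> M * (n * e)" by (simp add: M_def)
  finally have 2: "200 * (n + 1) \<le> 400 * (M * (n * e))" by simp
  have "time_const = 2000 * M" by (simp only: time_const_def M_def)
  then have "time_const * n * (2 * e) = 4000 * (M * (n * e))" by simp
  moreover have "(R + 1) * ((Q + 1) * (330 * ((e + 1 + 1) * (e + 1 + 1)))) = M * (330 * ((e + 1 + 1) * (e + 1 + 1)))"
    by (simp only: M_def mult.assoc)
  ultimately show ?thesis using 1 2 by linarith
qed

lemma peel_prog: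
  assumes I: "peel_inv s" and v20: "var s 20 \<noteq> 0"
  shows "wp W peel_prog (\<lambda>t s'. peel_inv s' \<and> cost (Var 20) + 1 + t + peel_time s' \<le> peel_time s) s"
proof -
  have v1: "var s 20 = 1" using I v20 by (simp add: peel_inv_def)
  obtain dg where s: "base s" "out_ok s" "deg_at dg s" and ok: "degs_ok dg"
    and cl: "\<And>K. cliq K \<Longrightarrow> (\<forall>x\<in>K. dg x \<noteq> 0) \<or> certified K (var s 0)"
    using I unfolding peel_inv_def by blast
  have nW: "n \<le> W" "1 \<le> W" using nZ W n by auto
  show ?thesis unfolding peel_prog_def wp_Seq[of W scan_prog]
  proof (rule wp_mono[OF scan_prog[OF s(1,3)]])
    fix t1 s1 assume *: "t1 \<le> 40 * (n + 1) \<and> same {10,12,19} s1 s \<and> mem s1 = mem s \<and>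
      ((\<forall>i<n. dg i = 0) \<and> var s1 19 = n \<or>
       var s1 10 < n \<and> dg (var s1 10) \<noteq> 0 \<and> var s1 19 = dg (var s1 10) \<and>
         (\<forall>i<n. dg i \<noteq> 0 \<longrightarrow> dg (var s1 10) \<le> dg i))"
    then have t1: "t1 \<le> 40 * (n + 1)" and sm1: "same {10,12,19} s1 s" and m1: "mem s1 = mem s" by auto
    have b1: "base s1" by (rule base_frame[OF s(1) sm1]) (use m1 in auto)
    have o1: "out_ok s1" by (rule out_ok_frame[OF s(2) sm1]) (use m1 in auto)
    have d1: "deg_at dg s1" by (rule deg_at_frame[OF s(3)]) (use m1 in auto)
    have v1': "var s1 20 = 1" "var s1 0 = var s 0" using sameD[OF sm1] v1 by auto
    have v2: "var s1 2 = n" using baseD[OF b1] by simp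
    consider "\<forall>i<n. dg i = 0" "var s1 19 = n" | "var s1 10 < n" "dg (var s1 10) \<noteq> 0" "var s1 19 = dg (var s1 10)"
      "\<forall>i<n. dg i \<noteq> 0 \<longrightarrow> dg (var s1 10) \<le> dg i" using * by blast
    then show "wp W (If (Minus (Var 2) (Var 19)) (Seq build_prog (Seq net_prog dec_prog)) (Assign 20 (Const 0)))
      (\<lambda>t2 s'. peel_inv s' \<and> cost (Var 20) + 1 + (t1 + t2) + peel_time s' \<le> peel_time s) s1"
    proof cases
      case 1
      define s2 where "s2 = s1\<lparr>var := (var s1)(20 := 0)\<rparr>"
      have sm2: "same {20} s2 s1" by (simp add: s2_def same_def)
      have "base s2" by (rule base_frame[OF b1 sm2]) (auto simp: s2_def)
      moreover have "out_ok s2" by (rule out_ok_frame[OF o1 sm2]) (auto simp: s2_def)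
      moreover have d2: "deg_at dg s2" using d1 by (simp add: deg_at_def s2_def)
      moreover have "var s2 20 = 0" "var s2 0 = var s 0" using v1' by (auto simp: s2_def)
      ultimately have inv: "peel_inv s2" unfolding peel_inv_def using ok cl 1(1)
        by (intro conjI exI[of _ dg]) simp_all
      \<comment> \<open>The last scan finds nothing to peel; it is paid for by register 20, whose
        change from 1 to 0 lowers the potential by \<open>time_const * n\<close>.\<close>
      have gen: "t1 + 10 + p' \<le> p" if "p = x + y + 2" "p' = x + 2" "200 * n \<le> y" for p p' x y
      proof -
        have "40 * (n + 1) = 40 * n + 40" by simp
        then show ?thesis using that t1 n by linarith
      qed
      have "t1 + 10 + peel_time s2 \<le> peel_time s"
      proof (rule gen)
        show "peel_time s = time_const * n * (\<Sum>i<n. dg i) + time_const * n + 2"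
          unfolding peel_time_def deg_sum[OF s(3)] v1 by (simp only: distrib_left mult_1_right)
        show "peel_time s2 = time_const * n * (\<Sum>i<n. dg i) + 2"
          unfolding peel_time_def deg_sum[OF d2] by (simp add: s2_def)
        show "200 * n \<le> time_const * n" by (intro mult_le_mono1) (simp add: time_const_def)
      qed
      then have post: "peel_inv s2 \<and> cost (Var 20) + 1 + (t1 + (cost (Minus (Var 2) (Var 19)) + 1 + (cost (Const 0) + 1))) +
        peel_time s2 \<le> peel_time s" using inv by simp
      have ev: "\<not> eval (Minus (Var 2) (Var 19)) s1 \<noteq> 0" and ft: "fits W (Minus (Var 2) (Var 19)) s1"
        using 1(2) v2 nW by simp_all
      have e2: "s1\<lparr>var := (var s1)(20 := eval (Const 0) s1)\<rparr> = s2" by (simp add: s2_def)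
      have "fits W (Const 0) s1" by simp
      then show ?thesis unfolding wp_If if_not_P[OF ev] wp_Assign e2 using ft post by blast
    next
      case 2
      define b where "b = var s1 10"
      have b: "b < n" "dg b \<noteq> 0" "\<forall>i<n. dg i \<noteq> 0 \<longrightarrow> dg b \<le> dg i" using 2 by (auto simp: b_def)
      define xs where "xs = filter (\<lambda>x. adj b x \<and> dg x \<noteq> 0) [0..<n]"
      define dg' where "dg' i = (if i = b then 0 else if i \<in> set xs then dg i - 1 else dg i)" for i
      note pf = peel_facts[OF ok b, folded xs_def]
      have dxs: "distinct xs" "set xs \<subseteq> {..<n}" by (auto simp: xs_def)
      have ebn: "1 \<le> dg b" "dg b < n" using b s(3) by (auto simp: deg_at_def)
      have "wp W (Seq build_prog (Seq net_prog dec_prog))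
        (\<lambda>t2 s'. peel_inv s' \<and> t1 + t2 + 10 + peel_time s' \<le> peel_time s) s1" unfolding wp_Seq
      proof (rule wp_mono[OF build_prog[OF b1 d1 b_def[symmetric] b(1,2) adj_refl[OF b(1)], folded xs_def]])
        fix t2 s2 assume *: "t2 \<le> 50 * (n + 1) \<and> same {9,12} s2 s1 \<and>
          (\<forall>a. a < 3 * Z \<or> 4 * Z \<le> a \<longrightarrow> mem s2 a = mem s1 a) \<and> list_at xs s2"
        then have t2: "t2 \<le> 50 * (n + 1)" and sm2: "same {9,12} s2 s1"
          and m2: "\<And>a. a < 3 * Z \<or> 4 * Z \<le> a \<Longrightarrow> mem s2 a = mem s1 a" and l2: "list_at xs s2" by auto
        have b2: "base s2" by (rule base_frame[OF b1 sm2]) (use m2 in auto)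
        have o2: "out_ok s2" by (rule out_ok_frame[OF o1 sm2]) (use m2 in auto)
        have d2: "deg_at dg s2" by (rule deg_at_frame[OF d1]) (use m2 in auto)
        show "wp W net_prog (\<lambda>t. wp W dec_prog (\<lambda>t' s'. peel_inv s' \<and>
          t1 + (t2 + (t + t')) + 10 + peel_time s' \<le> peel_time s)) s2"
        proof (rule wp_mono[OF net_prog[OF b2 l2 o2 dxs(1) pack[OF dxs]]])
          fix t3 s3 assume *: "t3 \<le> (R + 1) * ((Q + 1) * (330 * ((length xs + 1) * (length xs + 1)))) \<and>
            same {0,1,11,12,13,14,15,16,17,18,25} s3 s2 \<and> (\<forall>a. a < 4 * Z \<longrightarrow> mem s3 a = mem s2 a) \<and> out_ok s3 \<and>
            var s2 0 \<le> var s3 0 \<and> netted xs (var s3 0)"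
          then have t3: "t3 \<le> (R + 1) * ((Q + 1) * (330 * ((length xs + 1) * (length xs + 1))))"
            and sm3: "same {0,1,11,12,13,14,15,16,17,18,25} s3 s2"
            and m3: "\<And>a. a < 4 * Z \<Longrightarrow> mem s3 a = mem s2 a" and o3: "out_ok s3"
            and v3: "var s2 0 \<le> var s3 0" and net: "netted xs (var s3 0)" by auto
          have b3: "base s3" by (rule base_frame[OF b2 sm3]) (use m3 in auto)
          have d3: "deg_at dg s3" by (rule deg_at_frame[OF d2]) (use m3 in auto)
          have l3: "list_at xs s3" by (rule list_at_frame[OF l2 sm3]) (use m3 in auto)
          have v10: "var s3 10 = b" using sameD[OF sm3] sameD[OF sm2] b_def by simp
          show "wp W dec_prog (\<lambda>t' s'. peel_inv s' \<and> t1 + (t2 + (t3 + t')) + 10 + peel_time s' \<le> peel_time s) s3"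
          proof (rule wp_mono[OF dec_prog[OF b3 d3 l3 v10 b(1) dxs(1)]])
            fix t4 s4 assume *: "t4 \<le> 50 * (n + 1) \<and> same {12} s4 s3 \<and>
              (\<forall>a. a < 2 * Z \<or> 3 * Z \<le> a \<longrightarrow> mem s4 a = mem s3 a) \<and>
              deg_at (\<lambda>i. if i = b then 0 else if i \<in> set xs then dg i - 1 else dg i) s4"
            then have t4: "t4 \<le> 50 * (n + 1)" and sm4: "same {12} s4 s3"
              and m4: "\<And>a. a < 2 * Z \<or> 3 * Z \<le> a \<Longrightarrow> mem s4 a = mem s3 a"
              and d4: "deg_at dg' s4" by (auto simp: dg'_def[abs_def])
            have b4: "base s4" by (rule base_frame[OF b3 sm4]) (use m4 in auto)
            have o4: "out_ok s4" by (rule out_ok_frame[OF o3 sm4]) (use m4 in auto)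
            have v20: "var s4 20 = 1" using sameD[OF sm4] sameD[OF sm3] sameD[OF sm2] v1' by simp
            have v0: "var s4 0 = var s3 0" using sameD[OF sm4] by simp
            have mono: "var s 0 \<le> var s4 0" using v0 v3 sameD[OF sm2] v1' by simp
            have "(\<forall>x\<in>K. dg' x \<noteq> 0) \<or> certified K (var s4 0)" if K: "cliq K" for K
              using cl[OF K]
            proof
              assume "\<forall>x\<in>K. dg x \<noteq> 0"
              then show ?thesis using pf(4)[OF K _ net] unfolding dg'_def v0 by simp
            next
              assume "certified K (var s 0)"
              then show ?thesis using certified_mono[OF _ mono] by simp
            qed
            moreover have "degs_ok dg'" using pf(2) unfolding dg'_def .
            ultimately have inv: "peel_inv s4" unfolding peel_inv_def using b4 o4 v20 d4
              by (intro conjI exI[of _ dg']) simp_all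
            have sum: "(\<Sum>i<n. dg' i) + 2 * dg b = (\<Sum>i<n. dg i)" using pf(3) unfolding dg'_def .
            have "peel_time s = peel_time s4 + time_const * n * (2 * dg b)"
              unfolding peel_time_def deg_sum[OF s(3)] deg_sum[OF d4] v20 v1
              by (simp only: sum[symmetric]) (simp add: algebra_simps)
            moreover have "t1 + t2 + t3 + t4 + 10 \<le> time_const * n * (2 * dg b)"
            proof -
              have arith: "t1 + t2 + t3 + t4 + 10 \<le> X"
                if "200 * N + Y \<le> X" "t1 \<le> 40 * N" "t2 \<le> 50 * N" "t3 \<le> Y" "t4 \<le> 50 * N" "1 \<le> N" for N X Y
                using that by linarith
              have "200 * (n + 1) + (R + 1) * ((Q + 1) * (330 * ((dg b + 1 + 1) * (dg b + 1 + 1))))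
                \<le> time_const * n * (2 * dg b)" using ebn by (intro peel_time_arith) auto
              from arith[OF this t1 t2 t3[unfolded pf(1)] t4] show ?thesis using le_add2 by blast
            qed
            ultimately have "t1 + (t2 + (t3 + t4)) + 10 + peel_time s4 \<le> peel_time s"
            proof -
              have "t1 + (t2 + (t3 + t4)) + 10 + p' \<le> p" if "p = p' + X" "t1 + t2 + t3 + t4 + 10 \<le> X" for p p' X
                using that by simp
              then show "peel_time s = peel_time s4 + time_const * n * (2 * dg b) \<Longrightarrow>
                t1 + t2 + t3 + t4 + 10 \<le> time_const * n * (2 * dg b) \<Longrightarrow> ?thesis" .
            qed
            with inv show "peel_inv s4 \<and> t1 + (t2 + (t3 + t4)) + 10 + peel_time s4 \<le> peel_time s" by (rule conjI)
          qed
        qed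
      qed
      note rest = this
      have v19: "var s1 19 < n" using 2(3) ebn(2) unfolding b_def by simp
      then have ft: "fits W (Minus (Var 2) (Var 19)) s1" using v2 nW(1) by simp
      have ev: "eval (Minus (Var 2) (Var 19)) s1 \<noteq> 0" using v2 v19 by simp
      show ?thesis unfolding wp_If if_P[OF ev]
      proof (rule conjI[OF ft], rule wp_mono[OF rest])
        fix t s' assume *: "peel_inv s' \<and> t1 + t + 10 + peel_time s' \<le> peel_time s"
        have "cost (Var 20) + 1 + (t1 + (cost (Minus (Var 2) (Var 19)) + 1 + t)) = t1 + t + 6" by simp
        then show "peel_inv s' \<and> cost (Var 20) + 1 + (t1 + (cost (Minus (Var 2) (Var 19)) + 1 + t)) + peel_time s'
          \<le> peel_time s" using * by linarith
      qed
    qed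
  qed
qed

text \<open>By \<open>pos\<close> every clique of at least two vertices starts with nonzero degrees,
  so the invariant holds at the beginning without any certificate.\<close>

lemma peel_loop:
  assumes s: "base s" "out_ok s" "deg_at dg s" "var s 20 = 1" and ok: "degs_ok dg"
    and pos: "\<And>i j. i < n \<Longrightarrow> j < n \<Longrightarrow> i \<noteq> j \<Longrightarrow> adj i j \<Longrightarrow> dg i \<noteq> 0"
  shows "wp W (While (Var 20) peel_prog) (\<lambda>t s'. t \<le> time_const * n * ((\<Sum>i<n. dg i) + 1) + 2 \<and>
    out_ok s' \<and> (\<forall>K. cliq K \<longrightarrow> certified K (var s' 0))) s"
proof -
  have W1: "1 \<le> W" using nZ W n by auto
  have "dg x \<noteq> 0" if K: "cliq K" and x: "x \<in> K" for K x
  proof -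
    have "K \<noteq> {x}" using K by (auto simp: cliq_def)
    then obtain y where "y \<in> K" "y \<noteq> x" using x by blast
    then show ?thesis using pos[of x y] K x by (auto simp: cliq_def)
  qed
  then have inv: "peel_inv s" unfolding peel_inv_def using s ok by (intro conjI exI[of _ dg]) auto
  have "wp W (While (Var 20) peel_prog) (\<lambda>t s'. t \<le> peel_time s \<and> peel_inv s' \<and> eval (Var 20) s' = 0) s"
  proof (rule wp_While[where I = peel_inv and B = peel_time, OF inv])
    show "fits W (Var 20) s" if "peel_inv s" for s using that W1 by (auto simp: peel_inv_def)
    show "cost (Var 20) + 1 \<le> peel_time s" for s by (simp add: peel_time_def)
    show "wp W peel_prog (\<lambda>t s'. peel_inv s' \<and> cost (Var 20) + 1 + t + peel_time s' \<le> peel_time s) s"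
      if "peel_inv s" "eval (Var 20) s \<noteq> 0" for s using peel_prog[OF that(1)] that(2) by simp
  qed
  then show ?thesis
  proof (rule wp_mono)
    fix t s' assume *: "t \<le> peel_time s \<and> peel_inv s' \<and> eval (Var 20) s' = 0"
    then have "peel_inv s'" "var s' 20 = 0" by simp_all
    then obtain dg' :: "nat \<Rightarrow> nat" where 1: "\<forall>K. cliq K \<longrightarrow> (\<forall>x\<in>K. dg' x \<noteq> 0) \<or> certified K (var s' 0)" "\<forall>i<n. dg' i = 0"
      unfolding peel_inv_def by blast
    have "certified K (var s' 0)" if K: "cliq K" for K
    proof -
      obtain x where "x \<in> K" "x < n" using K unfolding cliq_def
        by (metis card.empty ex_in_conv lessThan_iff not_numeral_le_zero subsetD)
      then show ?thesis using 1 K by blast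
    qed
    moreover have "peel_time s = time_const * n * ((\<Sum>i<n. dg i) + 1) + 2"
      using s(4) deg_sum[OF s(3)] by (simp add: peel_time_def)
    ultimately show "t \<le> time_const * n * ((\<Sum>i<n. dg i) + 1) + 2 \<and> out_ok s' \<and> (\<forall>K. cliq K \<longrightarrow> certified K (var s' 0))"
      using * by (simp add: peel_inv_def)
  qed
qed

end

section \<open>Reading the input\<close>

definition fill_prog :: com where
  "fill_prog = For 12 2
    (Seq (Store (Plus (Plus (Var 3) (Times (Var 12) (Var 2))) (Var 12)) (Const 1))
    (Seq (Assign 22 (Minus (Mem (Plus (Var 12) (Const 3))) (Mem (Plus (Var 12) (Const 2)))))
    (Seq (Store (Plus (Var 4) (Var 12)) (Var 22))
    (For 13 22 (Store (Plus (Plus (Var 3) (Times (Var 12) (Var 2)))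
      (Mem (Plus (Mem (Plus (Var 12) (Const 2))) (Var 13)))) (Const 1))))))"

definition setup_prog :: "nat \<Rightarrow> nat \<Rightarrow> com" where
  "setup_prog Q R =
    Seq (Assign 3 (Plus (Plus (Times (Var 2) (Var 2)) (Var 2)) (Const 3)))
    (Seq (Assign 4 (Plus (Var 3) (Var 3)))
    (Seq (Assign 5 (Plus (Var 4) (Var 3)))
    (Seq (Assign 6 (Plus (Var 5) (Var 3)))
    (Seq (Assign 7 (Plus (Var 6) (Var 3)))
    (Seq (Assign 8 (Plus (Var 7) (Var 3)))
    (Seq (Assign 23 (Const R))
    (Seq (Assign 24 (Const Q))
    (Seq (Assign 0 (Const 1))
    (Seq (Assign 1 (Var 8))
    (Assign 20 (Const 1)))))))))))"

text \<open>The last pointer minus the first is the total length of the lists. If it is 0, the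
  program stops in constant time, and the output is the single vertex 0 prepared by
  \<open>setup_prog\<close>.\<close>

definition clique_prog :: "nat \<Rightarrow> nat \<Rightarrow> com" where
  "clique_prog Q R = Seq (Assign 2 (Mem (Const 0))) (If (Var 2)
    (Seq (setup_prog Q R) (If (Minus (Mem (Plus (Var 2) (Const 2))) (Mem (Const 2)))
      (Seq fill_prog (While (Var 20) peel_prog)) Skip)) Skip)"

lemma wp_Seq_Assign: "wp W (Seq (Assign i e) c) P s \<longleftrightarrow>
    fits W e s \<and> wp W c (\<lambda>t. P (cost e + 1 + t)) (s\<lparr>var := (var s)(i := eval e s)\<rparr>)"
  by (simp add: wp_Seq wp_Assign)

locale graph_memory = peeling +
  fixes nbrs :: "nat list list"
  assumes len: "length nbrs = n"
    and nbrs: "\<And>i. i < n \<Longrightarrow> distinct (nbrs ! i) \<and> set (nbrs ! i) \<subseteq> {..<n} - {i}"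
    and adj_nbrs: "\<And>i j. i < n \<Longrightarrow> j < n \<Longrightarrow> adj i j \<longleftrightarrow> i = j \<or> j \<in> set (nbrs ! i)"
begin

definition ptr :: "nat \<Rightarrow> nat" where
  "ptr i = n + 3 + length (concat (take i nbrs))"

lemma ptr_Suc: "i < n \<Longrightarrow> ptr (Suc i) = ptr i + length (nbrs ! i)"
  by (simp add: ptr_def take_Suc_conv_app_nth len)

lemma ptr_mono: "i \<le> j \<Longrightarrow> ptr i \<le> ptr j"
proof -
  assume "i \<le> j"
  then have "take i nbrs @ drop i (take j nbrs) = take j nbrs" by (metis append_take_drop_id min.absorb1 take_take)
  then have "length (concat (take j nbrs)) = length (concat (take i nbrs)) + length (concat (drop i (take j nbrs)))"
    by (metis concat_append length_append)
  then show ?thesis by (simp add: ptr_def)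
qed

lemma length_nbrs: "i < n \<Longrightarrow> length (nbrs ! i) < n"
proof -
  assume i: "i < n"
  have "card (set (nbrs ! i)) \<le> card ({..<n} - {i})" using nbrs[OF i] by (intro card_mono) auto
  then show ?thesis using nbrs[OF i] i by (simp add: distinct_card)
qed

lemma ptr_le: "i \<le> n \<Longrightarrow> ptr i \<le> n + 3 + i * n"
proof (induction i)
  case 0
  then show ?case by (simp add: ptr_def)
next
  case (Suc i)
  then show ?case using ptr_Suc[of i] length_nbrs[of i] by simp
qed

lemma ptr_Z: "i \<le> n \<Longrightarrow> ptr i \<le> Z"
proof -
  assume i: "i \<le> n"
  then have "i * n \<le> n * n" by simp
  then show ?thesis using ptr_le[OF i] Z by linarith
qed

lemma nth_concat_nbrs:
  "i < n \<Longrightarrow> j < length (nbrs ! i) \<Longrightarrow> concat nbrs ! (length (concat (take i nbrs)) + j) = nbrs ! i ! j"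
proof -
  assume i: "i < n" and j: "j < length (nbrs ! i)"
  have "nbrs = take i nbrs @ nbrs ! i # drop (Suc i) nbrs" using i len by (simp add: id_take_nth_drop)
  then have "concat nbrs = concat (take i nbrs) @ nbrs ! i @ concat (drop (Suc i) nbrs)"
    by (metis concat.simps(2) concat_append)
  then show ?thesis using j by (simp add: nth_append)
qed

definition stored :: "(nat \<Rightarrow> nat) \<Rightarrow> bool" where
  "stored m \<longleftrightarrow> m 0 = n \<and> (\<forall>i\<le>n. m (2 + i) = ptr i) \<and>
     (\<forall>i<n. \<forall>j<length (nbrs ! i). m (ptr i + j) = nbrs ! i ! j)"

lemma length_graph_input: "length (graph_input nbrs) = ptr n"
  by (simp add: graph_input_def ptr_def len)

lemma initial_stored:
  "stored (mem (initial_state (graph_input nbrs)))" "Z \<le> a \<Longrightarrow> mem (initial_state (graph_input nbrs)) a = 0"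
proof -
  have L: "graph_input nbrs ! (2 + i) = ptr i" "2 + i < ptr n" if "i \<le> n" for i
  proof -
    show "2 + i < ptr n" using that by (simp add: ptr_def)
    have "i < length [0..<n + 1]" using that by simp
    then show "graph_input nbrs ! (2 + i) = ptr i"
      unfolding graph_input_def len by (simp add: nth_append ptr_def del: upt_Suc)
  qed
  have M: "graph_input nbrs ! (ptr i + j) = nbrs ! i ! j" "ptr i + j < ptr n"
    if i: "i < n" and j: "j < length (nbrs ! i)" for i j
  proof -
    have "ptr i + j < ptr (Suc i)" using ptr_Suc[OF i] j by simp
    also have "\<dots> \<le> ptr n" using i by (intro ptr_mono) simp
    finally show "ptr i + j < ptr n" .
    have "graph_input nbrs ! (ptr i + j) = concat nbrs ! (length (concat (take i nbrs)) + j)"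
      unfolding graph_input_def len by (simp add: nth_append ptr_def nth_Cons' del: upt_Suc)
    then show "graph_input nbrs ! (ptr i + j) = nbrs ! i ! j" using nth_concat_nbrs[OF i j] by simp
  qed
  show "stored (mem (initial_state (graph_input nbrs)))" unfolding stored_def
    using L M by (auto simp: initial_state_def length_graph_input)
      (simp_all add: graph_input_def len ptr_def)
  show "Z \<le> a \<Longrightarrow> mem (initial_state (graph_input nbrs)) a = 0"
    using ptr_Z[of n] by (simp add: initial_state_def length_graph_input)
qed

lemma stored_frame:
  assumes "stored m" "\<And>a. a < Z \<Longrightarrow> m' a = m a"
  shows "stored m'"
proof -
  have "m' 0 = n" using assms Z by (simp add: stored_def)
  moreover have "m' (2 + i) = ptr i" if "i \<le> n" for i
    using assms that Z by (simp add: stored_def)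
  moreover have "m' (ptr i + j) = nbrs ! i ! j" if "i < n" "j < length (nbrs ! i)" for i j
  proof -
    have "ptr i + j < ptr (Suc i)" using ptr_Suc that by simp
    also have "\<dots> \<le> Z" using that by (intro ptr_Z) simp
    finally show ?thesis using assms that by (simp add: stored_def)
  qed
  ultimately show ?thesis by (simp add: stored_def)
qed

text \<open>The part of \<open>base\<close> that holds before the matrix is filled.\<close>

definition regs :: "state \<Rightarrow> bool" where
  "regs s \<longleftrightarrow> var s 2 = n \<and> var s 3 = Z \<and> var s 4 = 2 * Z \<and> var s 5 = 3 * Z \<and> var s 6 = 4 * Z \<and>
     var s 7 = 5 * Z \<and> var s 8 = 6 * Z \<and> var s 23 = R \<and> var s 24 = Q"

definition row_prog :: com where
  "row_prog = For 13 22 (Store (Plus (Plus (Var 3) (Times (Var 12) (Var 2)))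
      (Mem (Plus (Mem (Plus (Var 12) (Const 2))) (Var 13)))) (Const 1))"

lemma row_prog:
  assumes s: "var s 2 = n" "var s 3 = Z" "var s 12 = x" "var s 22 = length (nbrs ! x)" "stored (mem s)" and x: "x < n"
  shows "wp W row_prog (\<lambda>t s'. t \<le> (length (nbrs ! x) + 1) * 30 \<and> same {13} s' s \<and>
    (\<forall>a. mem s' a = (if a \<in> (\<lambda>y. Z + x * n + y) ` set (nbrs ! x) then 1 else mem s a))) s"
proof -
  define N where "N = length (nbrs ! x)"
  define I where "I j s' \<longleftrightarrow> same {13} s' s \<and> var s' 13 = j \<and> j \<le> N \<and>
    (\<forall>a. mem s' a = (if a \<in> (\<lambda>y. Z + x * n + y) ` set (take j (nbrs ! x)) then 1 else mem s a))" for j s'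
  have nW: "n \<le> W" "1 \<le> W" using nZ W n by auto
  have NW: "N \<le> W" using length_nbrs[OF x] nW by (simp add: N_def)
  have "wp W row_prog (\<lambda>t s'. t \<le> (N + 1) * (20 + 8) \<and> I N s') s" unfolding row_prog_def
  proof (rule wp_For)
    show "N \<le> W" "1 \<le> W" using NW nW by auto
    show "I 0 (s\<lparr>var := (var s)(13 := 0)\<rparr>)" by (simp add: I_def same_def)
    show "var s' 13 = j \<and> var s' 22 = N" if "I j s'" for j s'
      using that s(4) sameD[of "{13}" s' s 22] by (simp add: I_def N_def)
    fix j s' assume j: "j < N" and I: "I j s'"
    have sm: "same {13} s' s" and v: "var s' 13 = j"
      and m: "\<And>a. mem s' a = (if a \<in> (\<lambda>y. Z + x * n + y) ` set (take j (nbrs ! x)) then 1 else mem s a)"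
      using I by (auto simp: I_def)
    \<comment> \<open>All writes go to addresses from \<open>Z\<close> on, so the input is still
      intact while it is read.\<close>
    have st: "stored (mem s')" by (rule stored_frame[OF s(5)]) (auto simp: m)
    define y where "y = nbrs ! x ! j"
    have "y \<in> set (nbrs ! x)" using j by (simp add: y_def N_def)
    then have y: "y < n" using nbrs[OF x] by auto
    have c: "x * n + y < n * n" by (rule cell[OF x y])
    have p: "mem s' (x + 2) = ptr x" using st x by (simp add: stored_def add.commute)
    have q: "mem s' (ptr x + j) = y" using st x j by (simp add: stored_def y_def N_def)
    have "ptr x + j < ptr (Suc x)" using ptr_Suc[OF x] j by (simp add: N_def)
    also have "\<dots> \<le> Z" using x by (intro ptr_Z) simp
    finally have pj: "ptr x + j < Z" .
    have v': "var s' 2 = n" "var s' 3 = Z" "var s' 12 = x" using sameD[OF sm] s by simp_all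
    have f: "Z + x * n + y \<le> W" "Z + x * n \<le> W" "x * n \<le> W" "ptr x + j \<le> W" "ptr x \<le> W" "y \<le> W" "x + 2 \<le> W" "2 \<le> W" "j \<le> W" "x \<le> W" "Z \<le> W"
      using c nZ W pj y x Z by auto
    have tk: "set (take (Suc j) (nbrs ! x)) = insert y (set (take j (nbrs ! x)))"
      using j by (simp add: take_Suc_conv_app_nth y_def N_def)
    have 1: "((mem s')(Z + x * n + y := 1)) a =
        (if a \<in> (\<lambda>y. Z + x * n + y) ` set (take (Suc j) (nbrs ! x)) then 1 else mem s a)" for a
      unfolding tk by (auto simp: m)
    have e: "eval (Plus (Plus (Var 3) (Times (Var 12) (Var 2))) (Mem (Plus (Mem (Plus (Var 12) (Const 2))) (Var 13)))) s'
      = Z + x * n + y" using v v' p q by simp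
    have ft: "fits W (Plus (Plus (Var 3) (Times (Var 12) (Var 2))) (Mem (Plus (Mem (Plus (Var 12) (Const 2))) (Var 13)))) s'"
      using v v' p q f nW by simp
    show "wp W (Store (Plus (Plus (Var 3) (Times (Var 12) (Var 2)))
        (Mem (Plus (Mem (Plus (Var 12) (Const 2))) (Var 13)))) (Const 1))
      (\<lambda>t s'. t \<le> 20 \<and> var s' 13 = j \<and> I (Suc j) (s'\<lparr>var := (var s')(13 := Suc j)\<rparr>)) s'"
      unfolding wp_Store e
    proof (intro conjI ft)
      show "fits W (Const 1) s'" using nW by simp
      show "I (Suc j) (s'\<lparr>mem := (mem s')(Z + x * n + y := eval (Const 1) s'),
          var := (var (s'\<lparr>mem := (mem s')(Z + x * n + y := eval (Const 1) s')\<rparr>))(13 := Suc j)\<rparr>)"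
        using 1 j sm unfolding I_def by (simp add: same_def)
    qed (use v in auto)
  qed
  then show ?thesis
  proof (rule wp_mono)
    fix t s' assume *: "t \<le> (N + 1) * (20 + 8) \<and> I N s'"
    have "(N + 1) * (20 + 8) \<le> (N + 1) * 30" by (intro mult_le_mono2) simp
    then have "t \<le> (N + 1) * 30" using * by linarith
    then show "t \<le> (length (nbrs ! x) + 1) * 30 \<and> same {13} s' s \<and>
      (\<forall>a. mem s' a = (if a \<in> (\<lambda>y. Z + x * n + y) ` set (nbrs ! x) then 1 else mem s a))"
      using * by (simp add: I_def N_def)
  qed
qed

lemma cell_inj: "x < n \<Longrightarrow> y < n \<Longrightarrow> x' < n \<Longrightarrow> y' < n \<Longrightarrow> x * n + y = x' * n + y' \<Longrightarrow> x = x' \<and> y = y'"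
  by (metis add.commute div_mult_self1 mod_mult_self1 div_less mod_less add_0 not_less_zero)

text \<open>Zero entries of the matrix are never written, as the memory there is zero from the
  start; this avoids quadratic time. The rows have different lengths, so the times are summed
  individually and give the total length of the lists.\<close>

lemma fill_prog:
  assumes s: "regs s" "stored (mem s)" "\<And>a. Z \<le> a \<Longrightarrow> mem s a = 0"
  shows "wp W fill_prog (\<lambda>t s'. t \<le> 100 * (n + length (concat nbrs) + 1) \<and> same {12,13,22} s' s \<and> base s' \<and>
    deg_at (\<lambda>i. length (nbrs ! i)) s' \<and> (\<forall>a\<ge>3 * Z. mem s' a = 0)) s"
proof -
  define I where "I j s' \<longleftrightarrow> same {12,13,22} s' s \<and> var s' 12 = j \<and> j \<le> n \<and>
    (\<forall>a<Z. mem s' a = mem s a) \<and> (\<forall>a\<ge>3 * Z. mem s' a = 0) \<and>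
    (\<forall>x<n. \<forall>y<n. mem s' (Z + x * n + y) = of_bool (x < j \<and> adj x y)) \<and>
    (\<forall>i<j. mem s' (2 * Z + i) = length (nbrs ! i))" for j s'
  define body where "body = (Seq (Store (Plus (Plus (Var 3) (Times (Var 12) (Var 2))) (Var 12)) (Const 1))
    (Seq (Assign 22 (Minus (Mem (Plus (Var 12) (Const 3))) (Mem (Plus (Var 12) (Const 2)))))
    (Seq (Store (Plus (Var 4) (Var 12)) (Var 22)) row_prog)))"
  have nW: "n \<le> W" "1 \<le> W" "3 \<le> W" using nZ W n Z by auto
  have r: "var s 2 = n" "var s 3 = Z" "var s 4 = 2 * Z" using s(1) by (auto simp: regs_def)
  have body: "wp W body (\<lambda>t s'. t \<le> (length (nbrs ! j) + 1) * 30 + 30 \<and> var s' 12 = j \<and>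
      I (Suc j) (s'\<lparr>var := (var s')(12 := Suc j)\<rparr>)) s'" if j: "j < n" and I: "I j s'" for j s'
  proof -
    have sm: "same {12,13,22} s' s" and v: "var s' 12 = j" and low: "\<And>a. a < Z \<Longrightarrow> mem s' a = mem s a"
      and high: "\<And>a. 3 * Z \<le> a \<Longrightarrow> mem s' a = 0"
      and A: "\<And>x y. x < n \<Longrightarrow> y < n \<Longrightarrow> mem s' (Z + x * n + y) = of_bool (x < j \<and> adj x y)"
      and D: "\<And>i. i < j \<Longrightarrow> mem s' (2 * Z + i) = length (nbrs ! i)" using I by (auto simp: I_def)
    have v': "var s' 2 = n" "var s' 3 = Z" "var s' 4 = 2 * Z" using sameD[OF sm] r by simp_all
    have st: "stored (mem s')" by (rule stored_frame[OF s(2) low])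
    let ?a = "Z + j * n + j"
    have a: "j * n + j < n * n" by (rule cell[OF j j])
    have aW: "?a \<le> W" "j * n \<le> W" "Z + j * n \<le> W" "2 * Z + j \<le> W" "j \<le> W" "j + 3 \<le> W" "j + 2 \<le> W" "Z \<le> W" "2 * Z \<le> W"
      using a nZ W j Z by auto
    have p: "ptr j \<le> W" "ptr (Suc j) \<le> W" using ptr_Z[of j] ptr_Z[of "Suc j"] j W by auto
    have m2: "mem s' (j + 2) = ptr j" using st j by (simp add: stored_def add.commute)
    have "mem s' (2 + Suc j) = ptr (Suc j)" using st j unfolding stored_def by (meson Suc_leI)
    then have m3: "mem s' (j + 3) = ptr (Suc j)" by (simp add: numeral_eq_Suc)
    have ne: "j + 2 \<noteq> ?a" "j + 3 \<noteq> ?a" using Z j by auto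
    define l where "l = length (nbrs ! j)"
    have l: "ptr (Suc j) - ptr j = l" "l \<le> W" using ptr_Suc[OF j] length_nbrs[OF j] nW by (auto simp: l_def)
    define s2 where "s2 = s'\<lparr>mem := (mem s')(?a := 1, 2 * Z + j := l), var := (var s')(22 := l)\<rparr>"
    have st2: "stored (mem s2)" by (rule stored_frame[OF st]) (auto simp: s2_def)
    have "wp W row_prog (\<lambda>t s'. t \<le> (l + 1) * 30 \<and> var s' 12 = j \<and>
      I (Suc j) (s'\<lparr>var := (var s')(12 := Suc j)\<rparr>)) s2"
    proof (rule wp_mono[OF row_prog[OF _ _ _ _ st2 j]])
      show "var s2 2 = n" "var s2 3 = Z" "var s2 12 = j" "var s2 22 = length (nbrs ! j)"
        using v v' by (simp_all add: s2_def l_def)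
      fix t s3 assume *: "t \<le> (length (nbrs ! j) + 1) * 30 \<and> same {13} s3 s2 \<and>
        (\<forall>a. mem s3 a = (if a \<in> (\<lambda>y. Z + j * n + y) ` set (nbrs ! j) then 1 else mem s2 a))"
      then have sm3: "same {13} s3 s2"
        and m3: "\<And>a. mem s3 a = (if a \<in> (\<lambda>y. Z + j * n + y) ` set (nbrs ! j) then 1 else mem s2 a)" by auto
      have rowcell: "y < n" "j * n + y < n * n" if "y \<in> set (nbrs ! j)" for y
      proof -
        show y: "y < n" using that nbrs[OF j] by auto
        show "j * n + y < n * n" by (rule cell[OF j y])
      qed
      have outside: "mem s3 a = mem s2 a" if "a < Z \<or> 2 * Z \<le> a" for a
        using that rowcell nZ unfolding m3 by fastforce
      have "same {12,13,22} s3 s"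
      proof (rule same_trans[OF sm3])
        show "same {12,13,22} s2 s" using sm by (auto simp: same_def s2_def)
      qed auto
      then have "same {12,13,22} (s3\<lparr>var := (var s3)(12 := Suc j)\<rparr>) s" by (simp add: same_def)
      moreover have "var s3 12 = j" using sameD[OF sm3] v by (simp add: s2_def)
      moreover have "mem s3 b = mem s b" if "b < Z" for b
        using outside[of b] that low[of b] by (simp add: s2_def)
      moreover have "mem s3 b = 0" if "3 * Z \<le> b" for b
        using outside[of b] that high[of b] j a nZ by (simp add: s2_def)
      moreover have "mem s3 (2 * Z + i) = length (nbrs ! i)" if "i < Suc j" for i
        using outside[of "2 * Z + i"] that D[of i] a nZ by (auto simp: s2_def l_def less_Suc_eq)
      moreover have "mem s3 (Z + x * n + y) = of_bool (x < Suc j \<and> adj x y)" if xy: "x < n" "y < n" for x y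
      proof -
        have c: "x * n + y < n * n" by (rule cell[OF xy])
        have 1: "Z + x * n + y \<in> (\<lambda>y. Z + j * n + y) ` set (nbrs ! j) \<longleftrightarrow> x = j \<and> y \<in> set (nbrs ! j)"
        proof
          assume "Z + x * n + y \<in> (\<lambda>y. Z + j * n + y) ` set (nbrs ! j)"
          then obtain y' where "y' \<in> set (nbrs ! j)" "x * n + y = j * n + y'" by auto
          then show "x = j \<and> y \<in> set (nbrs ! j)" using cell_inj[OF xy j rowcell(1)] by blast
        qed auto
        have 2: "Z + x * n + y = ?a \<longleftrightarrow> x = j \<and> y = j" using cell_inj[OF xy j j] by auto
        have 3: "Z + x * n + y \<noteq> 2 * Z + j" using c nZ by auto
        have "mem s2 (Z + x * n + y) = (if x = j \<and> y = j then 1 else of_bool (x < j \<and> adj x y))"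
          using 2 3 A[OF xy] by (simp add: s2_def)
        then show ?thesis unfolding m3 1 using adj_nbrs[OF xy] by (auto simp: less_Suc_eq)
      qed
      ultimately show "t \<le> (l + 1) * 30 \<and> var s3 12 = j \<and> I (Suc j) (s3\<lparr>var := (var s3)(12 := Suc j)\<rparr>)"
        unfolding I_def using * j by (simp add: l_def)
    qed
    note row = this
    have e: "s'\<lparr>var := (var s')(22 := l), mem := (mem s')(Z + j * n + j := Suc 0, 2 * Z + j := l)\<rparr> = s2"
      by (simp add: s2_def)
    show ?thesis unfolding body_def
      using v v' aW nW m2 m3 ne p l
      by (simp add: wp_simps e) (rule wp_mono[OF row], simp add: l_def)
  qed
  have fp: "fill_prog = For 12 2 body" by (simp add: fill_prog_def body_def row_prog_def)
  have "wp W fill_prog (\<lambda>t s'. t \<le> (\<Sum>j<n. (length (nbrs ! j) + 1) * 30 + 30 + 8) + 8 \<and> I n s') s"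
    unfolding fp
  proof (rule wp_For_sum)
    show "n \<le> W" "1 \<le> W" using nW by auto
    have "mem s (Z + x * n + y) = 0" for x y using s(3) by simp
    then show "I 0 (s\<lparr>var := (var s)(12 := 0)\<rparr>)" using s(3) by (simp add: I_def same_def)
    show "var s' 12 = j \<and> var s' 2 = n" if "I j s'" for j s'
      using that r sameD[of "{12,13,22}" s' s 2] by (simp add: I_def)
  qed (rule body)
  then show ?thesis
  proof (rule wp_mono)
    fix t s' assume *: "t \<le> (\<Sum>j<n. (length (nbrs ! j) + 1) * 30 + 30 + 8) + 8 \<and> I n s'"
    have "(\<Sum>j<n. length (nbrs ! j)) = length (concat nbrs)"
      by (simp add: length_concat sum_list_sum_nth len lessThan_atLeast0)
    moreover have "(\<Sum>j<n. (length (nbrs ! j) + 1) * 30 + 30 + 8) = 30 * (\<Sum>j<n. length (nbrs ! j)) + 68 * n"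
      by (simp add: sum.distrib sum_distrib_left algebra_simps)
    ultimately have "t \<le> 100 * (n + length (concat nbrs) + 1)" using * by simp
    moreover have sm: "same {12,13,22} s' s" using * by (simp add: I_def)
    moreover have "base s'" unfolding base_def using * s(1) sameD[OF sm] by (simp add: I_def regs_def)
    moreover have "deg_at (\<lambda>i. length (nbrs ! i)) s'" using * length_nbrs by (simp add: deg_at_def I_def)
    ultimately show "t \<le> 100 * (n + length (concat nbrs) + 1) \<and> same {12,13,22} s' s \<and> base s' \<and>
      deg_at (\<lambda>i. length (nbrs ! i)) s' \<and> (\<forall>a\<ge>3 * Z. mem s' a = 0)" using * by (simp add: I_def)
  qed
qed

lemma degs_ok_nbrs: "degs_ok (\<lambda>i. length (nbrs ! i))"
  unfolding degs_ok_def
proof (intro allI impI)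
  fix i assume i: "i < n"
  have "{u. u < n \<and> u \<noteq> i \<and> adj i u \<and> length (nbrs ! u) \<noteq> 0} = set (nbrs ! i)"
  proof (intro equalityI subsetI)
    fix u assume "u \<in> {u. u < n \<and> u \<noteq> i \<and> adj i u \<and> length (nbrs ! u) \<noteq> 0}"
    then show "u \<in> set (nbrs ! i)" using adj_nbrs[OF i] by auto
  next
    fix u assume u: "u \<in> set (nbrs ! i)"
    then have "u < n" "u \<noteq> i" "adj i u" using nbrs[OF i] adj_nbrs[OF i] by auto
    moreover then have "i \<in> set (nbrs ! u)" using sym[OF i] adj_nbrs[of u i] i by auto
    ultimately show "u \<in> {u. u < n \<and> u \<noteq> i \<and> adj i u \<and> length (nbrs ! u) \<noteq> 0}" by auto
  qed
  then show "length (nbrs ! i) = card {u. u < n \<and> u \<noteq> i \<and> adj i u \<and> length (nbrs ! u) \<noteq> 0}"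
    using nbrs[OF i] by (simp add: distinct_card)
qed

theorem clique_prog:
  "wp W (clique_prog Q R) (\<lambda>t s'. t \<le> 200 + (if concat nbrs = [] then 0 else
      100 * (n + length (concat nbrs) + 1) + time_const * n * (length (concat nbrs) + 1)) \<and>
    out_ok s' \<and> (\<forall>K. cliq K \<longrightarrow> certified K (var s' 0))) (initial_state (graph_input nbrs))"
proof -
  define s0 where "s0 = initial_state (graph_input nbrs)"
  have st0: "stored (mem s0)" and z0: "\<And>a. Z \<le> a \<Longrightarrow> mem s0 a = 0"
    using initial_stored by (auto simp: s0_def)
  have nW: "n \<le> W" "1 \<le> W" "3 \<le> W" "n * n \<le> W" "n * n + n \<le> W" using nZ W n Z by auto
  define s1 where "s1 = s0\<lparr>var := (var s0)(2 := n, 3 := Z, 4 := 2 * Z, 5 := 3 * Z, 6 := 4 * Z, 7 := 5 * Z, 8 := 6 * Z,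
    23 := R, 24 := Q, 0 := 1, 1 := 6 * Z, 20 := 1)\<rparr>"
  have m1: "mem s1 = mem s0" by (simp add: s1_def)
  have regs: "regs s1" by (simp add: regs_def s1_def)
  \<comment> \<open>The untouched cell at \<open>6 * Z\<close> contains 0 and thus already
    represents the clique that consists of vertex 0.\<close>
  have o1: "out_ok s1" unfolding out_ok_def
    using n z0[of "6 * Z"] adj_refl[of 0] by (intro exI[of _ "[0]"]) (auto simp: s1_def)
  have p0: "mem s1 2 = ptr 0" "mem s1 (n + 2) = ptr n"
  proof -
    have "\<forall>i\<le>n. mem s1 (2 + i) = ptr i" using st0 unfolding m1 stored_def by blast
    from this[rule_format, of 0] this[rule_format, of n] show "mem s1 2 = ptr 0" "mem s1 (n + 2) = ptr n"
      by (simp_all only: le0 order_refl add_0_right add.commute[of n 2])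
  qed
  have pn: "ptr n - ptr 0 = length (concat nbrs)" by (simp add: ptr_def len)
  have pW: "ptr 0 \<le> W" "ptr n \<le> W" "n + 2 \<le> W" "2 \<le> W" using ptr_Z[of 0] ptr_Z[of n] W Z by auto
  define rest where "rest = If (Minus (Mem (Plus (Var 2) (Const 2))) (Mem (Const 2)))
      (Seq fill_prog (While (Var 20) peel_prog)) Skip"
  define T where "T = (if concat nbrs = [] then 0 else
      100 * (n + length (concat nbrs) + 1) + time_const * n * (length (concat nbrs) + 1))"
  have v1: "var s1 2 = n" by (simp add: s1_def)
  have ft: "fits W (Minus (Mem (Plus (Var 2) (Const 2))) (Mem (Const 2))) s1" using v1 p0 pW nW by simp
  have ev: "eval (Minus (Mem (Plus (Var 2) (Const 2))) (Mem (Const 2))) s1 = length (concat nbrs)"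
    using v1 p0 pn by simp
  have "wp W rest (\<lambda>t s'. t \<le> 20 + T \<and> out_ok s' \<and> (\<forall>K. cliq K \<longrightarrow> certified K (var s' 0))) s1"
  proof (cases "concat nbrs = []")
    case True
    have nocliq: "\<not> cliq K" for K
    proof
      assume K: "cliq K"
      then obtain x where x: "x \<in> K" unfolding cliq_def by fastforce
      have "K \<noteq> {x}" using K by (auto simp: cliq_def)
      then obtain y where y: "y \<in> K" "y \<noteq> x" using x by blast
      have "x < n" "y < n" "adj x y" using K x y by (auto simp: cliq_def)
      then have "y \<in> set (nbrs ! x)" using adj_nbrs[of x y] y by auto
      moreover have "nbrs ! x \<in> set nbrs" using \<open>x < n\<close> len by simp
      ultimately show False using True by auto
    qed
    have e0: "eval (Minus (Mem (Plus (Var 2) (Const 2))) (Mem (Const 2))) s1 = 0" using ev True by simp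
    show ?thesis unfolding rest_def wp_If wp_Skip using ft e0 o1 nocliq by simp
  next
    case False
    have b: "wp W fill_prog (\<lambda>t1. wp W (While (Var 20) peel_prog)
      (\<lambda>t s'. t1 + t + 10 \<le> 20 + T \<and> out_ok s' \<and> (\<forall>K. cliq K \<longrightarrow> certified K (var s' 0)))) s1"
    proof (rule wp_mono[OF fill_prog[OF regs]])
      show "stored (mem s1)" using st0 m1 by simp
      show "mem s1 a = 0" if "Z \<le> a" for a using z0 that m1 by simp
      fix t1 s2 assume *: "t1 \<le> 100 * (n + length (concat nbrs) + 1) \<and> same {12,13,22} s2 s1 \<and> base s2 \<and>
        deg_at (\<lambda>i. length (nbrs ! i)) s2 \<and> (\<forall>a\<ge>3 * Z. mem s2 a = 0)"
      then have sm: "same {12,13,22} s2 s1" by simp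
      have o2: "out_ok s2" by (rule out_ok_frame[OF o1 sm]) (use * z0 in \<open>auto simp: m1\<close>)
      have v20: "var s2 20 = 1" using sameD[OF sm] by (simp add: s1_def)
      have pos: "length (nbrs ! i) \<noteq> 0" if "i < n" "j < n" "i \<noteq> j" "adj i j" for i j
        using adj_nbrs[OF that(1,2)] that by auto
      have sum: "(\<Sum>j<n. length (nbrs ! j)) = length (concat nbrs)"
        by (simp add: length_concat sum_list_sum_nth len lessThan_atLeast0)
      show "wp W (While (Var 20) peel_prog)
        (\<lambda>t s'. t1 + t + 10 \<le> 20 + T \<and> out_ok s' \<and> (\<forall>K. cliq K \<longrightarrow> certified K (var s' 0))) s2"
      proof (rule wp_mono[OF peel_loop[OF _ o2 _ v20 degs_ok_nbrs]])
        show "base s2" "deg_at (\<lambda>i. length (nbrs ! i)) s2" using * by auto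
        show "length (nbrs ! i) \<noteq> 0" if "i < n" "j < n" "i \<noteq> j" "adj i j" for i j using pos that by blast
        fix t s' assume "t \<le> time_const * n * ((\<Sum>i<n. length (nbrs ! i)) + 1) + 2 \<and> out_ok s' \<and>
          (\<forall>K. cliq K \<longrightarrow> certified K (var s' 0))"
        moreover have "t1 + t + 10 \<le> 20 + (x + y)" if "t1 \<le> x" "t \<le> y + 2" for x y
          using that by simp
        ultimately show "t1 + t + 10 \<le> 20 + T \<and> out_ok s' \<and> (\<forall>K. cliq K \<longrightarrow> certified K (var s' 0))"
          using * unfolding sum T_def if_not_P[OF False] by blast
      qed
    qed
    have "eval (Minus (Mem (Plus (Var 2) (Const 2))) (Mem (Const 2))) s1 \<noteq> 0" using ev False by simp
    then show ?thesis unfolding rest_def wp_If wp_Seq using ft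
      by (simp del: eval.simps fits.simps) (rule wp_mono[OF b], erule wp_mono, simp)
  qed
  note rest = this
  have Zs: "n * n + n + 3 = Z" "Z + Z = 2 * Z" "2 * Z + Z = 3 * Z" "3 * Z + Z = 4 * Z" "4 * Z + Z = 5 * Z" "5 * Z + Z = 6 * Z"
    using Z by auto
  have ZW: "Z \<le> W" "2 * Z \<le> W" "3 * Z \<le> W" "4 * Z \<le> W" "5 * Z \<le> W" "6 * Z \<le> W" "Suc 0 \<le> W" "0 \<le> W"
    "Q \<le> W" "R \<le> W" using W nW by auto
  define s2 where "s2 = s0\<lparr>var := (var s0)(2 := n)\<rparr>"
  have init: "wp W (setup_prog Q R) (\<lambda>t s'. t \<le> 50 \<and> s' = s1) s2"
    unfolding setup_prog_def
    using nW ZW by (simp add: wp_Seq_Assign wp_Assign s2_def Zs s1_def)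
  have m0: "mem s0 0 = n" using st0 by (simp add: stored_def)
  have "wp W (Seq (setup_prog Q R) rest) (\<lambda>t s'. t + 20 \<le> 200 + T \<and> out_ok s' \<and>
      (\<forall>K. cliq K \<longrightarrow> certified K (var s' 0))) s2"
    unfolding wp_Seq by (rule wp_mono[OF init], elim conjE, hypsubst, rule wp_mono[OF rest]) simp
  then show ?thesis unfolding clique_prog_def rest_def[symmetric] s0_def[symmetric] T_def[symmetric] wp_Seq[of W "Assign _ _"]
    wp_Assign wp_If[of W "Var 2"]
    using m0 nW n by (simp add: s2_def) (erule wp_mono, simp)
qed

end

section \<open>Powers of graphs as hub graphs\<close>

lemma finite_edges: "simple_graph G \<Longrightarrow> finite (edges G)"
  unfolding simple_graph_def by (metis (no_types, lifting) Collect_mono_iff Pow_def finite_Pow_iff finite_subset)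

lemma gdist_sym_le: "gdist G u v \<le> enat d \<longleftrightarrow> gdist G v u \<le> enat d"
  unfolding gdist_le_iff by (metis length_rev walk_rev)

lemma hub_labelling_inv_image:
  assumes "hub_labelling V c d lab adj" "g ` V' \<subseteq> V"
  shows "hub_labelling V' c d (\<lambda>i. lab (g i)) (\<lambda>i j. adj (g i) (g j))"
proof -
  have g: "g x \<in> V" if "x \<in> V'" for x using assms(2) that by blast
  note hub = assms(1)[unfolded hub_labelling_def]
  have 1: "\<forall>x\<in>V. finite (lab x) \<and> card (lab x) \<le> c \<and> snd ` lab x \<subseteq> {..d}" by (rule conjunct1[OF hub])
  have 2: "\<forall>x\<in>V. \<forall>y\<in>V. adj x y \<longleftrightarrow> (\<exists>w i j. (w, i) \<in> lab x \<and> (w, j) \<in> lab y \<and> i + j \<le> d)"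
    by (rule conjunct2[OF hub])
  show ?thesis unfolding hub_labelling_def
    by (intro conjI ballI) (use bspec[OF 1 g] bspec[OF bspec[OF 2 g] g] in simp_all)
qed

lemma hub_labelling_mono: "hub_labelling V c d lab adj \<Longrightarrow> c \<le> c' \<Longrightarrow> hub_labelling V c' d lab adj"
  unfolding hub_labelling_def by (elim conjE, rule conjI, rule ballI, drule (1) bspec, simp, assumption)

text \<open>Each edge is listed once from either end; the bit \<open>i < j\<close> tells the two
  entries apart.\<close>

lemma length_concat_adj_le:
  assumes H: "simple_graph H" and adj: "adj_lists H f adj"
  shows "length (concat adj) \<le> 2 * card (edges H)"
proof -
  let ?n = "length adj"
  define P where "P = (SIGMA i:{..<?n}. set (adj ! i))"
  have inj: "inj_on f {..<?n}" using adj by (auto simp: adj_lists_def bij_betw_def)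
  have d: "distinct (adj ! i)" and s: "set (adj ! i) = {j. j < ?n \<and> {f i, f j} \<in> edges H}" if "i < ?n" for i
    using adj that by (auto simp: adj_lists_def)
  have "card P = (\<Sum>i<?n. card (set (adj ! i)))" unfolding P_def by (intro card_SigmaI) auto
  also have "\<dots> = (\<Sum>i<?n. length (adj ! i))" using d by (intro sum.cong) (auto simp: distinct_card)
  also have "\<dots> = length (concat adj)" by (simp add: length_concat sum_list_sum_nth lessThan_atLeast0)
  finally have P: "card P = length (concat adj)" .
  let ?g = "\<lambda>(i, j). ({f i, f j}, i < j)"
  have "inj_on ?g P"
  proof (rule inj_onI)
    fix p q assume pq: "p \<in> P" "q \<in> P" "?g p = ?g q"
    obtain i j i' j' where p: "p = (i, j)" "q = (i', j')" by (cases p; cases q)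
    have lt: "i < ?n" "j < ?n" "i' < ?n" "j' < ?n" using pq p s by (auto simp: P_def)
    have "{f i, f j} = {f i', f j'}" and o: "i < j \<longleftrightarrow> i' < j'" using pq(3) p by auto
    then have "f i = f i' \<and> f j = f j' \<or> f i = f j' \<and> f j = f i'" by (auto simp: doubleton_eq_iff)
    then have "i = i' \<and> j = j' \<or> i = j' \<and> j = i'"
      using inj lt by (metis inj_on_eq_iff lessThan_iff)
    moreover have "i \<noteq> j"
    proof
      assume "i = j"
      then have "{f i} \<in> edges H" using pq(1) p s[OF lt(1)] by (auto simp: P_def)
      then show False using H by (auto simp: simple_graph_def)
    qed
    ultimately show "p = q" using o p by auto
  qed
  moreover have "?g ` P \<subseteq> edges H \<times> UNIV" using s by (auto simp: P_def)
  moreover have "finite (edges H \<times> (UNIV :: bool set))" using finite_edges[OF H] by simp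
  ultimately have "card P \<le> card (edges H \<times> (UNIV :: bool set))" by (rule card_inj_on_le)
  then show ?thesis using P by (simp add: card_cartesian_product)
qed

text \<open>The base is at least 2, so \<open>x \<le> (n + 2) ^ x\<close> moves the constants
  \<open>Q\<close> and \<open>R\<close> into the exponent. The factor 8 takes exponent 3 and the
  block size takes exponent 2.\<close>

lemma power_bounds:
  assumes "b = Q + R + 6"
  shows "8 * (n * n + n + 3) \<le> (n + 2) ^ b" "Q * (n + 1) \<le> (n + 2) ^ b" "R \<le> (n + 2) ^ b" "(Q::nat) \<le> (n + 2) ^ b"
proof -
  have p: "x \<le> (n + 2) ^ x" for x :: nat
    using power_mono[of 2 "n + 2" x] less_exp[of x] by simp
  have up: "(n + 2) ^ e \<le> (n + 2) ^ b" if "e \<le> b" for e using that by (intro power_increasing) auto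
  have "(8::nat) = 2 ^ 3" by simp
  also have "\<dots> \<le> (n + 2) ^ 3" by (intro power_mono) auto
  finally have "8 * (n * n + n + 3) \<le> (n + 2) ^ 3 * (n + 2) ^ 2"
    by (intro mult_le_mono) (auto simp: power2_eq_square algebra_simps)
  also have "\<dots> = (n + 2) ^ 5" by (simp flip: power_add)
  also have "\<dots> \<le> (n + 2) ^ b" by (rule up) (simp add: assms)
  finally show "8 * (n * n + n + 3) \<le> (n + 2) ^ b" .
  have "Q * (n + 1) \<le> (n + 2) ^ Q * (n + 2) ^ 1" using p[of Q] by (intro mult_le_mono) auto
  also have "\<dots> = (n + 2) ^ (Q + 1)" by (simp only: power_add)
  finally show "Q * (n + 1) \<le> (n + 2) ^ b" using up[of "Q + 1"] assms by simp
  show "R \<le> (n + 2) ^ b" by (rule order_trans[OF p up]) (simp add: assms)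
  show "Q \<le> (n + 2) ^ b" by (rule order_trans[OF p up]) (simp add: assms)
qed

lemma finite_cliques: "finite (verts H) \<Longrightarrow> finite {K. clique H K}"
  by (rule finite_subset[of _ "Pow (verts H)"]) (auto simp: clique_def)

lemma card_clique_le: "finite (verts H) \<Longrightarrow> clique H K \<Longrightarrow> card K \<le> clique_number H"
  unfolding clique_number_def using finite_cliques by (intro Max_ge) auto

lemma maximum_clique:
  assumes "finite (verts H)"
  obtains K where "clique H K" "card K = clique_number H"
proof -
  have "{} \<in> {K. clique H K}" by (simp add: clique_def)
  then have "clique_number H \<in> card ` {K. clique H K}"
    unfolding clique_number_def using finite_cliques[OF assms] by (intro Max_in) auto
  then show thesis using that by auto
qed

lemma clique_prog_empty:
  assumes "W \<ge> 1"
  shows "wp W (clique_prog Q R) (\<lambda>t s. t \<le> 10 \<and> output_set s = {}) (initial_state (graph_input []))"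
  by (simp add: clique_prog_def wp_simps initial_state_def graph_input_def output_set_def)

lemma (in ram) output_set_out_ok:
  assumes "out_ok s"
  obtains zs where "output_set s = set zs" "length zs = var s 0" "distinct zs" "zs \<noteq> []" "set zs \<subseteq> {..<n}"
    "\<And>x y. x \<in> set zs \<Longrightarrow> y \<in> set zs \<Longrightarrow> adj x y"
proof -
  obtain zs where zs: "length zs = var s 0" "zs \<noteq> []" "distinct zs" "set zs \<subseteq> {..<n}"
    "\<forall>x\<in>set zs. \<forall>y\<in>set zs. adj x y" "\<forall>i<length zs. mem s (var s 1 + i) = zs ! i"
    using assms unfolding out_ok_def by blast
  have "output_set s = (\<lambda>i. mem s (var s 1 + i)) ` {..<var s 0}"
  proof -
    have "{var s 1..<var s 1 + var s 0} = (\<lambda>i. var s 1 + i) ` {..<var s 0}"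
      by (simp add: lessThan_atLeast0 image_add_atLeastLessThan add.commute)
    then show ?thesis by (simp add: output_set_def image_image)
  qed
  also have "\<dots> = (\<lambda>i. zs ! i) ` {..<length zs}" using zs(1,6) by (intro image_cong) auto
  also have "\<dots> = set zs" by (auto simp: set_conv_nth)
  finally have "output_set s = set zs" .
  then show thesis using that zs by blast
qed

section \<open>The constants and the approximation ratio\<close>

definition clique_scale :: "nat \<Rightarrow> nat \<Rightarrow> nat" where
  "clique_scale d c = scale c d (2 * c) (2 * c * (2 * c))"

text \<open>One more than the packing bound, because separated sets have to be strictly smaller than
  the number of rounds.\<close>

definition net_bound :: "nat \<Rightarrow> nat \<Rightarrow> nat" where
  "net_bound d c = type_bound c d (2 * c * clique_scale d c) + 1"

text \<open>The second \<open>2 * c\<close> is the value of \<open>\<kappa>\<close>: a closed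
  neighborhood of minimum degree has at most \<open>2 * c\<close> times as many vertices as a
  maximum clique.\<close>

definition clique_ratio :: "nat \<Rightarrow> nat \<Rightarrow> nat" where
  "clique_ratio d c = 2 * (2 * c) * type_bound c d (clique_scale d c)"

locale power_input =
  fixes G H :: "'a ugraph" and d c :: nat and lab :: "'a \<Rightarrow> ('a \<times> nat) set" and f :: "nat \<Rightarrow> 'a"
    and adj :: "nat list list"
  assumes G: "simple_graph G" and ind: "induced_subgraph H (graph_power G d)"
    and hubs: "hub_labelling (verts G) c d lab (\<lambda>x y. gdist G x y \<le> enat d)" and c: "c > 0"
    and adj: "adj_lists H f adj" and ne: "adj \<noteq> []"
begin

abbreviation "n \<equiv> length adj"

text \<open>Reflexive, unlike the adjacency of \<open>H\<close>; this agrees with the diagonal of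
  the matrix and with the distance condition of the labelling.\<close>

definition near_adj :: "nat \<Rightarrow> nat \<Rightarrow> bool" where
  "near_adj i j \<longleftrightarrow> gdist G (f i) (f j) \<le> enat d"

lemma bij: "bij_betw f {..<n} (verts H)"
  using adj by (simp add: adj_lists_def)

lemma inj: "inj_on f {..<n}"
  using bij by (simp add: bij_betw_def)

lemma vertsH: "verts H \<subseteq> verts G" "finite (verts H)"
  using ind G by (auto simp: induced_subgraph_def graph_power_def simple_graph_def intro: finite_subset)

lemma f_verts: "i < n \<Longrightarrow> f i \<in> verts H"
  using bij by (auto simp: bij_betw_def)

lemma edge_iff: "u \<in> verts H \<Longrightarrow> v \<in> verts H \<Longrightarrow> {u, v} \<in> edges H \<longleftrightarrow> u \<noteq> v \<and> gdist G u v \<le> enat d"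
proof -
  assume uv: "u \<in> verts H" "v \<in> verts H"
  then have "{u, v} \<in> edges H \<longleftrightarrow> {u, v} \<in> edges (graph_power G d)"
    using ind by (auto simp: induced_subgraph_def)
  also have "\<dots> \<longleftrightarrow> u \<noteq> v \<and> gdist G u v \<le> enat d"
    using uv vertsH gdist_sym_le[of G u v d] by (auto simp: graph_power_def doubleton_eq_iff)
  finally show ?thesis .
qed

lemma simpleH: "simple_graph H"
proof -
  have "e \<subseteq> verts H \<and> card e = 2" if e: "e \<in> edges H" for e
  proof -
    have "e \<subseteq> verts H" "e \<in> edges (graph_power G d)" using e ind by (auto simp: induced_subgraph_def)
    then show ?thesis by (auto simp: graph_power_def)
  qed
  then show ?thesis using vertsH by (auto simp: simple_graph_def)
qed

lemma near_adj_refl: "i < n \<Longrightarrow> near_adj i i"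
  unfolding near_adj_def gdist_le_iff using f_verts vertsH
  by (intro exI[of _ "[f i]"]) (auto intro: walk_single)

lemma near_adj_sym: "near_adj i j \<longleftrightarrow> near_adj j i"
  unfolding near_adj_def by (rule gdist_sym_le)

lemma edge_near_adj: "i < n \<Longrightarrow> j < n \<Longrightarrow> {f i, f j} \<in> edges H \<longleftrightarrow> i \<noteq> j \<and> near_adj i j"
  using edge_iff[of "f i" "f j"] f_verts inj_on_eq_iff[OF inj, of i j] by (auto simp: near_adj_def)

lemma clique_image:
  assumes "A \<subseteq> {..<n}" "\<And>x y. x \<in> A \<Longrightarrow> y \<in> A \<Longrightarrow> near_adj x y"
  shows "clique H (f ` A)" "card (f ` A) = card A"
proof -
  show "clique H (f ` A)" unfolding clique_def
  proof (intro conjI ballI impI)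
    show "f ` A \<subseteq> verts H" using assms(1) f_verts by auto
    fix u v assume uv: "u \<in> f ` A" "v \<in> f ` A" "u \<noteq> v"
    then obtain x y where xy: "x \<in> A" "y \<in> A" "u = f x" "v = f y" by blast
    then have "x < n" "y < n" "x \<noteq> y" using assms(1) uv(3) by auto
    then show "{u, v} \<in> edges H" using edge_near_adj[of x y] assms(2)[OF xy(1,2)] xy(3,4) by simp
  qed
  show "card (f ` A) = card A" using inj assms(1) by (intro card_image) (rule inj_on_subset)
qed

lemma hub_graph_index: "hub_graph {..<n} c d (\<lambda>i. lab (f i)) near_adj"
  unfolding hub_graph_def near_adj_def
  by (rule hub_labelling_inv_image[OF hubs]) (use f_verts vertsH in auto)

lemma hub_subset_list:
  assumes "set xs \<subseteq> {..<n}" "xs \<noteq> []"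
  shows "hub_subset {..<length xs} c d (\<lambda>i. lab (f (xs ! i))) (\<lambda>i j. near_adj (xs ! i) (xs ! j)) {..<length xs}"
proof
  show "hub_labelling {..<length xs} c d (\<lambda>i. lab (f (xs ! i))) (\<lambda>i j. near_adj (xs ! i) (xs ! j))"
    unfolding near_adj_def
  proof (rule hub_labelling_inv_image[OF hubs])
    have "f (xs ! i) \<in> verts G" if "i < length xs" for i
    proof -
      have "xs ! i < n" using assms(1) nth_mem[OF that] by auto
      then show ?thesis using f_verts vertsH(1) by blast
    qed
    then show "(\<lambda>i. f (xs ! i)) ` {..<length xs} \<subseteq> verts G" by auto
  qed
qed (use assms in auto)

abbreviation "\<kappa> \<equiv> 2 * c"
abbreviation "Q \<equiv> clique_scale d c"
abbreviation "R \<equiv> net_bound d c"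
abbreviation "ratio \<equiv> clique_ratio d c"

lemma graph_memory:
  assumes "W = (n + 2) ^ (Q + R + 6)"
  shows "graph_memory W n (n * n + n + 3) Q R near_adj adj"
proof unfold_locales
  show "1 \<le> n" using ne by (simp add: Suc_le_eq)
  show "n * n + n + 3 = n * n + n + 3" ..
  show "8 * (n * n + n + 3) \<le> W" "Q * (n + 1) \<le> W" "R \<le> W" "Q \<le> W"
    unfolding assms by (rule power_bounds[OF refl])+
  show "near_adj x y \<longleftrightarrow> near_adj y x" for x y by (rule near_adj_sym)
  show "near_adj x x" if "x < n" for x using near_adj_refl that .
  show "card S < R" if xs: "distinct xs" "set xs \<subseteq> {..<n}" and S: "S \<subseteq> {..<length xs}"
    and sep: "\<And>x y. x \<in> S \<Longrightarrow> y \<in> S \<Longrightarrow> x \<noteq> y \<Longrightarrow>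
      length xs < dif (\<lambda>i j. near_adj (xs ! i) (xs ! j)) {..<length xs} x y * Q" for xs S
  proof (cases "xs = []")
    case True
    then show ?thesis using S by (simp add: net_bound_def)
  next
    case False
    have "card S \<le> type_bound c d (2 * c * Q)"
      by (rule hub_subset.packing[OF hub_subset_list[OF xs(2) False] S c]) (use sep in simp)
    then show ?thesis by (simp add: net_bound_def)
  qed
  show "n = n" ..
  show "distinct (adj ! i) \<and> set (adj ! i) \<subseteq> {..<n} - {i}" if i: "i < n" for i
  proof -
    have "distinct (adj ! i)" "set (adj ! i) = {j. j < n \<and> {f i, f j} \<in> edges H}"
      using adj i by (auto simp: adj_lists_def)
    then show ?thesis using edge_near_adj[OF i] by auto
  qed
  show "near_adj i j \<longleftrightarrow> i = j \<or> j \<in> set (adj ! i)" if ij: "i < n" "j < n" for i j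
  proof -
    have "set (adj ! i) = {j. j < n \<and> {f i, f j} \<in> edges H}" using adj ij by (auto simp: adj_lists_def)
    then show ?thesis using edge_near_adj[OF ij] near_adj_refl ij by auto
  qed
qed

text \<open>The certificate was made without knowing the clique number. Degeneracy on
  \<open>S\<close> now shows that a maximum clique is a constant fraction of \<open>xs\<close>, and
  then some center of the net has a large universal set at some scale, which \<open>best\<close> has
  already taken into account.\<close>

lemma certified_ratio:
  assumes gm: "graph_memory W n Z Q R near_adj adj"
    and K: "K \<subseteq> {..<n}" "\<And>x y. x \<in> K \<Longrightarrow> y \<in> K \<Longrightarrow> near_adj x y" "card K = clique_number H" "2 \<le> card K"
    and cert: "peeling.certified n Q near_adj K best"
  shows "card K \<le> ratio * best"
proof -
  interpret graph_memory W n Z Q R near_adj adj by (rule gm)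
  obtain xs S where xs: "distinct xs" "K \<subseteq> set xs" "set xs \<subseteq> S" "S \<subseteq> {..<n}"
    "\<And>v. v \<in> S \<Longrightarrow> length xs \<le> card {u \<in> S. near_adj v u}" and net: "netted xs best"
    using cert unfolding certified_def by blast
  have "xs \<noteq> []" using xs(2) K(4) by auto
  have "length xs \<le> 2 * c * clique_number H"
  proof (rule hub_graph.degeneracy_le[OF hub_graph_index xs(4)])
    show "finite S" using xs(4) finite_subset by blast
    show "S \<noteq> {}" using xs(3) \<open>xs \<noteq> []\<close> by auto
    show "length xs \<le> card {u \<in> S. near_adj v u}" if "v \<in> S" for v using xs(5) that .
    show "card A \<le> clique_number H" if A: "A \<subseteq> S" "\<And>x y. x \<in> A \<Longrightarrow> y \<in> A \<Longrightarrow> near_adj x y" for A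
    proof -
      have "A \<subseteq> {..<n}" using A(1) xs(4) by blast
      from clique_image[OF this A(2)] show ?thesis using card_clique_le[OF vertsH(2)] by metis
    qed
  qed
  then have len: "length xs \<le> \<kappa> * card K" by (simp add: K(3))
  define K' where "K' = {i. i < length xs \<and> xs ! i \<in> K}"
  have "(!) xs ` K' = K" using xs(2) by (auto simp: K'_def in_set_conv_nth image_def) (metis in_set_conv_nth subsetD)
  moreover have "inj_on ((!) xs) K'" by (rule inj_on_nth[OF xs(1)]) (auto simp: K'_def)
  ultimately have cK': "card K' = card K" by (metis card_image)
  obtain ss where ss: "\<And>x. x < length xs \<Longrightarrow> \<exists>a\<in>ss. dif (ladj xs) {..<length xs} a x * Q \<le> length xs"
    "\<And>a. a \<in> ss \<Longrightarrow> found xs a best" using net unfolding netted_def by blast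
  have sub: "set xs \<subseteq> {..<n}" using xs by blast
  have "\<exists>s\<in>ss. \<exists>q\<in>{1..Q}. card {..<length xs} \<le> 2 * \<kappa> * type_bound c d Q *
      card (universal (ladj xs) (near (ladj xs) {..<length xs} s q))"
    unfolding clique_scale_def
  proof (rule hub_subset.large_universal_set[OF hub_subset_list[OF sub \<open>xs \<noteq> []\<close>] c])
    show "0 < \<kappa>" using c by simp
    show "K' \<subseteq> {..<length xs}" by (auto simp: K'_def)
    show "near_adj (xs ! x) (xs ! y)" if "x \<in> K'" "y \<in> K'" for x y using that K(2) by (simp add: K'_def)
    show "card {..<length xs} \<le> \<kappa> * card K'" using len cK' by simp
    show "\<exists>s\<in>ss. dif (ladj xs) {..<length xs} s x * scale c d \<kappa> (2 * c * \<kappa>) \<le> card {..<length xs}"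
      if "x \<in> {..<length xs}" for x using ss(1)[of x] that by (simp add: clique_scale_def)
  qed
  then obtain s q where sq: "s \<in> ss" "q \<in> {1..Q}"
    "length xs \<le> ratio * card (universal (ladj xs) (near (ladj xs) {..<length xs} s q))"
    by (auto simp: clique_ratio_def)
  have "card (universal (ladj xs) (near (ladj xs) {..<length xs} s q)) \<le> best"
    using ss(2)[OF sq(1)] sq(2) by (simp add: found_def)
  then have "length xs \<le> ratio * best" using sq(3) by (meson mult_le_mono2 order_trans)
  moreover have "card K \<le> length xs" using xs(1,2) by (metis List.finite_set card_mono distinct_card)
  ultimately show ?thesis by linarith
qed

lemma ratio_pos: "0 < ratio"
  using c by (simp add: clique_ratio_def type_bound_def)

lemma clique_prog_correct:
  "wp ((n + 2) ^ (Q + R + 6)) (clique_prog Q R) (\<lambda>t s.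
     t \<le> (6000 * ((R + 1) * (Q + 1)) + 1000) * (card (verts H) * card (edges H) + 1) \<and>
     output_set s \<subseteq> {..<n} \<and> clique H (f ` output_set s) \<and>
     clique_number H \<le> ratio * card (f ` output_set s)) (initial_state (graph_input adj))"
proof -
  define W where "W = (n + 2) ^ (Q + R + 6)"
  have gm: "graph_memory W n (n * n + n + 3) Q R near_adj adj" by (rule graph_memory[OF W_def])
  interpret graph_memory W n "n * n + n + 3" Q R near_adj adj by (rule gm)
  define m where "m = card (edges H)"
  have nH: "card (verts H) = n" using bij_betw_same_card[OF bij] by simp
  show ?thesis unfolding W_def[symmetric] nH m_def[symmetric]
  proof (rule wp_mono[OF clique_prog])
    fix t s assume *: "t \<le> 200 + (if concat adj = [] then 0 else
      100 * (n + length (concat adj) + 1) + time_const * n * (length (concat adj) + 1)) \<and>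
      out_ok s \<and> (\<forall>K. cliq K \<longrightarrow> certified K (var s 0))"
    have "t \<le> (6000 * ((R + 1) * (Q + 1)) + 1000) * (n * m + 1)"
    proof (cases "concat adj = []")
      case True
      then show ?thesis using * by simp
    next
      case False
      have L: "length (concat adj) \<le> 2 * m" using length_concat_adj_le[OF simpleH adj] by (simp add: m_def)
      have "0 < length (concat adj)" using False by simp
      \<comment> \<open>With at least one vertex and one edge, both \<open>n\<close> and
        \<open>m\<close> are bounded by \<open>n * m\<close>, which absorbs the linear time for
        reading the input.\<close>
      then have m: "1 \<le> m" using L by linarith
      have n1: "1 \<le> n" using ne by (simp add: Suc_le_eq)
      have "n * 1 \<le> n * m" "1 * m \<le> n * m" using m n1 by (intro mult_le_mono; simp)+
      then have nm: "n \<le> n * m" "m \<le> n * m" by simp_all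
      have "time_const * n * (length (concat adj) + 1) \<le> time_const * n * (3 * m)"
        using L m by (intro mult_le_mono2) linarith
      also have "\<dots> = 3 * time_const * (n * m)" by (simp add: mult_ac)
      finally have "time_const * n * (length (concat adj) + 1) \<le> 3 * time_const * (n * m)" .
      moreover have "100 * (n + length (concat adj) + 1) \<le> 300 * (n * m) + 100"
      proof -
        have "100 * (n + length (concat adj) + 1) = 100 * n + 100 * length (concat adj) + 100" by simp
        then show ?thesis using L nm by linarith
      qed
      moreover have "t \<le> 200 + (100 * (n + length (concat adj) + 1) + time_const * n * (length (concat adj) + 1))"
        using * unfolding if_not_P[OF False] by blast
      moreover have "t \<le> y + x + 300" if "b \<le> y" "a \<le> x + 100" "t \<le> 200 + (a + b)" for a b x y
        using that by simp
      ultimately have "t \<le> 3 * time_const * (n * m) + 300 * (n * m) + 300" by blast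
      also have "\<dots> \<le> (3 * time_const + 1000) * (n * m + 1)" by (simp add: algebra_simps)
      also have "3 * time_const = 6000 * ((R + 1) * (Q + 1))" unfolding time_const_def by (simp only: mult.assoc[symmetric])
      finally show ?thesis .
    qed
    moreover obtain zs where zs: "output_set s = set zs" "length zs = var s 0" "distinct zs" "zs \<noteq> []" "set zs \<subseteq> {..<n}"
      "\<And>x y. x \<in> set zs \<Longrightarrow> y \<in> set zs \<Longrightarrow> near_adj x y"
      using output_set_out_ok * by blast
    note img = clique_image[OF zs(5,6)]
    have cz: "card (f ` output_set s) = var s 0" using img(2) zs by (simp add: distinct_card)
    have "clique_number H \<le> ratio * var s 0"
    proof (cases "clique_number H \<le> 1")
      \<comment> \<open>The certificates concern cliques of at least two vertices; below that size a
        nonempty output is enough.\<close>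
      case True
      have "1 \<le> var s 0" using zs(2,4) by (cases zs) auto
      then have "1 * 1 \<le> ratio * var s 0" using ratio_pos by (intro mult_le_mono) auto
      then show ?thesis using True by linarith
    next
      case False
      obtain K0 where K0: "clique H K0" "card K0 = clique_number H" using maximum_clique[OF vertsH(2)] by blast
      define K where "K = {i. i < n \<and> f i \<in> K0}"
      have "f ` K = K0" using K0(1) bij unfolding K_def clique_def bij_betw_def by auto
      moreover have "inj_on f K" by (rule inj_on_subset[OF inj]) (auto simp: K_def)
      ultimately have cK: "card K = clique_number H" using K0(2) by (metis card_image)
      have adjK: "near_adj x y" if "x \<in> K" "y \<in> K" for x y
      proof (cases "x = y")
        case True
        then show ?thesis using near_adj_refl that by (simp add: K_def)
      next
        case False
        have lt: "x < n" "y < n" using that by (auto simp: K_def)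
        then have "f x \<noteq> f y" using inj False by (auto simp: inj_on_def)
        then have "{f x, f y} \<in> edges H" using K0(1) that by (auto simp: K_def clique_def)
        then show ?thesis using edge_near_adj lt by simp
      qed
      have "cliq K" unfolding cliq_def using adjK cK False by (auto simp: K_def)
      then have "certified K (var s 0)" using * by blast
      then have "card K \<le> ratio * var s 0"
        by (intro certified_ratio[OF gm]) (use adjK cK False in \<open>auto simp: K_def\<close>)
      then show ?thesis using cK by simp
    qed
    ultimately show "t \<le> (6000 * ((R + 1) * (Q + 1)) + 1000) * (n * m + 1) \<and> output_set s \<subseteq> {..<n} \<and>
      clique H (f ` output_set s) \<and> clique_number H \<le> ratio * card (f ` output_set s)"
      using img(1) zs(1,5) cz by simp
  qed
qed

end

theorem theorem6p2:
  fixes C :: "'a ugraph set" and d :: nat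
  assumes "\<And>G. G \<in> C \<Longrightarrow> simple_graph G"
    and "bounded_expansion C"
  shows "\<exists>s::nat. s > 0 \<and>
    (\<exists>(prog::com) (b::nat) (c::nat).
      \<forall>H \<in> induced_closure (class_power C d). \<forall>f adj. adj_lists H f adj \<longrightarrow>
        (let n = card (verts H); m = card (edges H) in
          \<exists>t st. exec ((n + 2) ^ b) prog (initial_state (graph_input adj)) t st \<and>
            t \<le> c * (n * m + 1) \<and>
            output_set st \<subseteq> {..<n} \<and>
            clique H (f ` output_set st) \<and>
            real (card (f ` output_set st)) \<ge> 1 / real s * real (clique_number H)))"
proof -
  obtain c0 where c0: "\<And>G. G \<in> C \<Longrightarrow> \<exists>lab :: 'a \<Rightarrow> ('a \<times> nat) set.
      hub_labelling (verts G) c0 d lab (\<lambda>x y. gdist G x y \<le> enat d)"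
    using bounded_expansion_hub_labelling[OF assms, of d] by blast
  \<comment> \<open>The packing argument and the growth of the scales need a positive bound on the
    number of labels.\<close>
  define c where "c = max 1 c0"
  define Q where "Q = clique_scale d c"
  define R where "R = net_bound d c"
  define s where "s = clique_ratio d c"
  define T where "T = 6000 * ((R + 1) * (Q + 1)) + 1000"
  have s_pos: "0 < s"
    by (simp add: s_def clique_ratio_def type_bound_def c_def)
  have run: "\<exists>t st. exec ((card (verts H) + 2) ^ (Q + R + 6)) (clique_prog Q R) (initial_state (graph_input adj)) t st \<and>
      t \<le> T * (card (verts H) * card (edges H) + 1) \<and> output_set st \<subseteq> {..<card (verts H)} \<and>
      clique H (f ` output_set st) \<and> real (card (f ` output_set st)) \<ge> 1 / real s * real (clique_number H)"
    if H: "H \<in> induced_closure (class_power C d)" and adj: "adj_lists H f adj" for H f adj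
  proof -
    obtain G where G: "G \<in> C" "induced_subgraph H (graph_power G d)"
      using H by (auto simp: induced_closure_def class_power_def)
    obtain lab :: "'a \<Rightarrow> ('a \<times> nat) set" where "hub_labelling (verts G) c0 d lab (\<lambda>x y. gdist G x y \<le> enat d)"
      using c0[OF G(1)] by blast
    then have lab: "hub_labelling (verts G) c d lab (\<lambda>x y. gdist G x y \<le> enat d)"
      by (rule hub_labelling_mono) (simp add: c_def)
    have nH: "card (verts H) = length adj"
      using adj bij_betw_same_card[of f "{..<length adj}" "verts H"] by (simp add: adj_lists_def)
    show ?thesis
    proof (cases "adj = []")
      \<comment> \<open>Without vertices there is not even a vertex 0 to output; the program stops
        at once with an empty list, and the clique number is 0.\<close>
      case True
      then have V: "verts H = {}" using adj by (simp add: adj_lists_def bij_betw_def)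
      have "{K. clique H K} = {{}}" using V by (auto simp: clique_def)
      then have om: "clique_number H = 0" by (simp add: clique_number_def)
      obtain t st where run: "exec ((card (verts H) + 2) ^ (Q + R + 6)) (clique_prog Q R) (initial_state (graph_input [])) t st"
        and "t \<le> 10" "output_set st = {}"
        using clique_prog_empty[of "(card (verts H) + 2) ^ (Q + R + 6)" Q R] unfolding wp_def by (auto simp del: power_Suc)
      moreover have "T * (card (verts H) * card (edges H) + 1) \<ge> 10" by (simp add: T_def)
      ultimately have rest: "t \<le> T * (card (verts H) * card (edges H) + 1) \<and> output_set st \<subseteq> {..<card (verts H)} \<and>
          clique H (f ` output_set st) \<and> real (card (f ` output_set st)) \<ge> 1 / real s * real (clique_number H)"
        unfolding om by (simp add: clique_def)
      show ?thesis unfolding True by (intro exI conjI, rule run) (use rest in blast)+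
    next
      case False
      then interpret power_input G H d c lab f adj
        using assms(1)[OF G(1)] G(2) lab adj by unfold_locales (simp_all add: c_def)
      obtain t st where *: "exec ((card (verts H) + 2) ^ (Q + R + 6)) (clique_prog Q R) (initial_state (graph_input adj)) t st"
        "t \<le> T * (card (verts H) * card (edges H) + 1)" "output_set st \<subseteq> {..<card (verts H)}"
        "clique H (f ` output_set st)" "clique_number H \<le> s * card (f ` output_set st)"
        using clique_prog_correct unfolding wp_def nH Q_def R_def s_def T_def by blast
      have "real (clique_number H) \<le> real s * real (card (f ` output_set st))"
        using *(5) by (metis of_nat_le_iff of_nat_mult)
      then have "real (card (f ` output_set st)) \<ge> 1 / real s * real (clique_number H)"
        using s_pos by (simp add: field_simps)
      then show ?thesis using * by blast
    qed
  qed
  show ?thesis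
  proof (intro exI conjI ballI allI impI)
    show "0 < s" by (rule s_pos)
    fix H :: "'a ugraph" and f adj
    assume "H \<in> induced_closure (class_power C d)" "adj_lists H f adj"
    from run[OF this] show "let n = card (verts H); m = card (edges H) in
      \<exists>t st. exec ((n + 2) ^ (Q + R + 6)) (clique_prog Q R) (initial_state (graph_input adj)) t st \<and>
        t \<le> T * (n * m + 1) \<and> output_set st \<subseteq> {..<n} \<and> clique H (f ` output_set st) \<and>
        real (card (f ` output_set st)) \<ge> 1 / real s * real (clique_number H)"
      unfolding Let_def .
  qed
qed

end
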